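(* As $n\to\infty$, $$\operatorname{Vol}(\mathcal{P}_{3,n}\cap \mathcal{D}_{3,n})-\operatorname{Vol}(\mathcal{H}_{3,n})\sim\frac{\pi}{12\sqrt3}\,\frac{1}{2^n\,n^2}\Bigl(\frac23\Bigr)^{n},$$ and hence $$1-\frac{\operatorname{Vol}(\mathcal{H}_{3,n})}{\operatorname{Vol}(\mathcal{P}_{3,n}\cap \mathcal{D}_{3,n})}\sim\frac{2}{3\sqrt{3\pi}}\,\frac{1}{\sqrt n}\Bigl(\frac23\Bigr)^{n}.$$
   Context: For integers $m\ge2$, $n\ge1$, let $\mathcal{P}_{m,n}$ be the set of $(x,y)\in\mathbb{R}^{m\times n}\times\mathbb{R}^m$ with $0\le x_{ij}\le y_i$ for all $1\le i\le m$, $1\le j\le n$, and $y_i\le 1$ for all $i$. Let $\mathcal{D}_{m,n}=\{(x,y)\in\mathbb{R}^{m\times n}\times\mathbb{R}^m:\ \sum_{i=1}^m x_{ij}=1\ \text{for all } 1\le j\le n\}$, an affine subspace of dimension $d=(m-1)n+m$. The integer hull is $\mathcal{H}_{m,n}:=\operatorname{conv}\{(x,y)\in \mathcal{P}_{m,n}\cap \mathcal{D}_{m,n}:\ y\in\{0,1\}^m\}$. For $K\subset\mathcal{D}_{m,n}$, $\operatorname{Vol}(K)$ denotes the $d$-dimensional Lebesgue measure of the image of $K$ under the coordinate projection $\mathcal{D}_{m,n}\to\mathbb{R}^d$ that deletes the variables $x_{mj}$, $1\le j\le n$ (an affine bijection). $a\sim b$ means $a/b\to1$. *)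

theory Defs
  imports
    "HOL-Analysis.Analysis"
    "HOL-Analysis.Finite_Function_Topology"
    "HOL-Library.Landau_Symbols"
begin

text \<open>
  Since \<open>n\<close> varies, \<open>\<real>\<^bsup>m\<times>n\<^esup> \<times> \<real>\<^bsup>m\<^esup>\<close> cannot be given by a type. Its points are represented by
  pairs of finitely supported functions that vanish outside the index ranges
  \<open>1 \<le> i \<le> m\<close>, \<open>1 \<le> j \<le> n\<close>; these form a subspace of a real vector space,
  so that the library's convex hull is available.
\<close>

type_synonym point = "((nat \<times> nat) \<Rightarrow>\<^sub>0 real) \<times> (nat \<Rightarrow>\<^sub>0 real)"

definition ambient :: "nat \<Rightarrow> nat \<Rightarrow> point set" where
  "ambient m n =
     {(x, y). Poly_Mapping.keys x \<subseteq> {1..m} \<times> {1..n} \<and> Poly_Mapping.keys y \<subseteq> {1..m}}"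

definition P_set :: "nat \<Rightarrow> nat \<Rightarrow> point set" where
  "P_set m n =
     {(x, y) \<in> ambient m n.
        (\<forall>i\<in>{1..m}. \<forall>j\<in>{1..n}.
           0 \<le> Poly_Mapping.lookup x (i, j) \<and>
           Poly_Mapping.lookup x (i, j) \<le> Poly_Mapping.lookup y i) \<and>
        (\<forall>i\<in>{1..m}. Poly_Mapping.lookup y i \<le> 1)}"

definition D_set :: "nat \<Rightarrow> nat \<Rightarrow> point set" where
  "D_set m n =
     {(x, y) \<in> ambient m n. \<forall>j\<in>{1..n}. (\<Sum>i=1..m. Poly_Mapping.lookup x (i, j)) = 1}"

definition integer_hull :: "nat \<Rightarrow> nat \<Rightarrow> point set" where
  "integer_hull m n =
     convex hull {(x, y) \<in> P_set m n \<inter> D_set m n. \<forall>i\<in>{1..m}. Poly_Mapping.lookup y i \<in> {0, 1}}"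

text \<open>
  The coordinate projection deleting the variables \<open>x\<^sub>m\<^sub>j\<close>. Its target \<open>\<real>\<^bsup>d\<^esup>\<close>,
  \<open>d = (m - 1) n + m\<close>, is modelled by the extensional functions on the remaining indices,
  and Lebesgue measure on it is the completion of the product of one-dimensional measures.
\<close>

definition coord_proj :: "nat \<Rightarrow> nat \<Rightarrow> point \<Rightarrow> ((nat \<times> nat) \<Rightarrow> real) \<times> (nat \<Rightarrow> real)" where
  "coord_proj m n =
     (\<lambda>(x, y). (restrict (Poly_Mapping.lookup x) ({1..<m} \<times> {1..n}),
               restrict (Poly_Mapping.lookup y) {1..m}))"

definition coord_lebesgue :: "nat \<Rightarrow> nat \<Rightarrow> (((nat \<times> nat) \<Rightarrow> real) \<times> (nat \<Rightarrow> real)) measure" where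
  "coord_lebesgue m n =
     completion (Pi\<^sub>M ({1..<m} \<times> {1..n}) (\<lambda>_. lborel) \<Otimes>\<^sub>M Pi\<^sub>M {1..m} (\<lambda>_. lborel))"

definition Vol :: "nat \<Rightarrow> nat \<Rightarrow> point set \<Rightarrow> real" where
  "Vol m n K = measure (coord_lebesgue m n) (coord_proj m n ` K)"

end

theory Submission
  imports Defs "HOL-Probability.Probability" "HOL-Real_Asymp.Real_Asymp"
begin

text \<open>
  A point \<open>(x, y)\<close> of \<open>P \<inter> D\<close> lies in the integer hull iff \<open>y\<^sub>1 + y\<^sub>2 + y\<^sub>3 + \<mu>\<^sub>1 + \<mu>\<^sub>2 + \<mu>\<^sub>3 \<ge> 2\<close>, where
  \<open>\<mu>\<^sub>i = min\<^sub>j x\<^sub>i\<^sub>j\<close>. For fixed \<open>y\<close> with \<open>\<tau> = y\<^sub>1 + y\<^sub>2 + y\<^sub>3 - 1 > 0\<close>, put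
  \<open>c\<^sub>i = 1 - (y\<^sub>i - \<mu>\<^sub>i) / \<tau>\<close>; then the violated inequality reads \<open>c\<^sub>1 + c\<^sub>2 + c\<^sub>3 < 1\<close>. The fibre
  points with \<open>c \<ge> a\<close> have volume \<open>(\<tau>\<^sup>2 (1 - |a|\<^sup>2) / 2)\<^sup>n\<close> (a triangle minus three disjoint
  corners, to the power \<open>n\<close>), so \<open>c\<close> has the density
  \<open>\<tau>\<^sup>2\<^sup>n n (n - 1) (n - 2) c\<^sub>1 c\<^sub>2 c\<^sub>3 ((1 - |c|\<^sup>2) / 2)\<^sup>n\<^sup>-\<^sup>3\<close>. Integrating over \<open>y\<close> first is elementary
  once \<open>y\<^sub>i \<le> 1\<close> is dropped, an exponentially small relative error.
  What remains is a Laplace integral over \<open>c\<close> concentrated at \<open>(1/3, 1/3, 1/3)\<close>, on scale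
  \<open>1/\<surd>n\<close> along the face \<open>c\<^sub>1 + c\<^sub>2 + c\<^sub>3 = 1\<close> and \<open>1/n\<close> across it. The volume of
  \<open>P \<inter> D\<close> is a Laplace integral concentrated at \<open>y = (1, 1, 1)\<close>.
\<close>

section \<open>The odd cycle inequalities describe the integer hull\<close>

text \<open>Minima enter the hull condition for the following reason. A hull point amounts to a
  probability distribution on the nonempty supports S together with, for each column j, a flow of
  the weight of S to its elements. The weights are common to all columns, and the columns interact
  only through the singletons, whose weights must stay below the row minima.

  The orthant formula needs disjoint corners. It is used for a_1 + a_2 + a_3 <= 1 only, so the law
  of c is identified on the simplex itself, with boxes contained in it as generators.

  Let zeta = 2 - c_1 - c_2 - c_3 and w = tau * zeta. The y-integral becomes zeta^-(2n+1) times the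
  integral of w^(2n) (1-w)^2 / 2, about 1/(8 n^3), which absorbs the factor n (n-1) (n-2) of the
  density. For c_i >= 1/6 and w >= 5/6 the bounds y_i <= 1 hold automatically, so dropping them
  gives an upper bound and restricting c and w a lower bound of the same order. At c = (1/3, 1/3,
  1/3) the base is 1/3 and zeta = 1, whence 3^-n; the rescaling of c gives n^-2, and the constant is
  1/8 times the Gaussian integral 2 pi / (3 sqrt 3).\<close>

abbreviation "lookup \<equiv> Poly_Mapping.lookup"

lemma lookup_scaleR_poly_mapping [simp]:
  "lookup (r *\<^sub>R x) i = r * lookup x i"
proof -
  have "finite {i. r * lookup x i \<noteq> 0}"
    by (rule finite_subset[OF _ finite_keys[of x]]) (auto simp: in_keys_iff)
  then show ?thesis by (simp add: scaleR_poly_mapping_def)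
qed

lemma ambient_iff:
  "(x, y) \<in> ambient m n \<longleftrightarrow>
    (\<forall>i j. i \<notin> {1..m} \<or> j \<notin> {1..n} \<longrightarrow> lookup x (i, j) = 0) \<and>
    (\<forall>i. i \<notin> {1..m} \<longrightarrow> lookup y i = 0)"
  unfolding ambient_def by (simp only: mem_Collect_eq prod.case subset_iff in_keys_iff split_paired_All mem_Sigma_iff) blast

text \<open>A convex combination read as a flow: \<open>lam S\<close> is the weight of the support
  S, and the values \<open>f S i j / lam S\<close> form column j of a feasible point whose y is the
  indicator of S. Only the weights are shared, so each column may be routed on its own.\<close>

lemma integer_hull_flowI:
  fixes lam :: "nat set \<Rightarrow> real" and f :: "nat set \<Rightarrow> nat \<Rightarrow> nat \<Rightarrow> real"
  assumes amb: "(x, y) \<in> ambient m n"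
    and lam: "\<And>S. S \<in> Pow {1..m} - {{}} \<Longrightarrow> 0 \<le> lam S" "sum lam (Pow {1..m} - {{}}) = 1"
    and f: "\<And>S i j. \<lbrakk>S \<in> Pow {1..m} - {{}}; i \<in> S; j \<in> {1..n}\<rbrakk> \<Longrightarrow> 0 \<le> f S i j"
      "\<And>S j. \<lbrakk>S \<in> Pow {1..m} - {{}}; j \<in> {1..n}\<rbrakk> \<Longrightarrow> (\<Sum>i\<in>S. f S i j) = lam S"
    and x: "\<And>i j. \<lbrakk>i \<in> {1..m}; j \<in> {1..n}\<rbrakk> \<Longrightarrow>
      lookup x (i, j) = (\<Sum>S\<in>Pow {1..m} - {{}}. if i \<in> S then f S i j else 0)"
    and y: "\<And>i. i \<in> {1..m} \<Longrightarrow>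
      lookup y i = (\<Sum>S\<in>Pow {1..m} - {{}}. if i \<in> S then lam S else 0)"
  shows "(x, y) \<in> integer_hull m n"
proof -
  let ?\<S> = "Pow {1..m} - {{}}"
  \<comment> \<open>If \<open>lam S = 0\<close> the quotient carries no information; the unit is
    then given to \<open>Min S\<close>, so that every column still sums to 1 and the point stays
    feasible.\<close>
  define g where "g S i j = (if lam S > 0 then f S i j / lam S else if i = Min S then 1 else 0)"
    for S :: "nat set" and i j :: nat
  define vx where "vx S = Abs_poly_mapping (\<lambda>(i, j). if i \<in> S \<and> j \<in> {1..n} then g S i j else 0)"
    for S :: "nat set"
  define vy where "vy S = Abs_poly_mapping (\<lambda>i. if i \<in> S then 1 else 0 :: real)" for S :: "nat set"
  have fin: "finite S" if "S \<in> ?\<S>" for S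
    using that by (meson Diff_iff PowD finite_atLeastAtMost finite_subset)
  have lx: "lookup (vx S) (i, j) = (if i \<in> S \<and> j \<in> {1..n} then g S i j else 0)"
    if "S \<in> ?\<S>" for S i j
  proof -
    have "finite {p. (case p of (i, j) \<Rightarrow> if i \<in> S \<and> j \<in> {1..n} then g S i j else 0) \<noteq> 0}"
      by (rule finite_subset[of _ "S \<times> {1..n}"]) (use fin[OF that] in \<open>auto split: if_splits\<close>)
    then show ?thesis by (simp add: vx_def)
  qed
  have ly: "lookup (vy S) i = (if i \<in> S then 1 else 0)" if "S \<in> ?\<S>" for S i
    using fin[OF that] by (simp add: vy_def)
  have g0: "0 \<le> g S i j" if "S \<in> ?\<S>" "i \<in> S" "j \<in> {1..n}" for S i j
    using f(1)[OF that] by (simp add: g_def)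
  have g1: "(\<Sum>i\<in>S. g S i j) = 1" if "S \<in> ?\<S>" "j \<in> {1..n}" for S j
  proof (cases "lam S > 0")
    case True
    then show ?thesis using f(2)[OF that] by (simp add: g_def flip: sum_divide_distrib)
  next
    case False
    have "(\<Sum>i\<in>S. g S i j) = (\<Sum>i\<in>S. if i = Min S then 1 else 0)"
      using False by (simp add: g_def)
    also have "\<dots> = 1"
      using fin[OF that(1)] that(1) by (simp add: sum.delta)
    finally show ?thesis .
  qed
  have gle: "g S i j \<le> 1" if "S \<in> ?\<S>" "i \<in> S" "j \<in> {1..n}" for S i j
    using member_le_sum[of i S "\<lambda>i. g S i j"] g0[OF that(1) _ that(3)] g1[OF that(1,3)] that(2) fin[OF that(1)]
    by auto
  have v: "(vx S, vy S) \<in> {(x, y) \<in> P_set m n \<inter> D_set m n. \<forall>i\<in>{1..m}. lookup y i \<in> {0, 1}}"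
    if S: "S \<in> ?\<S>" for S
  proof -
    have "(vx S, vy S) \<in> ambient m n"
      using S by (auto simp: ambient_def in_keys_iff lx[OF S] ly[OF S] split: if_splits)
    moreover have "(\<Sum>i=1..m. lookup (vx S) (i, j)) = 1" if "j \<in> {1..n}" for j
    proof -
      have "(\<Sum>i=1..m. lookup (vx S) (i, j)) = (\<Sum>i\<in>S. g S i j)"
        using that S by (intro sum.mono_neutral_cong_right) (auto simp: lx[OF S])
      then show ?thesis using g1[OF S that] by simp
    qed
    ultimately show ?thesis
      using g0[OF S] gle[OF S] by (auto simp: P_set_def D_set_def lx[OF S] ly[OF S])
  qed
  have lamf: "lam S * g S i j = f S i j" if "S \<in> ?\<S>" "i \<in> S" "j \<in> {1..n}" for S i j
  proof (cases "lam S > 0")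
    case False
    then have l0: "lam S = 0" using lam(1)[OF that(1)] by simp
    \<comment> \<open>Nonnegative terms with sum \<open>lam S = 0\<close> vanish, so the default in
      \<open>g\<close> disappears after weighting.\<close>
    have "f S i j = 0"
      using sum_nonneg_eq_0_iff[OF fin[OF that(1)], of "\<lambda>i. f S i j"] f(1)[OF that(1) _ that(3)]
        f(2)[OF that(1,3)] l0 that(2) by simp
    then show ?thesis using l0 by simp
  qed (simp add: g_def)
  have kx: "lookup x (i, j) = 0" if "\<not> (i \<in> {1..m} \<and> j \<in> {1..n})" for i j
    using amb that by (auto simp: ambient_iff)
  have ky: "lookup y i = 0" if "i \<notin> {1..m}" for i
    using amb that by (auto simp: ambient_iff)
  have "x = (\<Sum>S\<in>?\<S>. lam S *\<^sub>R vx S)"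
  proof (rule poly_mapping_eqI)
    fix p :: "nat \<times> nat"
    obtain i j where p: "p = (i, j)" by force
    show "lookup x p = lookup (\<Sum>S\<in>?\<S>. lam S *\<^sub>R vx S) p"
    proof (cases "i \<in> {1..m} \<and> j \<in> {1..n}")
      case True
      then show ?thesis
        unfolding p lookup_sum lookup_scaleR_poly_mapping
        using x[of i j] True by (simp only:) (rule sum.cong[OF refl], simp only: lx, simp add: lamf)
    next
      case False
      then have "lam S * lookup (vx S) (i, j) = 0" if "S \<in> ?\<S>" for S
        using that by (auto simp: lx[OF that])
      then show ?thesis
        unfolding p lookup_sum lookup_scaleR_poly_mapping kx[OF False]
        by (metis (no_types, lifting) sum.neutral)
    qed
  qed
  moreover have "y = (\<Sum>S\<in>?\<S>. lam S *\<^sub>R vy S)"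
  proof (rule poly_mapping_eqI)
    fix i
    show "lookup y i = lookup (\<Sum>S\<in>?\<S>. lam S *\<^sub>R vy S) i"
    proof (cases "i \<in> {1..m}")
      case True
      then show ?thesis
        unfolding lookup_sum lookup_scaleR_poly_mapping
        using y[OF True] by (simp only:) (rule sum.cong[OF refl], simp only: ly, simp)
    next
      case False
      then have "lam S * lookup (vy S) i = 0" if "S \<in> ?\<S>" for S
        using that by (auto simp: ly[OF that])
      then show ?thesis
        unfolding lookup_sum lookup_scaleR_poly_mapping ky[OF False]
        by (metis (no_types, lifting) sum.neutral)
    qed
  qed
  ultimately have "(x, y) = (\<Sum>S\<in>?\<S>. lam S *\<^sub>R (vx S, vy S))"
    by (simp add: scaleR_prod_def sum_prod prod_eq_iff fst_sum snd_sum)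
  also have "\<dots> \<in> integer_hull m n"
    unfolding integer_hull_def
    by (intro convex_sum lam hull_inc v convex_convex_hull) auto
  finally show ?thesis .
qed

section \<open>Distributing weights and flows over the subsets of {1, 2, 3}\<close>

lemma ex_between_sum3:
  fixes e :: real
  assumes "l1 \<le> u1" "l2 \<le> u2" "l3 \<le> u3" "l1 + l2 + l3 \<le> e" "e \<le> u1 + u2 + u3"
  obtains h1 h2 h3 where "l1 \<le> h1" "h1 \<le> u1" "l2 \<le> h2" "h2 \<le> u2" "l3 \<le> h3" "h3 \<le> u3"
    "h1 + h2 + h3 = e"
proof
  \<comment> \<open>Greedy choice: each term takes its upper bound, unless this would push a later
    term below its lower bound.\<close>
  define h1 where "h1 = min u1 (e - l2 - l3)"
  define h2 where "h2 = min u2 (e - h1 - l3)"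
  show "l1 \<le> h1" "h1 \<le> u1" "l2 \<le> h2" "h2 \<le> u2" "l3 \<le> e - h1 - h2" "e - h1 - h2 \<le> u3"
    "h1 + h2 + (e - h1 - h2) = e"
    using assms by (auto simp: h1_def h2_def min_def)
qed

text \<open>Flow from the three two-element subsets of \<open>{1, 2, 3}\<close>, with supplies \<open>T\<^sub>i\<close> indexed by the
  missing element, to the three elements with demands \<open>r\<^sub>i\<close>. The network is a hexagon, so one
  parameter determines the flow.\<close>

lemma ex_hexagon_flow:
  fixes T1 :: real
  assumes "0 \<le> T1" "0 \<le> T2" "0 \<le> T3" "0 \<le> r1" "0 \<le> r2" "0 \<le> r3"
    "r1 \<le> T2 + T3" "r2 \<le> T1 + T3" "r3 \<le> T1 + T2" "r1 + r2 + r3 = T1 + T2 + T3"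
  obtains p q r where "0 \<le> p" "p \<le> T3" "0 \<le> q" "q \<le> T1" "0 \<le> r" "r \<le> T2"
    "r1 = p + (T2 - r)" "r2 = q + (T3 - p)" "r3 = r + (T1 - q)"
proof
  \<comment> \<open>Conservation forces q = r2 - T3 + p and r = p + T2 - r1, and this p is the least
    one for which p, q, r are nonnegative. The upper bounds on p are T3, T1 + T3 - r2 and r1;
    comparing each lower with each upper bound yields only inequalities supplied by the
    hypotheses.\<close>
  define p where "p = max 0 (max (r1 - T2) (T3 - r2))"
  show "0 \<le> p" "p \<le> T3" "0 \<le> r2 - T3 + p" "r2 - T3 + p \<le> T1" "0 \<le> p + T2 - r1" "p + T2 - r1 \<le> T2"
    "r1 = p + (T2 - (p + T2 - r1))" "r2 = (r2 - T3 + p) + (T3 - p)"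
    "r3 = (p + T2 - r1) + (T1 - (r2 - T3 + p))"
    using assms by (auto simp: p_def)
qed

lemma atLeastAtMost_1_3: "{1..3::nat} = {1, 2, 3}"
  by auto

lemma Pow3: "Pow {1..3} - {{}} = {{1}, {2}, {3}, {1, 2}, {1, 3}, {2, 3}, {1, 2, 3::nat}}"
proof -
  have "Pow {1..3::nat} = {{}, {1}, {2}, {3}, {1, 2}, {1, 3}, {2, 3}, {1, 2, 3::nat}}"
    unfolding atLeastAtMost_1_3 by (simp only: Pow_insert Pow_empty image_insert image_empty insert_commute Un_insert_left Un_insert_right Un_empty_left Un_empty_right)
  then show ?thesis by simp
qed

text \<open>Here a_i is the weight of the singleton {i}, T_i that of the pair missing i, and w that
  of the full set. If y1 + y2 + y3 >= 2, pairs and the full set suffice. Otherwise the full set is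
  avoided and the singletons must carry 2 - (y1 + y2 + y3) in total, which fits below m1 + m2 + m3
  precisely by the last hypothesis.\<close>

lemma coverage_weights:
  fixes y1 y2 y3 m1 m2 m3 :: real
  assumes y: "0 \<le> y1" "0 \<le> y2" "0 \<le> y3" "y1 \<le> 1" "y2 \<le> 1" "y3 \<le> 1" "1 \<le> y1 + y2 + y3"
    and m: "0 \<le> m1" "0 \<le> m2" "0 \<le> m3"
      "1 - y2 - y3 \<le> m1" "1 - y1 - y3 \<le> m2" "1 - y1 - y2 \<le> m3"
      "2 \<le> m1 + m2 + m3 + y1 + y2 + y3"
  obtains a1 a2 a3 T1 T2 T3 w where
    "0 \<le> a1" "0 \<le> a2" "0 \<le> a3" "a1 \<le> m1" "a2 \<le> m2" "a3 \<le> m3" "0 \<le> T1" "0 \<le> T2" "0 \<le> T3" "0 \<le> w"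
    "a1 + a2 + a3 + T1 + T2 + T3 + w = 1"
    "y1 = a1 + T2 + T3 + w" "y2 = a2 + T1 + T3 + w" "y3 = a3 + T1 + T2 + w"
proof (cases "y1 + y2 + y3 \<ge> 2")
  case True
  show thesis
    by (rule that[of 0 0 0 "1 - y1" "1 - y2" "1 - y3" "y1 + y2 + y3 - 2"]) (use True assms in auto)
next
  case False
  \<comment> \<open>The lower bounds are the conditions T_i >= 0, rewritten with a1 + a2 + a3 = 2 -
    (y1 + y2 + y3).\<close>
  obtain a1 a2 a3 where "max 0 (1 - y2 - y3) \<le> a1" "a1 \<le> m1" "max 0 (1 - y1 - y3) \<le> a2" "a2 \<le> m2"
    "max 0 (1 - y1 - y2) \<le> a3" "a3 \<le> m3" "a1 + a2 + a3 = 2 - (y1 + y2 + y3)"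
    by (rule ex_between_sum3[of "max 0 (1 - y2 - y3)" m1 "max 0 (1 - y1 - y3)" m2
          "max 0 (1 - y1 - y2)" m3 "2 - (y1 + y2 + y3)"]) (use False assms in linarith)+
  then show thesis
    by (intro that[of a1 a2 a3 "1 - y1 - a2 - a3" "1 - y2 - a1 - a3" "1 - y3 - a1 - a2" 0]) auto
qed

text \<open>The sum of the positive parts is one of the eight partial sums. In
  \<open>coverage_flow\<close> these become one supply condition for each set of elements.\<close>

lemma sum3_max_0_le:
  fixes e :: real
  assumes "0 \<le> e" "a \<le> e" "b \<le> e" "c \<le> e" "a + b \<le> e" "a + c \<le> e" "b + c \<le> e" "a + b + c \<le> e"
  shows "max 0 a + max 0 b + max 0 c \<le> e"
  using assms by (simp add: max_def)

lemma coverage_flow: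
  fixes x1 x2 x3 :: real
  assumes a: "0 \<le> a1" "0 \<le> a2" "0 \<le> a3" "a1 \<le> x1" "a2 \<le> x2" "a3 \<le> x3"
    and T: "0 \<le> T1" "0 \<le> T2" "0 \<le> T3" "0 \<le> w"
    and "a1 + a2 + a3 + T1 + T2 + T3 + w = 1" "x1 + x2 + x3 = 1"
    and "x1 \<le> a1 + T2 + T3 + w" "x2 \<le> a2 + T1 + T3 + w" "x3 \<le> a3 + T1 + T2 + w"
  obtains h1 h2 h3 p q r where
    "0 \<le> h1" "0 \<le> h2" "0 \<le> h3" "h1 + h2 + h3 = w"
    "0 \<le> p" "p \<le> T3" "0 \<le> q" "q \<le> T1" "0 \<le> r" "r \<le> T2"
    "x1 = a1 + h1 + p + (T2 - r)" "x2 = a2 + h2 + q + (T3 - p)" "x3 = a3 + h3 + r + (T1 - q)"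
proof -
  have *: "max 0 (x1 - a1 - T2 - T3) + max 0 (x2 - a2 - T1 - T3) + max 0 (x3 - a3 - T1 - T2) \<le> w"
    by (rule sum3_max_0_le) (use assms in linarith)+
  obtain h1 h2 h3 where h: "max 0 (x1 - a1 - T2 - T3) \<le> h1" "h1 \<le> x1 - a1"
    "max 0 (x2 - a2 - T1 - T3) \<le> h2" "h2 \<le> x2 - a2"
    "max 0 (x3 - a3 - T1 - T2) \<le> h3" "h3 \<le> x3 - a3" "h1 + h2 + h3 = w"
    by (rule ex_between_sum3[of "max 0 (x1 - a1 - T2 - T3)" "x1 - a1" "max 0 (x2 - a2 - T1 - T3)" "x2 - a2"
          "max 0 (x3 - a3 - T1 - T2)" "x3 - a3" w])
      (use a T in simp, use a T in simp, use a T in simp, rule *, use assms(11,12) T in linarith)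
  obtain p q r where "0 \<le> p" "p \<le> T3" "0 \<le> q" "q \<le> T1" "0 \<le> r" "r \<le> T2"
    "x1 - a1 - h1 = p + (T2 - r)" "x2 - a2 - h2 = q + (T3 - p)" "x3 - a3 - h3 = r + (T1 - q)"
    by (rule ex_hexagon_flow[of T1 T2 T3 "x1 - a1 - h1" "x2 - a2 - h2" "x3 - a3 - h3"])
      (use assms(10-12) T h[unfolded max.bounded_iff] in linarith)+
  then show thesis
    by (intro that[of h1 h2 h3 p q r]) (use h in auto)
qed

text \<open>The column indices j1, j2, j3 are independent, which expresses the condition on the row
  minima by linear inequalities and makes convexity immediate.\<close>

definition odd_cycle_set :: "nat \<Rightarrow> point set" where
  "odd_cycle_set n = {(x, y). \<forall>j1\<in>{1..n}. \<forall>j2\<in>{1..n}. \<forall>j3\<in>{1..n}.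
     2 \<le> lookup x (1, j1) + lookup x (2, j2) + lookup x (3, j3)
       + lookup y 1 + lookup y 2 + lookup y 3}"

lemma convex_PD: "convex (P_set m n \<inter> D_set m n)"
proof (rule convexI)
  fix p q :: point and u v :: real
  assume p: "p \<in> P_set m n \<inter> D_set m n" and q: "q \<in> P_set m n \<inter> D_set m n"
    and uv: "0 \<le> u" "0 \<le> v" "u + v = 1"
  obtain x y x' y' where pq: "p = (x, y)" "q = (x', y')" by force
  let ?l = "lookup"
  have "u *\<^sub>R p + v *\<^sub>R q \<in> ambient m n"
    using p q unfolding pq P_set_def by (simp add: ambient_iff lookup_add)
  moreover have "0 \<le> u * ?l x (i, j) + v * ?l x' (i, j)"
    "u * ?l x (i, j) + v * ?l x' (i, j) \<le> u * ?l y i + v * ?l y' i"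
    if "i \<in> {1..m}" "j \<in> {1..n}" for i j
    using p q that uv unfolding pq P_set_def by (auto intro!: add_nonneg_nonneg add_mono mult_left_mono)
  moreover have "u * ?l y i + v * ?l y' i \<le> 1" if "i \<in> {1..m}" for i
    using p q that uv unfolding pq P_set_def by (intro convex_bound_le) auto
  moreover have "(\<Sum>i=1..m. u * ?l x (i, j) + v * ?l x' (i, j)) = 1" if "j \<in> {1..n}" for j
    using p q that uv unfolding pq D_set_def by (simp add: sum.distrib flip: sum_distrib_left)
  ultimately show "u *\<^sub>R p + v *\<^sub>R q \<in> P_set m n \<inter> D_set m n"
    unfolding pq P_set_def D_set_def by (auto simp: lookup_add)
qed

lemma convex_odd_cycle_set: "convex (odd_cycle_set n)"
proof (rule convexI)
  fix p q :: point and u v :: real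
  assume p: "p \<in> odd_cycle_set n" and q: "q \<in> odd_cycle_set n"
    and uv: "0 \<le> u" "0 \<le> v" "u + v = 1"
  obtain x y x' y' where pq: "p = (x, y)" "q = (x', y')" by force
  let ?s = "\<lambda>x y j1 j2 j3. lookup x (1::nat, j1::nat) + lookup x (2, j2) + lookup x (3, j3)
       + lookup y (1::nat) + lookup y 2 + lookup y 3 :: real"
  have "2 \<le> ?s (u *\<^sub>R x + v *\<^sub>R x') (u *\<^sub>R y + v *\<^sub>R y') j1 j2 j3"
    if j: "j1 \<in> {1..n}" "j2 \<in> {1..n}" "j3 \<in> {1..n}" for j1 j2 j3
  proof -
    have "2 \<le> ?s x y j1 j2 j3" "2 \<le> ?s x' y' j1 j2 j3"
      using p q j unfolding pq odd_cycle_set_def by blast+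
    then have "u * 2 + v * 2 \<le> u * ?s x y j1 j2 j3 + v * ?s x' y' j1 j2 j3"
      using uv by (intro add_mono mult_left_mono)
    then show ?thesis using uv by (simp add: lookup_add algebra_simps)
  qed
  then show "u *\<^sub>R p + v *\<^sub>R q \<in> odd_cycle_set n"
    unfolding pq odd_cycle_set_def by simp
qed

lemma integer_hull_eq:
  assumes n: "n \<ge> 1"
  shows "integer_hull 3 n = P_set 3 n \<inter> D_set 3 n \<inter> odd_cycle_set n"
proof
  show "integer_hull 3 n \<subseteq> P_set 3 n \<inter> D_set 3 n \<inter> odd_cycle_set n"
    unfolding integer_hull_def
  proof (rule hull_minimal)
    show "convex (P_set 3 n \<inter> D_set 3 n \<inter> odd_cycle_set n)"
      by (intro convex_Int[OF convex_PD] convex_odd_cycle_set)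
  next
    show "{(x, y). (x, y) \<in> P_set 3 n \<inter> D_set 3 n \<and> (\<forall>i\<in>{1..3}. lookup y i \<in> {0, 1})}
      \<subseteq> P_set 3 n \<inter> D_set 3 n \<inter> odd_cycle_set n"
    proof clarify
      fix x :: "(nat \<times> nat) \<Rightarrow>\<^sub>0 real" and y :: "nat \<Rightarrow>\<^sub>0 real"
      assume P: "(x, y) \<in> P_set 3 n" and D: "(x, y) \<in> D_set 3 n"
        and y: "\<forall>i\<in>{1..3}. lookup y i \<in> {0, 1}"
      let ?x = "\<lambda>i j. lookup x (i, j)" and ?y = "lookup y"
      have b: "0 \<le> ?x i j \<and> ?x i j \<le> ?y i" if "i \<in> {1, 2, 3}" "j \<in> {1..n}" for i j
        using P that by (auto simp: P_set_def)
      have s: "?x 1 j + ?x 2 j + ?x 3 j = 1" if "j \<in> {1..n}" for j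
        using D that unfolding D_set_def atLeastAtMost_1_3 by (simp add: add.assoc)
      have y01: "?y 1 \<in> {0, 1}" "?y 2 \<in> {0, 1}" "?y 3 \<in> {0, 1}" using y unfolding atLeastAtMost_1_3 by blast+
      \<comment> \<open>For integral y some y_i is 1. If two of them are, the y-terms already give
        2; if only one is, its x-entries are all 1, because the other rows vanish.\<close>
      have "2 \<le> ?x 1 j1 + ?x 2 j2 + ?x 3 j3 + ?y 1 + ?y 2 + ?y 3"
        if "j1 \<in> {1..n}" "j2 \<in> {1..n}" "j3 \<in> {1..n}" for j1 j2 j3
        using b[of 1 j1] b[of 2 j1] b[of 3 j1] b[of 1 j2] b[of 2 j2] b[of 3 j2] b[of 1 j3] b[of 2 j3] b[of 3 j3]
          s[of j1] s[of j2] s[of j3] that y01 by auto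
      then show "(x, y) \<in> P_set 3 n \<inter> D_set 3 n \<inter> odd_cycle_set n"
        using P D by (auto simp: odd_cycle_set_def)
    qed
  qed
next
  show "P_set 3 n \<inter> D_set 3 n \<inter> odd_cycle_set n \<subseteq> integer_hull 3 n"
  proof clarify
    fix x :: "(nat \<times> nat) \<Rightarrow>\<^sub>0 real" and y :: "nat \<Rightarrow>\<^sub>0 real"
    assume P: "(x, y) \<in> P_set 3 n" and D: "(x, y) \<in> D_set 3 n" and Q: "(x, y) \<in> odd_cycle_set n"
    let ?x = "\<lambda>i j. lookup x (i, j)" and ?y = "lookup y"
    have b: "0 \<le> ?x i j \<and> ?x i j \<le> ?y i" if "i \<in> {1, 2, 3}" "j \<in> {1..n}" for i j
      using P that by (auto simp: P_set_def)
    have s: "?x 1 j + ?x 2 j + ?x 3 j = 1" if "j \<in> {1..n}" for j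
      using D that unfolding D_set_def atLeastAtMost_1_3 by (simp add: add.assoc)
    have y1: "?y i \<le> 1" if "i \<in> {1, 2, 3}" for i using P that by (auto simp: P_set_def)
    \<comment> \<open>\<open>k i\<close> is a column where row i is minimal; different rows may use
      different columns.\<close>
    have "\<exists>k\<in>{1..n}. \<forall>j\<in>{1..n}. ?x i k \<le> ?x i j" for i :: nat
    proof -
      have "{1..n} \<noteq> {}" using n by simp
      from ex_is_arg_min_if_finite[OF _ this, of "?x i"]
      show ?thesis unfolding is_arg_min_linorder by blast
    qed
    then obtain k where k: "\<And>i. k i \<in> {1..n}" "\<And>i j. j \<in> {1..n} \<Longrightarrow> ?x i (k i) \<le> ?x i j"
      by metis
    have Q': "2 \<le> ?x 1 (k 1) + ?x 2 (k 2) + ?x 3 (k 3) + ?y 1 + ?y 2 + ?y 3"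
      using Q k(1) unfolding odd_cycle_set_def by simp
    have y0: "0 \<le> ?y 1" "0 \<le> ?y 2" "0 \<le> ?y 3" using b[of _ "k 1"] k(1)[of 1] by (force)+
    have s1: "1 \<le> ?y 1 + ?y 2 + ?y 3"
      using b[of 1 "k 1"] b[of 2 "k 1"] b[of 3 "k 1"] s[of "k 1"] k(1)[of 1] by simp
    have m1: "1 - ?y 2 - ?y 3 \<le> ?x 1 (k 1)"
      using b[of 1 "k 1"] b[of 2 "k 1"] b[of 3 "k 1"] s[of "k 1"] k(1)[of 1] by simp
    have m2: "1 - ?y 1 - ?y 3 \<le> ?x 2 (k 2)"
      using b[of 1 "k 2"] b[of 2 "k 2"] b[of 3 "k 2"] s[of "k 2"] k(1)[of 2] by simp
    have m3: "1 - ?y 1 - ?y 2 \<le> ?x 3 (k 3)"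
      using b[of 1 "k 3"] b[of 2 "k 3"] b[of 3 "k 3"] s[of "k 3"] k(1)[of 3] by simp
    have m0: "0 \<le> ?x 1 (k 1)" "0 \<le> ?x 2 (k 2)" "0 \<le> ?x 3 (k 3)"
      using b[of 1 "k 1"] b[of 2 "k 2"] b[of 3 "k 3"] k(1) by simp_all
    have y1: "?y 1 \<le> 1" "?y 2 \<le> 1" "?y 3 \<le> 1" using y1 by simp_all
    \<comment> \<open>The weights depend only on y and on the row minima, so they are fixed before
      any column is considered, and each a_i lies below every entry of row i.\<close>
    obtain a1 a2 a3 T1 T2 T3 w where a: "0 \<le> a1" "0 \<le> a2" "0 \<le> a3"
      "a1 \<le> ?x 1 (k 1)" "a2 \<le> ?x 2 (k 2)" "a3 \<le> ?x 3 (k 3)"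
      and T: "0 \<le> T1" "0 \<le> T2" "0 \<le> T3" "0 \<le> w"
      and aT: "a1 + a2 + a3 + T1 + T2 + T3 + w = 1"
      and yy: "?y 1 = a1 + T2 + T3 + w" "?y 2 = a2 + T1 + T3 + w" "?y 3 = a3 + T1 + T2 + w"
      by (rule coverage_weights[OF y0 y1 s1 m0 m1 m2 m3 Q'])
    \<comment> \<open>One tuple per column allows the six flow parameters to be chosen
      simultaneously as functions of j.\<close>
    define good where "good j t = (case t of (h1, h2, h3, p, q, r) \<Rightarrow>
      0 \<le> h1 \<and> 0 \<le> h2 \<and> 0 \<le> h3 \<and> h1 + h2 + h3 = w \<and>
      0 \<le> p \<and> p \<le> T3 \<and> 0 \<le> q \<and> q \<le> T1 \<and> 0 \<le> r \<and> r \<le> T2 \<and>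
      ?x 1 j = a1 + h1 + p + (T2 - r) \<and> ?x 2 j = a2 + h2 + q + (T3 - p) \<and>
      ?x 3 j = a3 + h3 + r + (T1 - q))" for j t
    have "\<exists>t. good j t" if j: "j \<in> {1..n}" for j
    proof -
      have bj: "?x 1 j \<le> ?y 1" "?x 2 j \<le> ?y 2" "?x 3 j \<le> ?y 3" using b j by auto
      have aj: "a1 \<le> ?x 1 j" "a2 \<le> ?x 2 j" "a3 \<le> ?x 3 j"
        using a(4-6) k(2)[OF j] by (meson order_trans)+
      obtain h1 h2 h3 p q r where "0 \<le> h1" "0 \<le> h2" "0 \<le> h3" "h1 + h2 + h3 = w"
        "0 \<le> p" "p \<le> T3" "0 \<le> q" "q \<le> T1" "0 \<le> r" "r \<le> T2"
        "?x 1 j = a1 + h1 + p + (T2 - r)" "?x 2 j = a2 + h2 + q + (T3 - p)"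
        "?x 3 j = a3 + h3 + r + (T1 - q)"
        by (rule coverage_flow[OF a(1-3) aj T aT s[OF j] bj[unfolded yy]])
      then have "good j (h1, h2, h3, p, q, r)" by (simp only: good_def prod.case simp_thms)
      then show ?thesis by blast
    qed
    then obtain t where t: "\<And>j. j \<in> {1..n} \<Longrightarrow> good j (t j)" by metis
    define h1 h2 h3 p q r where "h1 j = fst (t j)" and "h2 j = fst (snd (t j))"
      and "h3 j = fst (snd (snd (t j)))" and "p j = fst (snd (snd (snd (t j))))"
      and "q j = fst (snd (snd (snd (snd (t j)))))" and "r j = snd (snd (snd (snd (snd (t j)))))" for j
    have "t j = (h1 j, h2 j, h3 j, p j, q j, r j)" for j
      by (simp add: h1_def h2_def h3_def p_def q_def r_def)
    note t' = t[unfolded this good_def prod.case]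
    have h: "0 \<le> h1 j" "0 \<le> h2 j" "0 \<le> h3 j" "h1 j + h2 j + h3 j = w"
      "0 \<le> p j" "p j \<le> T3" "0 \<le> q j" "q j \<le> T1" "0 \<le> r j" "r j \<le> T2"
      "?x 1 j = a1 + h1 j + p j + (T2 - r j)" "?x 2 j = a2 + h2 j + q j + (T3 - p j)"
      "?x 3 j = a3 + h3 j + r j + (T1 - q j)" if "j \<in> {1..n}" for j
      by (insert t'[OF that], elim conjE, assumption)+
    \<comment> \<open>T_i belongs to the pair missing i, hence {1, 2} receives T3. In
      \<open>f\<close>, the numbers p, q, r are what 1 takes from {1, 2}, 2 from {2, 3} and 3 from
      {1, 3}.\<close>
    define lam :: "nat set \<Rightarrow> real" where "lam S =
       (if S = {1} then a1 else if S = {2} then a2 else if S = {3} then a3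
        else if S = {1, 2} then T3 else if S = {1, 3} then T2 else if S = {2, 3} then T1 else w)" for S
    define f :: "nat set \<Rightarrow> nat \<Rightarrow> nat \<Rightarrow> real" where "f S i j =
       (if S = {1} then a1 else if S = {2} then a2 else if S = {3} then a3
        else if S = {1, 2} then (if i = 1 then p j else T3 - p j)
        else if S = {1, 3} then (if i = 3 then r j else T2 - r j)
        else if S = {2, 3} then (if i = 2 then q j else T1 - q j)
        else if i = 1 then h1 j else if i = 2 then h2 j else h3 j)" for S i j
    have ne: "{1} \<noteq> {2::nat}" "{1} \<noteq> {3::nat}" "{2} \<noteq> {3::nat}" "{1} \<noteq> {1,2::nat}" "{1} \<noteq> {1,3::nat}"
      "{1} \<noteq> {2,3::nat}" "{1} \<noteq> {1,2,3::nat}" "{2} \<noteq> {1,2::nat}" "{2} \<noteq> {1,3::nat}"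
      "{2} \<noteq> {2,3::nat}" "{2} \<noteq> {1,2,3::nat}" "{3} \<noteq> {1,2::nat}" "{3} \<noteq> {1,3::nat}"
      "{3} \<noteq> {2,3::nat}" "{3} \<noteq> {1,2,3::nat}" "{1,2} \<noteq> {1,3::nat}" "{1,2} \<noteq> {2,3::nat}" "{1,2} \<noteq> {1,2,3::nat}"
      "{1,3} \<noteq> {2,3::nat}" "{1,3} \<noteq> {1,2,3::nat}" "{2,3} \<noteq> {1,2,3::nat}"
      by (simp_all add: set_eq_subset)
    note ne = ne ne[symmetric]
    show "(x, y) \<in> integer_hull 3 n"
    proof (rule integer_hull_flowI[of _ _ _ _ lam f])
      show "(x, y) \<in> ambient 3 n" using P by (simp add: P_set_def)
      show "0 \<le> lam S" for S using a T by (simp add: lam_def)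
      show "sum lam (Pow {1..3} - {{}}) = 1"
        unfolding Pow3 using aT by (simp add: ne lam_def del: One_nat_def)
      show "0 \<le> f S i j" if "j \<in> {1..n}" for S i j using h[OF that] a T by (simp add: f_def)
      show "(\<Sum>i\<in>S. f S i j) = lam S" if "S \<in> Pow {1..3} - {{}}" "j \<in> {1..n}" for S j
        using that h(4)[OF that(2)] unfolding Pow3 by (auto simp: f_def lam_def ne simp del: One_nat_def)
      show "?x i j = (\<Sum>S\<in>Pow {1..3} - {{}}. if i \<in> S then f S i j else 0)"
        if "i \<in> {1..3}" "j \<in> {1..n}" for i j
        using that(1) h[OF that(2)] unfolding Pow3 unfolding atLeastAtMost_1_3 by (auto simp: f_def ne simp del: One_nat_def)
      show "?y i = (\<Sum>S\<in>Pow {1..3} - {{}}. if i \<in> S then lam S else 0)"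
        if "i \<in> {1..3}" for i
        using that yy unfolding Pow3 unfolding atLeastAtMost_1_3 by (auto simp: lam_def ne simp del: One_nat_def)
    qed
  qed
qed

section \<open>Areas of fibres and product measures\<close>

lemma emeasure_lborel_prod:
  fixes S :: "('a::euclidean_space \<times> 'b::euclidean_space) set"
  assumes "S \<in> sets borel"
  shows "emeasure lborel S = (\<integral>\<^sup>+x. emeasure lborel {y. (x, y) \<in> S} \<partial>lborel)"
proof -
  have "emeasure lborel S = emeasure (lborel \<Otimes>\<^sub>M lborel) S"
    by (simp add: lborel_prod)
  also have "\<dots> = (\<integral>\<^sup>+x. emeasure lborel (Pair x -` S) \<partial>lborel)"
    by (rule lborel.emeasure_pair_measure_alt) (use assms in \<open>simp only: lborel_prod sets_lborel\<close>)
  finally show ?thesis by (simp add: vimage_def)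
qed

lemma borel_Collect_prod:
  fixes P :: "'a::second_countable_topology \<Rightarrow> 'b::second_countable_topology \<Rightarrow> bool"
  assumes "Measurable.pred (borel \<Otimes>\<^sub>M borel) (\<lambda>(x, y). P x y)"
  shows "{(x, y). P x y} \<in> sets borel"
  using assms[unfolded pred_def borel_prod] by simp

text \<open>The set is only required to lie between the open and the closed triangle, so that
  half-open triangles are covered as well. Both bounds have the same section lengths for almost
  every a.\<close>

lemma emeasure_triangle:
  fixes S :: "(real \<times> real) set"
  assumes le: "p + q \<le> r" and S[measurable]: "S \<in> sets borel"
    and sub: "{(a, b). p < a \<and> q < b \<and> a + b < r} \<subseteq> S" "S \<subseteq> {(a, b). p \<le> a \<and> q \<le> b \<and> a + b \<le> r}"
  shows "emeasure lborel S = ennreal ((r - p - q)\<^sup>2 / 2)"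
proof -
  have fund: "(\<integral>\<^sup>+a. ennreal (r - q - a) * indicator {p..r - q} a \<partial>lborel) = ennreal ((r - p - q)\<^sup>2 / 2)"
  proof -
    have "(\<integral>\<^sup>+a. ennreal (r - q - a) * indicator {p..r - q} a \<partial>lborel)
        = (- (r - q - (r - q))\<^sup>2 / 2) - (- (r - q - p)\<^sup>2 / 2)"
      by (rule nn_integral_FTC_Icc) (use le in \<open>auto intro!: derivative_eq_intros simp: field_simps\<close>)
    then show ?thesis by (simp add: algebra_simps)
  qed
  define U where "U = {(a, b). p < a \<and> q < b \<and> a + b < r}"
  define C where "C = {(a, b). p \<le> a \<and> q \<le> b \<and> a + b \<le> r}"
  have "open U"
    unfolding U_def split_def by (intro open_Collect_conj open_Collect_less continuous_intros)
  then have U[measurable]: "U \<in> sets borel" by simp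
  have "closed C"
    unfolding C_def split_def by (intro closed_Collect_conj closed_Collect_le continuous_intros)
  then have C[measurable]: "C \<in> sets borel" by simp
  \<comment> \<open>At a = p the open triangle has an empty section, while the formula gives the
    full leg; this single point is discarded below as a null set.\<close>
  have Ub: "emeasure lborel {b. (a, b) \<in> U} = ennreal (r - q - a) * indicator {p..r - q} a" if "a \<noteq> p" for a
  proof (cases "p \<le> a \<and> a \<le> r - q")
    case True
    then have "{b. (a, b) \<in> U} = {q<..<r - a}" using that by (auto simp: U_def)
    then show ?thesis using True by (simp add: algebra_simps)
  next
    case False
    then have "{b. (a, b) \<in> U} = {}" using that by (auto simp: U_def)
    then show ?thesis using False by simp
  qed
  have Cb: "emeasure lborel {b. (a, b) \<in> C} = ennreal (r - q - a) * indicator {p..r - q} a" for a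
  proof (cases "p \<le> a \<and> a \<le> r - q")
    case True
    then have "{b. (a, b) \<in> C} = {q..r - a}" by (auto simp: C_def)
    then show ?thesis using True by (simp add: algebra_simps)
  next
    case False
    then have "{b. (a, b) \<in> C} = {}" by (auto simp: C_def)
    then show ?thesis using False by simp
  qed
  have "emeasure lborel U = (\<integral>\<^sup>+a. ennreal (r - q - a) * indicator {p..r - q} a \<partial>lborel)"
    unfolding emeasure_lborel_prod[OF U]
    by (rule nn_integral_cong_AE, rule AE_mp[OF AE_lborel_singleton[of p]]) (use Ub in auto)
  moreover have "emeasure lborel C = (\<integral>\<^sup>+a. ennreal (r - q - a) * indicator {p..r - q} a \<partial>lborel)"
    unfolding emeasure_lborel_prod[OF C] Cb ..
  moreover have "emeasure lborel U \<le> emeasure lborel S" "emeasure lborel S \<le> emeasure lborel C"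
    using sub S U C by (auto intro!: emeasure_mono simp: U_def C_def)
  ultimately show ?thesis using fund by auto
qed

lemma emeasure_lborel_uminus:
  fixes S :: "'a::euclidean_space set"
  assumes "S \<in> sets borel"
  shows "emeasure lborel (uminus ` S) = emeasure lborel S"
proof -
  have *: "uminus ` S = uminus -` S" by force
  have "lborel = density (distr lborel borel (\<lambda>x. 0 + (-1) *\<^sub>R x :: 'a)) (\<lambda>_. ennreal (\<bar>-1\<bar> ^ DIM('a)))"
    by (rule lborel_affine) simp
  then have "lborel = distr lborel borel (uminus :: 'a \<Rightarrow> 'a)"
    by (simp add: density_1)
  then have "emeasure lborel S = emeasure (distr lborel borel (uminus :: 'a \<Rightarrow> 'a)) S" by simp
  also have "\<dots> = emeasure lborel (uminus -` S)"
    using assms by (subst emeasure_distr) auto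
  finally show ?thesis using * by simp
qed

lemma emeasure_triangle_rev:
  fixes S :: "(real \<times> real) set"
  assumes le: "r \<le> p + q" and S[measurable]: "S \<in> sets borel"
    and sub: "{(a, b). a < p \<and> b < q \<and> r < a + b} \<subseteq> S" "S \<subseteq> {(a, b). a \<le> p \<and> b \<le> q \<and> r \<le> a + b}"
  shows "emeasure lborel S = ennreal ((p + q - r)\<^sup>2 / 2)"
proof -
  have "emeasure lborel S = emeasure lborel (uminus ` S)"
    by (simp add: emeasure_lborel_uminus)
  also have "\<dots> = ennreal ((- r - (- p) - (- q))\<^sup>2 / 2)"
  proof (rule emeasure_triangle)
    have "uminus ` S = uminus -` S" by force
    also have "\<dots> \<in> sets borel" using measurable_sets[of uminus "borel :: (real \<times> real) measure" borel S] by simp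
    finally show "uminus ` S \<in> sets borel" .
    show "{(a, b). - p < a \<and> - q < b \<and> a + b < - r} \<subseteq> uminus ` S"
    proof clarify
      fix a b assume "- p < a" "- q < b" "a + b < - r"
      then have "(- a, - b) \<in> S" using sub(1) by auto
      then show "(a, b) \<in> uminus ` S" by (rule rev_image_eqI) simp
    qed
  qed (use le sub(2) in auto)
  finally show ?thesis by (simp add: algebra_simps)
qed

text \<open>The section of the box with lower corner l and upper corner b by the plane x + y + z =
  1, with z eliminated.\<close>

definition hexagon :: "real \<Rightarrow> real \<Rightarrow> real \<Rightarrow> real \<Rightarrow> real \<Rightarrow> real \<Rightarrow> (real \<times> real) set" where
  "hexagon l1 l2 l3 b1 b2 b3 =
     {(x, y). l1 \<le> x \<and> x \<le> b1 \<and> l2 \<le> y \<and> y \<le> b2 \<and> l3 \<le> 1 - x - y \<and> 1 - x - y \<le> b3}"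

lemma hexagon_measurable [measurable]: "hexagon l1 l2 l3 b1 b2 b3 \<in> sets borel"
proof -
  have "closed (hexagon l1 l2 l3 b1 b2 b3)"
    unfolding hexagon_def split_def by (intro closed_Collect_conj closed_Collect_le continuous_intros)
  then show ?thesis by simp
qed

text \<open>The upper bounds alone cut out a right isosceles triangle with legs T. The lower bound
  l_i removes a similar corner with legs d_i, and d_i + d_j <= T makes the corners disjoint, their
  inner edges being excluded.\<close>

lemma emeasure_hexagon:
  assumes d: "d1 = b2 + b3 + l1 - 1" "d2 = b1 + b3 + l2 - 1" "d3 = b1 + b2 + l3 - 1" "T = b1 + b2 + b3 - 1"
    and d0: "0 \<le> d1" "0 \<le> d2" "0 \<le> d3" "d1 + d2 \<le> T" "d1 + d3 \<le> T" "d2 + d3 \<le> T"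
  shows "emeasure lborel (hexagon l1 l2 l3 b1 b2 b3) = ennreal ((T\<^sup>2 - d1\<^sup>2 - d2\<^sup>2 - d3\<^sup>2) / 2)"
proof -
  define H where "H = hexagon l1 l2 l3 b1 b2 b3"
  define B where "B = {(x :: real, y :: real). x \<le> b1 \<and> y \<le> b2 \<and> 1 - x - y \<le> b3}"
  define C1 where "C1 = {(x :: real, y :: real). x < l1 \<and> y \<le> b2 \<and> 1 - x - y \<le> b3}"
  define C2 where "C2 = {(x :: real, y :: real). x \<le> b1 \<and> y < l2 \<and> 1 - x - y \<le> b3}"
  define C3 where "C3 = {(x :: real, y :: real). x \<le> b1 \<and> y \<le> b2 \<and> 1 - x - y < l3}"
  have "H \<in> sets borel" by (simp add: H_def)
  have mB: "B \<in> sets borel" unfolding B_def by (rule borel_Collect_prod) measurable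
  have mC1: "C1 \<in> sets borel" unfolding C1_def by (rule borel_Collect_prod) measurable
  have mC2: "C2 \<in> sets borel" unfolding C2_def by (rule borel_Collect_prod) measurable
  have mC3: "C3 \<in> sets borel" unfolding C3_def by (rule borel_Collect_prod) measurable
  have m: "B \<in> sets borel" "C1 \<in> sets borel" "C2 \<in> sets borel" "C3 \<in> sets borel" by fact+
  have B: "emeasure lborel B = ennreal (T\<^sup>2 / 2)"
    by (subst emeasure_triangle_rev[of "1 - b3" b1 b2]) (use m(1) d d0 in \<open>auto simp: B_def\<close>)
  have C1: "emeasure lborel C1 = ennreal (d1\<^sup>2 / 2)"
    by (subst emeasure_triangle_rev[of "1 - b3" l1 b2]) (use m(2) d d0 in \<open>auto simp: C1_def algebra_simps\<close>)
  have C2: "emeasure lborel C2 = ennreal (d2\<^sup>2 / 2)"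
    by (subst emeasure_triangle_rev[of "1 - b3" b1 l2]) (use m(3) d d0 in \<open>auto simp: C2_def algebra_simps\<close>)
  have C3: "emeasure lborel C3 = ennreal (d3\<^sup>2 / 2)"
    by (subst emeasure_triangle_rev[of "1 - l3" b1 b2]) (use m(4) d d0 in \<open>auto simp: C3_def algebra_simps\<close>)
  have "B = H \<union> (C1 \<union> (C2 \<union> C3))"
    using d d0 unfolding B_def H_def C1_def C2_def C3_def hexagon_def by auto
  moreover have "H \<inter> (C1 \<union> (C2 \<union> C3)) = {}"
    unfolding H_def C1_def C2_def C3_def hexagon_def by auto
  moreover have "C1 \<inter> (C2 \<union> C3) = {}" "C2 \<inter> C3 = {}"
    using d d0 unfolding C1_def C2_def C3_def by auto
  ultimately have "emeasure lborel B = emeasure lborel H + (emeasure lborel C1 + (emeasure lborel C2 + emeasure lborel C3))"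
    using m \<open>H \<in> sets borel\<close> by (simp add: plus_emeasure[symmetric] sets.Un)
  then have "ennreal (T\<^sup>2 / 2) = emeasure lborel H + ennreal (d1\<^sup>2 / 2 + (d2\<^sup>2 / 2 + d3\<^sup>2 / 2))"
    by (simp add: B C1 C2 C3)
  then have "emeasure lborel H = ennreal (T\<^sup>2 / 2) - ennreal (d1\<^sup>2 / 2 + (d2\<^sup>2 / 2 + d3\<^sup>2 / 2))"
    by simp
  also have "\<dots> = ennreal (T\<^sup>2 / 2 - (d1\<^sup>2 / 2 + (d2\<^sup>2 / 2 + d3\<^sup>2 / 2)))"
    by (rule ennreal_minus) simp
  finally show ?thesis unfolding H_def by (simp add: field_simps)
qed

text \<open>Regrouping the 2n coordinates by columns: the product measure is the image under
  \<open>h\<close> of the n-fold product of planar Lebesgue measure, where the set in question is a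
  power of R.\<close>

lemma emeasure_PiM_pairs:
  fixes R :: "(real \<times> real) set"
  assumes R[measurable]: "R \<in> sets borel"
  shows "emeasure (Pi\<^sub>M ({1..<3::nat} \<times> {1..n::nat}) (\<lambda>_. lborel))
    {x \<in> space (Pi\<^sub>M ({1..<3} \<times> {1..n}) (\<lambda>_. lborel)). \<forall>j\<in>{1..n}. (x (1, j), x (2, j)) \<in> R} = emeasure lborel R ^ n"
proof -
  let ?I = "{1..<3::nat}" and ?J = "{1..n}"
  let ?Q = "Pi\<^sub>M ?J (\<lambda>_. lborel :: (real \<times> real) measure)"
  let ?P = "Pi\<^sub>M (?I \<times> ?J) (\<lambda>_. lborel :: real measure)"
  interpret p: product_sigma_finite "\<lambda>_ :: nat \<times> nat. lborel :: real measure" by standard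
  interpret q: product_sigma_finite "\<lambda>_ :: nat. lborel :: (real \<times> real) measure" by standard
  have I: "?I = {1, 2}" by auto
  define h where "h w = restrict (\<lambda>(i, j). if i = 1 then fst (w j) else snd (w j)) (?I \<times> ?J)"
    for w :: "nat \<Rightarrow> real \<times> real"
  have h: "h \<in> measurable ?Q ?P"
    unfolding h_def
  proof (rule measurable_restrict)
    fix k assume "k \<in> ?I \<times> ?J"
    then obtain i j where k: "k = (i, j)" "j \<in> ?J" by auto
    have "(\<lambda>w. w j) \<in> measurable ?Q lborel" by (rule measurable_component_singleton) fact
    then have wj: "(\<lambda>w. w j) \<in> measurable ?Q borel" by simp
    have "fst \<in> borel_measurable (borel :: (real \<times> real) measure)"
      "snd \<in> borel_measurable (borel :: (real \<times> real) measure)"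
      by (intro borel_measurable_continuous_onI continuous_intros)+
    from this[THEN measurable_compose[OF wj]]
    show "(\<lambda>w. case k of (i, j) \<Rightarrow> if i = 1 then fst (w j) else snd (w j)) \<in> measurable ?Q lborel"
      unfolding k prod.case measurable_lborel2 by (cases "i = 1") simp_all
  qed
  have "distr ?Q ?P h = ?P"
  proof (rule p.PiM_eqI)
    fix A :: "nat \<times> nat \<Rightarrow> real set" assume A: "\<And>i. i \<in> ?I \<times> ?J \<Longrightarrow> A i \<in> sets lborel"
    have "emeasure (distr ?Q ?P h) (Pi\<^sub>E (?I \<times> ?J) A) = emeasure ?Q (h -` Pi\<^sub>E (?I \<times> ?J) A \<inter> space ?Q)"
      using A by (intro emeasure_distr h sets_PiM_I_finite) auto
    also have "h -` Pi\<^sub>E (?I \<times> ?J) A \<inter> space ?Q = Pi\<^sub>E ?J (\<lambda>j. A (1, j) \<times> A (2, j))"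
    proof (intro set_eqI iffI)
      fix w assume w: "w \<in> h -` Pi\<^sub>E (?I \<times> ?J) A \<inter> space ?Q"
      have "w j \<in> A (1, j) \<times> A (2, j)" if "j \<in> ?J" for j
      proof -
        have "h w (1, j) \<in> A (1, j)" "h w (2, j) \<in> A (2, j)" using w that by (auto simp: PiE_def Pi_def)
        then show ?thesis using that by (simp add: h_def mem_Times_iff)
      qed
      then show "w \<in> Pi\<^sub>E ?J (\<lambda>j. A (1, j) \<times> A (2, j))"
        using w by (auto simp: space_PiM PiE_def)
    next
      fix w assume w: "w \<in> Pi\<^sub>E ?J (\<lambda>j. A (1, j) \<times> A (2, j))"
      have hk: "h w k \<in> A k" if "k \<in> ?I \<times> ?J" for k
      proof -
        obtain i j where k: "k = (i, j)" "i \<in> {1, 2}" "j \<in> ?J" using \<open>k \<in> _\<close> unfolding I by auto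
        moreover have "w j \<in> A (1, j) \<times> A (2, j)" using w k(3) by (rule PiE_mem)
        ultimately show ?thesis using that by (auto simp: h_def)
      qed
      have "h w \<in> Pi\<^sub>E (?I \<times> ?J) A"
        by (rule PiE_I) (fact hk, simp only: h_def restrict_apply if_False)
      moreover have "w \<in> space ?Q" using w by (auto simp: space_PiM PiE_def)
      ultimately show "w \<in> h -` Pi\<^sub>E (?I \<times> ?J) A \<inter> space ?Q" by simp
    qed
    also have "emeasure ?Q \<dots> = (\<Prod>j\<in>?J. emeasure lborel (A (1, j) \<times> A (2, j)))"
      using A by (intro q.emeasure_PiM) (auto simp flip: lborel_prod)
    also have "\<dots> = (\<Prod>j\<in>?J. emeasure lborel (A (1, j)) * emeasure lborel (A (2, j)))"
      using A by (intro prod.cong refl) (simp add: lborel.emeasure_pair_measure_Times flip: lborel_prod)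
    also have "\<dots> = (\<Prod>i\<in>?I. \<Prod>j\<in>?J. emeasure lborel (A (i, j)))"
      unfolding I by (simp add: prod.distrib)
    also have "\<dots> = (\<Prod>k\<in>?I \<times> ?J. emeasure lborel (A k))"
      by (simp add: prod.cartesian_product split_def)
    finally show "emeasure (distr ?Q ?P h) (Pi\<^sub>E (?I \<times> ?J) A) = (\<Prod>k\<in>?I \<times> ?J. emeasure lborel (A k))" .
  qed auto
  have S: "{x \<in> space ?P. \<forall>j\<in>?J. (x (1, j), x (2, j)) \<in> R} \<in> sets ?P"
  proof -
    have mp: "(\<lambda>x. (x (1, j), x (2, j))) \<in> measurable ?P borel" if "j \<in> ?J" for j
    proof -
      have "(\<lambda>x. x (1, j)) \<in> measurable ?P lborel" "(\<lambda>x. x (2, j)) \<in> measurable ?P lborel"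
        using that by (auto intro!: measurable_component_singleton)
      then show ?thesis by (simp add: borel_measurable_Pair)
    qed
    have "{x \<in> space ?P. (x (1, j), x (2, j)) \<in> R} \<in> sets ?P" if "j \<in> ?J" for j
      using measurable_sets[OF mp[OF that] R] by (simp add: vimage_def Int_def conj_commute)
    then show ?thesis by (intro sets.sets_Collect_finite_All) auto
  qed
  have "emeasure ?P {x \<in> space ?P. \<forall>j\<in>?J. (x (1, j), x (2, j)) \<in> R}
      = emeasure (distr ?Q ?P h) {x \<in> space ?P. \<forall>j\<in>?J. (x (1, j), x (2, j)) \<in> R}"
    using \<open>distr ?Q ?P h = ?P\<close> by simp
  also have "\<dots> = emeasure ?Q (h -` {x \<in> space ?P. \<forall>j\<in>?J. (x (1, j), x (2, j)) \<in> R} \<inter> space ?Q)"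
    using h S by (rule emeasure_distr)
  also have "h -` {x \<in> space ?P. \<forall>j\<in>?J. (x (1, j), x (2, j)) \<in> R} \<inter> space ?Q = Pi\<^sub>E ?J (\<lambda>_. R)"
  proof -
    have "h w (1, j) = fst (w j)" "h w (2, j) = snd (w j)" if "j \<in> ?J" for w j
      using that by (simp_all add: h_def)
    then show ?thesis using measurable_space[OF h] by (auto simp: space_PiM PiE_def Pi_def)
  qed
  also have "emeasure ?Q \<dots> = emeasure lborel R ^ n"
    by (subst q.emeasure_PiM) auto
  finally show ?thesis .
qed

section \<open>The law of the slacks\<close>

abbreviation lborel2 :: "(real \<times> real) measure" where
  "lborel2 \<equiv> lborel \<Otimes>\<^sub>M lborel"

abbreviation lborel3 :: "((real \<times> real) \<times> real) measure" where
  "lborel3 \<equiv> lborel2 \<Otimes>\<^sub>M lborel"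

lemma nn_integral_lborel3:
  assumes f[measurable]: "f \<in> borel_measurable lborel3"
  shows "integral\<^sup>N lborel3 f = (\<integral>\<^sup>+x. \<integral>\<^sup>+y. \<integral>\<^sup>+z. f ((x, y), z) \<partial>lborel \<partial>lborel \<partial>lborel)"
proof -
  have "integral\<^sup>N lborel3 f = (\<integral>\<^sup>+xy. \<integral>\<^sup>+z. f (xy, z) \<partial>lborel \<partial>lborel2)"
    by (rule lborel.nn_integral_fst[symmetric]) fact
  also have "\<dots> = (\<integral>\<^sup>+x. \<integral>\<^sup>+y. \<integral>\<^sup>+z. f ((x, y), z) \<partial>lborel \<partial>lborel \<partial>lborel)"
    by (rule lborel.nn_integral_fst[symmetric]) measurable
  finally show ?thesis .
qed

text \<open>The target carries the sigma-algebra generated by E, so measurability is checked on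
  generators only and no comparison with Borel sets is needed.\<close>

lemma emeasure_distr_restrict_sigma:
  assumes E: "E \<subseteq> Pow \<Omega>" and Z: "Z \<in> sets L" and h: "h \<in> Z \<rightarrow> \<Omega>"
    and pre: "\<And>e. e \<in> E \<Longrightarrow> h -` e \<inter> Z \<in> sets L" and e: "e \<in> sets (sigma \<Omega> E)"
  shows "emeasure (distr (restrict_space L Z) (sigma \<Omega> E) h) e = emeasure L (h -` e \<inter> Z)"
proof -
  have sp: "Z \<inter> space L = Z" using sets.sets_into_space[OF Z] by auto
  have "h \<in> measurable (restrict_space L Z) (sigma \<Omega> E)"
    by (rule measurable_measure_of[OF E])
      (use h pre Z in \<open>auto simp: space_restrict_space sp sets_restrict_space_iff\<close>)
  then show ?thesis
    using e Z by (simp add: emeasure_distr emeasure_restrict_space space_restrict_space sp)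
qed

text \<open>A pi-system argument confined to the simplex. Half-open boxes anchored at (k1, k2, k3)
  whose upper corner has coordinate sum at most 1 lie in the simplex, are closed under intersection,
  and cover it countably. Larger boxes are avoided because the orthant formula is supplied for
  coordinate sums up to 1 only.\<close>

lemma emeasure_simplex_eqI:
  fixes X1 X2 X3 :: "'a \<Rightarrow> real" and Y1 Y2 Y3 :: "'b \<Rightarrow> real"
  assumes fin: "emeasure M (space M) \<noteq> \<infinity>"
    and X[measurable]: "X1 \<in> borel_measurable M" "X2 \<in> borel_measurable M" "X3 \<in> borel_measurable M"
    and Y[measurable]: "Y1 \<in> borel_measurable N" "Y2 \<in> borel_measurable N" "Y3 \<in> borel_measurable N"
    and eq: "\<And>b1 b2 b3. \<lbrakk>k1 < b1; k2 < b2; k3 < b3; b1 + b2 + b3 \<le> 1\<rbrakk> \<Longrightarrow>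
      emeasure M {x \<in> space M. k1 \<le> X1 x \<and> X1 x < b1 \<and> k2 \<le> X2 x \<and> X2 x < b2 \<and> k3 \<le> X3 x \<and> X3 x < b3}
      = emeasure N {x \<in> space N. k1 \<le> Y1 x \<and> Y1 x < b1 \<and> k2 \<le> Y2 x \<and> Y2 x < b2 \<and> k3 \<le> Y3 x \<and> Y3 x < b3}"
  shows "emeasure M {x \<in> space M. k1 \<le> X1 x \<and> k2 \<le> X2 x \<and> k3 \<le> X3 x \<and> X1 x + X2 x + X3 x < 1}
    = emeasure N {x \<in> space N. k1 \<le> Y1 x \<and> k2 \<le> Y2 x \<and> k3 \<le> Y3 x \<and> Y1 x + Y2 x + Y3 x < 1}"
proof -
  define \<Omega> where "\<Omega> = {(a, b, c). k1 \<le> a \<and> k2 \<le> b \<and> k3 \<le> c \<and> a + b + c < 1}"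
  define B where "B = (\<lambda>(b1, b2, b3). {(a, b, c). k1 \<le> a \<and> a < b1 \<and> k2 \<le> b \<and> b < b2 \<and> k3 \<le> c \<and> c < b3})"
  define E where "E = B ` {(b1, b2, b3). b1 + b2 + b3 \<le> 1}"
  define SX where "SX = {x \<in> space M. k1 \<le> X1 x \<and> k2 \<le> X2 x \<and> k3 \<le> X3 x \<and> X1 x + X2 x + X3 x < 1}"
  define SY where "SY = {x \<in> space N. k1 \<le> Y1 x \<and> k2 \<le> Y2 x \<and> k3 \<le> Y3 x \<and> Y1 x + Y2 x + Y3 x < 1}"
  define X where "X = (\<lambda>x. (X1 x, X2 x, X3 x))"
  define Y where "Y = (\<lambda>x. (Y1 x, Y2 x, Y3 x))"
  define S where "S = sigma \<Omega> E"
  have SX[measurable]: "SX \<in> sets M" unfolding SX_def by measurable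
  have SY[measurable]: "SY \<in> sets N" unfolding SY_def by measurable
  have EO: "E \<subseteq> Pow \<Omega>"
    by (auto simp: E_def B_def \<Omega>_def)
  have preX: "X -` B (b1, b2, b3) \<inter> SX
      = {x \<in> space M. k1 \<le> X1 x \<and> X1 x < b1 \<and> k2 \<le> X2 x \<and> X2 x < b2 \<and> k3 \<le> X3 x \<and> X3 x < b3}"
    if "b1 + b2 + b3 \<le> 1" for b1 b2 b3
    using that by (auto simp: X_def B_def SX_def)
  have preY: "Y -` B (b1, b2, b3) \<inter> SY
      = {x \<in> space N. k1 \<le> Y1 x \<and> Y1 x < b1 \<and> k2 \<le> Y2 x \<and> Y2 x < b2 \<and> k3 \<le> Y3 x \<and> Y3 x < b3}"
    if "b1 + b2 + b3 \<le> 1" for b1 b2 b3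
    using that by (auto simp: Y_def B_def SY_def)
  have sS: "sets S = sigma_sets \<Omega> E" "space S = \<Omega>" unfolding S_def using EO by simp_all
  have dX: "emeasure (distr (restrict_space M SX) S X) e = emeasure M (X -` e \<inter> SX)" if "e \<in> sets S" for e
    unfolding S_def
  proof (rule emeasure_distr_restrict_sigma[OF EO SX])
    show "X \<in> SX \<rightarrow> \<Omega>" by (auto simp: X_def SX_def \<Omega>_def)
    show "X -` e \<inter> SX \<in> sets M" if "e \<in> E" for e
    proof -
      obtain b1 b2 b3 where e: "e = B (b1, b2, b3)" "b1 + b2 + b3 \<le> 1" using \<open>e \<in> E\<close> by (auto simp: E_def)
      show ?thesis unfolding e(1) preX[OF e(2)] by measurable
    qed
  qed (use that in \<open>simp add: S_def\<close>)
  have dY: "emeasure (distr (restrict_space N SY) S Y) e = emeasure N (Y -` e \<inter> SY)" if "e \<in> sets S" for e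
    unfolding S_def
  proof (rule emeasure_distr_restrict_sigma[OF EO SY])
    show "Y \<in> SY \<rightarrow> \<Omega>" by (auto simp: Y_def SY_def \<Omega>_def)
    show "Y -` e \<inter> SY \<in> sets N" if "e \<in> E" for e
    proof -
      obtain b1 b2 b3 where e: "e = B (b1, b2, b3)" "b1 + b2 + b3 \<le> 1" using \<open>e \<in> E\<close> by (auto simp: E_def)
      show ?thesis unfolding e(1) preY[OF e(2)] by measurable
    qed
  qed (use that in \<open>simp add: S_def\<close>)
  \<comment> \<open>Rational upper corners provide the countable cover demanded by the uniqueness
    theorem.\<close>
  define C where "C = B ` {(b1, b2, b3). b1 \<in> \<rat> \<and> b2 \<in> \<rat> \<and> b3 \<in> \<rat> \<and> b1 + b2 + b3 \<le> 1}"
  have "distr (restrict_space M SX) S X = distr (restrict_space N SY) S Y"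
  proof (rule measure_eqI_generator_eq_countable[where \<Omega> = \<Omega> and E = E and A = C])
    show "Int_stable E"
    proof (rule Int_stableI)
      fix e e' assume "e \<in> E" "e' \<in> E"
      then obtain b1 b2 b3 b1' b2' b3' where e: "e = B (b1, b2, b3)" "b1 + b2 + b3 \<le> 1"
        "e' = B (b1', b2', b3')" by (auto simp: E_def)
      have "e \<inter> e' = B (min b1 b1', min b2 b2', min b3 b3')"
        unfolding e B_def by auto
      moreover have "min b1 b1' + min b2 b2' + min b3 b3' \<le> 1" using e(2) by linarith
      ultimately show "e \<inter> e' \<in> E" by (auto simp: E_def)
    qed
    show "E \<subseteq> Pow \<Omega>" by fact
    show "emeasure (distr (restrict_space M SX) S X) e = emeasure (distr (restrict_space N SY) S Y) e"
      if eE: "e \<in> E" for e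
    proof -
      obtain b1 b2 b3 where e: "e = B (b1, b2, b3)" "b1 + b2 + b3 \<le> 1" using eE by (auto simp: E_def)
      have es: "e \<in> sets S" using eE by (auto simp: sS)
      show ?thesis
      proof (cases "k1 < b1 \<and> k2 < b2 \<and> k3 < b3")
        case True
        then show ?thesis
          unfolding dX[OF es] dY[OF es] unfolding e(1) preX[OF e(2)] preY[OF e(2)] using e(2) by (intro eq) auto
      next
        case False
        then have "e = {}" unfolding e(1) B_def by auto
        then show ?thesis by simp
      qed
    qed
    show "sets (distr (restrict_space M SX) S X) = sigma_sets \<Omega> E"
      "sets (distr (restrict_space N SY) S Y) = sigma_sets \<Omega> E" by (simp_all add: sS)
    have "countable (\<rat> \<times> \<rat> \<times> \<rat> :: (real \<times> real \<times> real) set)"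
      by (intro countable_SIGMA countable_rat)
    then have "countable {(b1, b2, b3 :: real). b1 \<in> \<rat> \<and> b2 \<in> \<rat> \<and> b3 \<in> \<rat> \<and> b1 + b2 + b3 \<le> (1 :: real)}"
      by (rule countable_subset[rotated]) auto
    then show "countable C" unfolding C_def by (rule countable_image)
    show CE: "C \<subseteq> E" unfolding C_def E_def by auto
    show "\<Union> C = \<Omega>"
    proof
      show "\<Union> C \<subseteq> \<Omega>" using CE EO by auto
      show "\<Omega> \<subseteq> \<Union> C"
      proof
        fix w assume "w \<in> \<Omega>"
        then obtain a b c where w: "w = (a, b, c)" "k1 \<le> a" "k2 \<le> b" "k3 \<le> c" "a + b + c < 1"
          by (auto simp: \<Omega>_def)
        \<comment> \<open>A third of the slack, so that enlarging each coordinate by less than d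
          keeps the sum below 1.\<close>
        define d where "d = (1 - a - b - c) / 3"
        have d: "d > 0" using w by (simp add: d_def)
        obtain q1 where q1: "q1 \<in> \<rat>" "a < q1" "q1 < a + d" using Rats_dense_in_real[of a "a + d"] d by auto
        obtain q2 where q2: "q2 \<in> \<rat>" "b < q2" "q2 < b + d" using Rats_dense_in_real[of b "b + d"] d by auto
        obtain q3 where q3: "q3 \<in> \<rat>" "c < q3" "q3 < c + d" using Rats_dense_in_real[of c "c + d"] d by auto
        have "q1 + q2 + q3 \<le> 1" using q1(3) q2(3) q3(3) unfolding d_def by argo
        moreover have "w \<in> B (q1, q2, q3)" using w q1 q2 q3 by (simp add: B_def)
        ultimately show "w \<in> \<Union> C" unfolding C_def using q1(1) q2(1) q3(1) by blast
      qed
    qed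
    show "emeasure (distr (restrict_space M SX) S X) e \<noteq> \<infinity>" if "e \<in> C" for e
    proof -
      have "e \<in> sets S" using that CE by (auto simp: sS)
      have "emeasure M (X -` e \<inter> SX) \<le> emeasure M (space M)"
        by (rule emeasure_space)
      then show ?thesis unfolding dX[OF \<open>e \<in> sets S\<close>] using fin by (auto simp: top_unique)
    qed
  qed
  then have "emeasure (distr (restrict_space M SX) S X) \<Omega> = emeasure (distr (restrict_space N SY) S Y) \<Omega>" by simp
  moreover have "\<Omega> \<in> sets S" using sets.top[of S] by (simp add: sS)
  ultimately have "emeasure M (X -` \<Omega> \<inter> SX) = emeasure N (Y -` \<Omega> \<inter> SY)" by (simp add: dX dY)
  moreover have "X -` \<Omega> \<inter> SX = SX" "Y -` \<Omega> \<inter> SY = SY"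
    by (auto simp: X_def Y_def SX_def SY_def \<Omega>_def)
  ultimately show ?thesis by (simp add: SX_def SY_def)
qed

lemma nn_integral_FTC_Ico:
  fixes f :: "real \<Rightarrow> real"
  assumes "f \<in> borel_measurable borel"
    and "\<And>x. x \<in> {a..b} \<Longrightarrow> DERIV F x :> f x" "\<And>x. x \<in> {a..b} \<Longrightarrow> 0 \<le> f x" "a \<le> b"
  shows "(\<integral>\<^sup>+x. ennreal (f x) * indicator {a..<b} x \<partial>lborel) = ennreal (F b - F a)"
proof -
  have "(\<integral>\<^sup>+x. ennreal (f x) * indicator {a..<b} x \<partial>lborel) = (\<integral>\<^sup>+x. ennreal (f x) * indicator {a..b} x \<partial>lborel)"
    by (rule nn_integral_cong_AE, rule AE_mp[OF AE_lborel_singleton[of b]])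
      (auto simp: indicator_def)
  also have "\<dots> = F b - F a" by (rule nn_integral_FTC_Icc) (use assms in auto)
  finally show ?thesis .
qed

text \<open>Minus the mixed third derivative of \<open>((1 - |c|\<^sup>2) / 2) ^ n\<close>.\<close>

definition simplex_density :: "nat \<Rightarrow> real \<Rightarrow> real \<Rightarrow> real \<Rightarrow> real" where
  "simplex_density n a b c = real n * real (n - 1) * real (n - 2) * a * b * c * ((1 - a\<^sup>2 - b\<^sup>2 - c\<^sup>2) / 2) ^ (n - 3)"

lemma sum_squares_le_one:
  fixes a b c :: real
  assumes "0 \<le> a" "0 \<le> b" "0 \<le> c" "a + b + c \<le> 1"
  shows "a\<^sup>2 + b\<^sup>2 + c\<^sup>2 \<le> 1"
proof -
  have "a\<^sup>2 \<le> a" "b\<^sup>2 \<le> b" "c\<^sup>2 \<le> c"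
    using assms by (auto simp: power2_eq_square intro!: mult_left_le)
  then show ?thesis using assms by linarith
qed

text \<open>The density is minus the mixed third derivative of F, so three applications of the
  fundamental theorem give the alternating sum over the eight corners. Truncated subtraction does no
  harm: for n < 3 the factor n (n-1) (n-2) is zero.\<close>

lemma nn_integral_simplex_density_box:
  assumes k: "0 \<le> k1" "0 \<le> k2" "0 \<le> k3" and kb: "k1 < b1" "k2 < b2" "k3 < b3"
    and b: "b1 + b2 + b3 \<le> 1"
  defines "F \<equiv> \<lambda>m a b c. ((1 - a\<^sup>2 - b\<^sup>2 - c\<^sup>2) / 2 :: real) ^ m"
  shows "(\<integral>\<^sup>+z. (case z of ((c1, c2), c3) \<Rightarrow> ennreal (simplex_density n c1 c2 c3) *
      (indicator {k1..<b1} c1 * indicator {k2..<b2} c2 * indicator {k3..<b3} c3)) \<partial>lborel3)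
    = ennreal (((F n k1 k2 k3 - F n k1 k2 b3) - (F n k1 b2 k3 - F n k1 b2 b3))
        - ((F n b1 k2 k3 - F n b1 k2 b3) - (F n b1 b2 k3 - F n b1 b2 b3)))"
proof -
  \<comment> \<open>Differences of F in the third and then in the second variable, left over by the
    inner integrals. Differentiation in a remaining variable x lowers the exponent m by one and
    brings out the factor - m x.\<close>
  define D3 where "D3 m a b = F m a b k3 - F m a b b3" for m a b
  define D2 where "D2 m a = D3 m a k2 - D3 m a b2" for m a
  have sq: "x\<^sup>2 + y\<^sup>2 + z\<^sup>2 \<le> 1" if "x \<in> {k1..b1}" "y \<in> {k2..b2}" "z \<in> {k3..b3}" for x y z
    using that k b by (intro sum_squares_le_one) auto
  have D3_nonneg: "0 \<le> D3 m x y" if "x \<in> {k1..b1}" "y \<in> {k2..b2}" for m x y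
  proof -
    have "((1 - x\<^sup>2 - y\<^sup>2 - b3\<^sup>2) / 2) ^ m \<le> ((1 - x\<^sup>2 - y\<^sup>2 - k3\<^sup>2) / 2) ^ m"
    proof (rule power_mono)
      have "k3\<^sup>2 \<le> b3\<^sup>2" using k kb by (intro power_mono) auto
      then show "(1 - x\<^sup>2 - y\<^sup>2 - b3\<^sup>2) / 2 \<le> (1 - x\<^sup>2 - y\<^sup>2 - k3\<^sup>2) / 2" by simp
      show "0 \<le> (1 - x\<^sup>2 - y\<^sup>2 - b3\<^sup>2) / 2" using sq[OF that, of b3] kb by simp
    qed
    then show ?thesis by (simp add: D3_def F_def)
  qed
  have pd: "((\<lambda>c. ((R - c\<^sup>2) / 2) ^ m) has_real_derivative - (real m * c * ((R - c\<^sup>2) / 2) ^ (m - 1))) (at c)"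
    for R c :: real and m
    by (auto intro!: derivative_eq_intros simp del: power_divide)
  have F_deriv: "((\<lambda>z. F m x y z) has_real_derivative - (real m * z * F (m - 1) x y z)) (at z)" for m x y z
    unfolding F_def by (rule pd)
  \<comment> \<open>F is symmetric, so the derivative rule in the last argument serves all three
    variables.\<close>
  have F2: "F m x y z = F m x z y" and F1: "F m x y z = F m y z x" for m x y z
    unfolding F_def by (simp_all add: algebra_simps)
  have D3_deriv: "((\<lambda>y. D3 m x y) has_real_derivative - (real m * y * D3 (m - 1) x y)) (at y)" for m x y
  proof -
    have "((\<lambda>y. F m x k3 y - F m x b3 y) has_real_derivative
        - (real m * y * F (m - 1) x k3 y) - - (real m * y * F (m - 1) x b3 y)) (at y)"
      by (intro DERIV_diff F_deriv)
    moreover have e: "D3 m x y = F m x k3 y - F m x b3 y" for m y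
      unfolding D3_def F2[of _ x y] ..
    ultimately show ?thesis unfolding e by (simp add: algebra_simps)
  qed
  have D2_deriv: "((\<lambda>x. D2 m x) has_real_derivative - (real m * x * D2 (m - 1) x)) (at x)" for m x
  proof -
    have "((\<lambda>x. (F m k2 k3 x - F m k2 b3 x) - (F m b2 k3 x - F m b2 b3 x)) has_real_derivative
        (- (real m * x * F (m - 1) k2 k3 x) - - (real m * x * F (m - 1) k2 b3 x))
        - (- (real m * x * F (m - 1) b2 k3 x) - - (real m * x * F (m - 1) b2 b3 x))) (at x)"
      by (intro DERIV_diff F_deriv)
    moreover have e: "D2 m x = (F m k2 k3 x - F m k2 b3 x) - (F m b2 k3 x - F m b2 b3 x)" for m x
      unfolding D2_def D3_def F1[of _ x] ..
    ultimately show ?thesis unfolding e by (simp add: algebra_simps)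
  qed
  have D2_nonneg: "0 \<le> D2 m x" if "x \<in> {k1..b1}" for m x
  proof -
    \<comment> \<open>The y-derivative of \<open>D3 m\<close> is - m y \<open>D3 (m - 1)\<close>,
      which is nonpositive; thus the sign of D3 settles that of D2.\<close>
    have "D3 m x b2 \<le> D3 m x k2"
    proof (rule DERIV_nonpos_imp_nonincreasing[of k2 b2])
      show "k2 \<le> b2" using kb by simp
      fix y assume y: "k2 \<le> y" "y \<le> b2"
      then have "0 \<le> real m * y * D3 (m - 1) x y" using D3_nonneg[OF that, of y] k by simp
      then show "\<exists>d. ((\<lambda>y. D3 m x y) has_real_derivative d) (at y) \<and> d \<le> 0"
        using D3_deriv[of m x y] by (intro exI[of _ "- (real m * y * D3 (m - 1) x y)"]) simp
    qed
    then show ?thesis by (simp add: D2_def)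
  qed
  have meas[measurable]: "(\<lambda>z. F m x y z) \<in> borel_measurable borel" "(\<lambda>y. D3 m x y) \<in> borel_measurable borel"
    "(\<lambda>x. D2 m x) \<in> borel_measurable borel" for m x y
    unfolding D2_def D3_def F_def by measurable
  have i3: "(\<integral>\<^sup>+z. ennreal (simplex_density n x y z) * indicator {k3..<b3} z \<partial>lborel)
      = ennreal (real n * real (n - 1) * x * y * D3 (n - 2) x y)"
    if x: "x \<in> {k1..b1}" and y: "y \<in> {k2..b2}" for x y
  proof -
    have e: "simplex_density n x y z = real n * real (n - 1) * x * y * (real (n - 2) * z * F (n - 2 - 1) x y z)" for z
      by (simp add: simplex_density_def F_def)
    have "(\<integral>\<^sup>+z. ennreal (real n * real (n - 1) * x * y * (real (n - 2) * z * F (n - 2 - 1) x y z)) * indicator {k3..<b3} z \<partial>lborel)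
      = ennreal (- (real n * real (n - 1) * x * y * F (n - 2) x y b3) - - (real n * real (n - 1) * x * y * F (n - 2) x y k3))"
    proof (rule nn_integral_FTC_Ico)
      fix z assume z: "z \<in> {k3..b3}"
      have "((\<lambda>z. - (real n * real (n - 1) * x * y * F (n - 2) x y z)) has_real_derivative
        - (real n * real (n - 1) * x * y * (- (real (n - 2) * z * F (n - 2 - 1) x y z)))) (at z)"
        by (intro DERIV_minus DERIV_cmult F_deriv)
      then show "((\<lambda>z. - (real n * real (n - 1) * x * y * F (n - 2) x y z)) has_real_derivative
         (real n * real (n - 1) * x * y * (real (n - 2) * z * F (n - 2 - 1) x y z))) (at z)" by simp
      have "0 \<le> F (n - 2 - 1) x y z" unfolding F_def using sq[OF x y z] by (intro zero_le_power) simp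
      then show "0 \<le> real n * real (n - 1) * x * y * (real (n - 2) * z * F (n - 2 - 1) x y z)"
        using x y z k by (auto intro!: mult_nonneg_nonneg)
    qed (use kb in auto)
    then show ?thesis unfolding e D3_def by (simp add: algebra_simps)
  qed
  have i2: "(\<integral>\<^sup>+y. ennreal (real n * real (n - 1) * x * y * D3 (n - 2) x y) * indicator {k2..<b2} y \<partial>lborel)
      = ennreal (real n * x * D2 (n - 1) x)"
    if x: "x \<in> {k1..b1}" for x
  proof -
    have "(\<integral>\<^sup>+y. ennreal (real n * x * (real (n - 1) * y * D3 (n - 1 - 1) x y)) * indicator {k2..<b2} y \<partial>lborel)
      = ennreal (- (real n * x * D3 (n - 1) x b2) - - (real n * x * D3 (n - 1) x k2))"
    proof (rule nn_integral_FTC_Ico)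
      fix y assume y: "y \<in> {k2..b2}"
      have "((\<lambda>y. - (real n * x * D3 (n - 1) x y)) has_real_derivative
        - (real n * x * (- (real (n - 1) * y * D3 (n - 1 - 1) x y)))) (at y)"
        by (intro DERIV_minus DERIV_cmult D3_deriv)
      then show "((\<lambda>y. - (real n * x * D3 (n - 1) x y)) has_real_derivative
        (real n * x * (real (n - 1) * y * D3 (n - 1 - 1) x y))) (at y)" by simp
      show "0 \<le> real n * x * (real (n - 1) * y * D3 (n - 1 - 1) x y)"
        using x y k D3_nonneg[OF x y] by (auto intro!: mult_nonneg_nonneg)
    qed (use kb in auto)
    then show ?thesis unfolding D2_def by (simp add: algebra_simps numeral_2_eq_2)
  qed
  have i1: "(\<integral>\<^sup>+x. ennreal (real n * x * D2 (n - 1) x) * indicator {k1..<b1} x \<partial>lborel)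
      = ennreal (- D2 n b1 - - D2 n k1)"
  proof (rule nn_integral_FTC_Ico)
    fix x assume x: "x \<in> {k1..b1}"
    have "((\<lambda>x. - D2 n x) has_real_derivative - (- (real n * x * D2 (n - 1) x))) (at x)"
      by (intro DERIV_minus D2_deriv)
    then show "((\<lambda>x. - D2 n x) has_real_derivative real n * x * D2 (n - 1) x) (at x)" by simp
    show "0 \<le> real n * x * D2 (n - 1) x"
      using x k D2_nonneg[OF x] by (auto intro!: mult_nonneg_nonneg)
  qed (use kb in auto)
  have "(\<integral>\<^sup>+z. (case z of ((c1, c2), c3) \<Rightarrow> ennreal (simplex_density n c1 c2 c3) *
      (indicator {k1..<b1} c1 * indicator {k2..<b2} c2 * indicator {k3..<b3} c3)) \<partial>lborel3)
    = (\<integral>\<^sup>+x. \<integral>\<^sup>+y. \<integral>\<^sup>+z. ennreal (simplex_density n x y z) *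
      (indicator {k1..<b1} x * indicator {k2..<b2} y * indicator {k3..<b3} z) \<partial>lborel \<partial>lborel \<partial>lborel)"
    by (subst nn_integral_lborel3) (auto simp: simplex_density_def split_def)
  also have "\<dots> = (\<integral>\<^sup>+x. \<integral>\<^sup>+y. ennreal (real n * real (n - 1) * x * y * D3 (n - 2) x y) * indicator {k2..<b2} y
      * indicator {k1..<b1} x \<partial>lborel \<partial>lborel)"
  proof (intro nn_integral_cong)
    fix x y :: real
    show "(\<integral>\<^sup>+z. ennreal (simplex_density n x y z) *
      (indicator {k1..<b1} x * indicator {k2..<b2} y * indicator {k3..<b3} z) \<partial>lborel)
      = ennreal (real n * real (n - 1) * x * y * D3 (n - 2) x y) * indicator {k2..<b2} y * indicator {k1..<b1} x"
      using i3[of x y] by (auto simp: indicator_def if_distrib cong: if_cong)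
  qed
  also have "\<dots> = (\<integral>\<^sup>+x. ennreal (real n * x * D2 (n - 1) x) * indicator {k1..<b1} x \<partial>lborel)"
  proof (intro nn_integral_cong)
    fix x :: real
    show "(\<integral>\<^sup>+y. ennreal (real n * real (n - 1) * x * y * D3 (n - 2) x y) * indicator {k2..<b2} y * indicator {k1..<b1} x \<partial>lborel)
      = ennreal (real n * x * D2 (n - 1) x) * indicator {k1..<b1} x"
      using i2[of x] by (auto simp: indicator_def if_distrib cong: if_cong)
  qed
  also have "\<dots> = ennreal (D2 n k1 - D2 n b1)" unfolding i1 by simp
  finally show ?thesis unfolding D2_def D3_def .
qed

text \<open>Orthant measures determine box measures by inclusion-exclusion, box measures are
  integrals of the density, and \<open>emeasure_simplex_eqI\<close> passes from boxes to the
  simplex. All corners of a box have coordinate sum at most that of its upper corner, so the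
  hypothesis \<open>orth\<close> reaches each of them.\<close>

lemma emeasure_simplex_law:
  fixes X1 X2 X3 :: "'a \<Rightarrow> real"
  assumes "finite_measure M"
    and X[measurable]: "X1 \<in> borel_measurable M" "X2 \<in> borel_measurable M" "X3 \<in> borel_measurable M"
    and k: "0 \<le> k1" "0 \<le> k2" "0 \<le> k3" and K: "0 \<le> K"
    and Xk: "\<And>x. x \<in> space M \<Longrightarrow> k1 \<le> X1 x \<and> k2 \<le> X2 x \<and> k3 \<le> X3 x"
    and orth: "\<And>a1 a2 a3. \<lbrakk>k1 \<le> a1; k2 \<le> a2; k3 \<le> a3; a1 + a2 + a3 \<le> 1\<rbrakk> \<Longrightarrow>
      measure M {x \<in> space M. a1 \<le> X1 x \<and> a2 \<le> X2 x \<and> a3 \<le> X3 x} = K * ((1 - a1\<^sup>2 - a2\<^sup>2 - a3\<^sup>2) / 2) ^ n"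
  shows "emeasure M {x \<in> space M. X1 x + X2 x + X3 x < 1}
    = ennreal K * (\<integral>\<^sup>+z. (case z of ((c1, c2), c3) \<Rightarrow> ennreal (simplex_density n c1 c2 c3) *
        indicator {((c1, c2), c3). k1 \<le> c1 \<and> k2 \<le> c2 \<and> k3 \<le> c3 \<and> c1 + c2 + c3 < 1} z) \<partial>lborel3)"
proof -
  interpret finite_measure M by fact
  define p where "p = (\<lambda>((c1, c2), c3). ennreal K * ennreal (simplex_density n c1 c2 c3))"
  have p[measurable]: "p \<in> borel_measurable lborel3"
    unfolding p_def simplex_density_def case_prod_beta by measurable
  define N where "N = density lborel3 p"
  have sN[measurable_cong]: "sets N = sets lborel3" by (simp add: N_def)
  have spN: "space N = UNIV" by (simp add: N_def space_pair_measure)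
  define U where "U a1 a2 a3 = {x \<in> space M. a1 \<le> X1 x \<and> a2 \<le> X2 x \<and> a3 \<le> X3 x}" for a1 a2 a3
  have U[measurable]: "U a1 a2 a3 \<in> sets M" for a1 a2 a3 unfolding U_def by measurable
  define F where "F a b c = ((1 - a\<^sup>2 - b\<^sup>2 - c\<^sup>2) / 2 :: real) ^ n" for a b c
  have UF: "measure M (U a1 a2 a3) = K * F a1 a2 a3" if "k1 \<le> a1" "k2 \<le> a2" "k3 \<le> a3" "a1 + a2 + a3 \<le> 1" for a1 a2 a3
    using orth[OF that] by (simp add: U_def F_def)
  have "emeasure M {x \<in> space M. k1 \<le> X1 x \<and> k2 \<le> X2 x \<and> k3 \<le> X3 x \<and> X1 x + X2 x + X3 x < 1}
    = emeasure N {z \<in> space N. k1 \<le> fst (fst z) \<and> k2 \<le> snd (fst z) \<and> k3 \<le> snd z \<and> fst (fst z) + snd (fst z) + snd z < 1}"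
  proof (rule emeasure_simplex_eqI)
    show "emeasure M (space M) \<noteq> \<infinity>" by simp
    fix b1 b2 b3 assume b: "k1 < b1" "k2 < b2" "k3 < b3" "b1 + b2 + b3 \<le> 1"
    \<comment> \<open>Removing one upper orthant per coordinate, one coordinate at a time; each step
      subtracts a subset, so finite measures subtract.\<close>
    define V2 where "V2 a2 a3 = U k1 a2 a3 - U b1 a2 a3" for a2 a3
    define V3 where "V3 a3 = V2 k2 a3 - V2 b2 a3" for a3
    have [measurable]: "V2 a2 a3 \<in> sets M" "V3 a3 \<in> sets M" for a2 a3 by (auto simp: V2_def V3_def)
    have mV2: "measure M (V2 a2 a3) = measure M (U k1 a2 a3) - measure M (U b1 a2 a3)" for a2 a3
      unfolding V2_def using b by (intro finite_measure_Diff) (auto simp: U_def)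
    have mV3: "measure M (V3 a3) = measure M (V2 k2 a3) - measure M (V2 b2 a3)" for a3
      unfolding V3_def using b by (intro finite_measure_Diff) (auto simp: U_def V2_def)
    have "{x \<in> space M. k1 \<le> X1 x \<and> X1 x < b1 \<and> k2 \<le> X2 x \<and> X2 x < b2 \<and> k3 \<le> X3 x \<and> X3 x < b3} = V3 k3 - V3 b3"
      using b unfolding V3_def V2_def U_def by auto
    moreover have "measure M (V3 k3 - V3 b3) = measure M (V3 k3) - measure M (V3 b3)"
      using b by (intro finite_measure_Diff) (auto simp: U_def V2_def V3_def)
    ultimately have "emeasure M {x \<in> space M. k1 \<le> X1 x \<and> X1 x < b1 \<and> k2 \<le> X2 x \<and> X2 x < b2 \<and> k3 \<le> X3 x \<and> X3 x < b3}
      = ennreal (measure M (V3 k3) - measure M (V3 b3))"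
      by (simp add: emeasure_eq_measure)
    also have "measure M (V3 k3) - measure M (V3 b3) =
      K * (((F k1 k2 k3 - F k1 k2 b3) - (F k1 b2 k3 - F k1 b2 b3))
        - ((F b1 k2 k3 - F b1 k2 b3) - (F b1 b2 k3 - F b1 b2 b3)))"
      unfolding mV3 mV2 using b by (simp add: UF algebra_simps)
    also have "ennreal \<dots> = ennreal K * ennreal (((F k1 k2 k3 - F k1 k2 b3) - (F k1 b2 k3 - F k1 b2 b3))
        - ((F b1 k2 k3 - F b1 k2 b3) - (F b1 b2 k3 - F b1 b2 b3)))"
      using K by (rule ennreal_mult')
    also have "\<dots> = ennreal K * (\<integral>\<^sup>+z. (case z of ((c1, c2), c3) \<Rightarrow> ennreal (simplex_density n c1 c2 c3) *
      (indicator {k1..<b1} c1 * indicator {k2..<b2} c2 * indicator {k3..<b3} c3)) \<partial>lborel3)"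
      unfolding F_def by (subst nn_integral_simplex_density_box[OF k b]) simp
    also have "\<dots> = (\<integral>\<^sup>+z. ennreal K * (case z of ((c1, c2), c3) \<Rightarrow> ennreal (simplex_density n c1 c2 c3) *
      (indicator {k1..<b1} c1 * indicator {k2..<b2} c2 * indicator {k3..<b3} c3)) \<partial>lborel3)"
      unfolding simplex_density_def case_prod_beta by (rule nn_integral_cmult[symmetric]) measurable
    also have "\<dots> = (\<integral>\<^sup>+z. p z * indicator {z. k1 \<le> fst (fst z) \<and> fst (fst z) < b1 \<and> k2 \<le> snd (fst z)
        \<and> snd (fst z) < b2 \<and> k3 \<le> snd z \<and> snd z < b3} z \<partial>lborel3)"
      by (intro nn_integral_cong) (auto simp: p_def indicator_def split: prod.splits)
    also have "\<dots> = emeasure N {z. k1 \<le> fst (fst z) \<and> fst (fst z) < b1 \<and> k2 \<le> snd (fst z)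
        \<and> snd (fst z) < b2 \<and> k3 \<le> snd z \<and> snd z < b3}"
    proof -
      have "{z \<in> space lborel3. k1 \<le> fst (fst z) \<and> fst (fst z) < b1 \<and> k2 \<le> snd (fst z)
        \<and> snd (fst z) < b2 \<and> k3 \<le> snd z \<and> snd z < b3} \<in> sets lborel3" by measurable
      then show ?thesis unfolding N_def by (subst emeasure_density) (auto simp: space_pair_measure)
    qed
    finally show "emeasure M {x \<in> space M. k1 \<le> X1 x \<and> X1 x < b1 \<and> k2 \<le> X2 x \<and> X2 x < b2 \<and> k3 \<le> X3 x \<and> X3 x < b3}
      = emeasure N {z \<in> space N. k1 \<le> fst (fst z) \<and> fst (fst z) < b1 \<and> k2 \<le> snd (fst z)
        \<and> snd (fst z) < b2 \<and> k3 \<le> snd z \<and> snd z < b3}" by (simp add: spN)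
  qed (use X in measurable)
  also have "\<dots> = (\<integral>\<^sup>+z. p z * indicator {z. k1 \<le> fst (fst z) \<and> k2 \<le> snd (fst z) \<and> k3 \<le> snd z
      \<and> fst (fst z) + snd (fst z) + snd z < 1} z \<partial>lborel3)"
  proof -
    have "{z \<in> space lborel3. k1 \<le> fst (fst z) \<and> k2 \<le> snd (fst z) \<and> k3 \<le> snd z
      \<and> fst (fst z) + snd (fst z) + snd z < 1} \<in> sets lborel3" by measurable
    then show ?thesis unfolding N_def by (subst emeasure_density) (auto simp: space_pair_measure)
  qed
  also have "\<dots> = (\<integral>\<^sup>+z. ennreal K * (case z of ((c1, c2), c3) \<Rightarrow> ennreal (simplex_density n c1 c2 c3) *
        indicator {((c1, c2), c3). k1 \<le> c1 \<and> k2 \<le> c2 \<and> k3 \<le> c3 \<and> c1 + c2 + c3 < 1} z) \<partial>lborel3)"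
    by (intro nn_integral_cong) (auto simp: p_def indicator_def mult.assoc split: prod.splits)
  also have "\<dots> = ennreal K * (\<integral>\<^sup>+z. (case z of ((c1, c2), c3) \<Rightarrow> ennreal (simplex_density n c1 c2 c3) *
        indicator {((c1, c2), c3). k1 \<le> c1 \<and> k2 \<le> c2 \<and> k3 \<le> c3 \<and> c1 + c2 + c3 < 1} z) \<partial>lborel3)"
    unfolding simplex_density_def case_prod_beta by (rule nn_integral_cmult) measurable
  finally show ?thesis using Xk by (simp cong: conj_cong)
qed

section \<open>Volumes as iterated integrals\<close>

abbreviation Mx :: "nat \<Rightarrow> (nat \<times> nat \<Rightarrow> real) measure" where
  "Mx n \<equiv> Pi\<^sub>M ({1..<3} \<times> {1..n}) (\<lambda>_. lborel)"

abbreviation My :: "(nat \<Rightarrow> real) measure" where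
  "My \<equiv> Pi\<^sub>M {1..3} (\<lambda>_. lborel)"

abbreviation Mxy :: "nat \<Rightarrow> ((nat \<times> nat \<Rightarrow> real) \<times> (nat \<Rightarrow> real)) measure" where
  "Mxy n \<equiv> Mx n \<Otimes>\<^sub>M My"

text \<open>Membership in \<open>space (Mxy n)\<close> encodes extensionality, which all values of
  \<open>coord_proj\<close> have. The deleted third row is present through the last two bounds of
  \<open>hexagon\<close>.\<close>

definition PD_coord :: "nat \<Rightarrow> ((nat \<times> nat \<Rightarrow> real) \<times> (nat \<Rightarrow> real)) set" where
  "PD_coord n = {z \<in> space (Mxy n).
     (\<forall>j\<in>{1..n}. (fst z (1, j), fst z (2, j)) \<in> hexagon 0 0 0 (snd z 1) (snd z 2) (snd z 3)) \<and>
     snd z 1 \<le> 1 \<and> snd z 2 \<le> 1 \<and> snd z 3 \<le> 1}"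

definition gap_coord :: "nat \<Rightarrow> ((nat \<times> nat \<Rightarrow> real) \<times> (nat \<Rightarrow> real)) set" where
  "gap_coord n = {z \<in> PD_coord n. \<exists>j1\<in>{1..n}. \<exists>j2\<in>{1..n}. \<exists>j3\<in>{1..n}.
     fst z (1, j1) + fst z (2, j2) + (1 - fst z (1, j3) - fst z (2, j3)) + snd z 1 + snd z 2 + snd z 3 < 2}"

section \<open>Images of the polytope and of its hull under the projection\<close>

lemma index_1_3: "{1..<3::nat} = {1, 2}" by auto

text \<open>A right inverse of the projection: the deleted entries x_3j are restored from the column
  sums.\<close>

lemma coord_proj_lift:
  assumes "(f, g) \<in> space (Mxy n)"
  obtains x y where "(x, y) \<in> ambient 3 n" "coord_proj 3 n (x, y) = (f, g)"
    "\<And>j. j \<in> {1..n} \<Longrightarrow> lookup x (1, j) = f (1, j)"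
    "\<And>j. j \<in> {1..n} \<Longrightarrow> lookup x (2, j) = f (2, j)"
    "\<And>j. j \<in> {1..n} \<Longrightarrow> lookup x (3, j) = 1 - f (1, j) - f (2, j)"
    "\<And>i. i \<in> {1, 2, 3} \<Longrightarrow> lookup y i = g i"
proof
  define x where "x = Abs_poly_mapping (\<lambda>(i, j). if i \<in> {1, 2, 3} \<and> j \<in> {1..n}
    then if i = 3 then 1 - f (1, j) - f (2, j) else f (i, j) else 0)"
  define y where "y = Abs_poly_mapping (\<lambda>i. if i \<in> {1, 2, 3} then g i else 0)"
  have lx: "lookup x (i, j) = (if i \<in> {1, 2, 3} \<and> j \<in> {1..n}
    then if i = 3 then 1 - f (1, j) - f (2, j) else f (i, j) else 0)" for i j
  proof -
    have "finite {p. (case p of (i, j) \<Rightarrow> if i \<in> {1, 2, 3} \<and> j \<in> {1..n}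
      then if i = 3 then 1 - f (1, j) - f (2, j) else f (i, j) else 0) \<noteq> 0}"
      by (rule finite_subset[of _ "{1, 2, 3} \<times> {1..n}"]) (auto split: if_splits)
    then show ?thesis by (simp add: x_def)
  qed
  have ly: "lookup y i = (if i \<in> {1, 2, 3} then g i else 0)" for i
  proof -
    have "finite {i. (if i \<in> {1, 2, 3} then g i else 0) \<noteq> 0}"
      by (rule finite_subset[of _ "{1, 2, 3}"]) (auto split: if_splits)
    then show ?thesis by (simp add: y_def)
  qed
  show "(x, y) \<in> ambient 3 n"
    unfolding ambient_iff atLeastAtMost_1_3 lx ly by auto
  show "coord_proj 3 n (x, y) = (f, g)"
  proof -
    have ext: "f \<in> extensional ({1..<3} \<times> {1..n})" "g \<in> extensional {1..3}"
      using assms by (auto simp: space_pair_measure space_PiM PiE_def)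
    have "restrict (lookup x) ({1..<3} \<times> {1..n}) = f"
    proof (rule extensionalityI[OF _ ext(1)])
      fix k assume "k \<in> {1..<3::nat} \<times> {1..n}"
      then obtain i j where "k = (i, j)" "i \<in> {1, 2}" "j \<in> {1..n}" unfolding index_1_3 by auto
      then show "restrict (lookup x) ({1..<3} \<times> {1..n}) k = f k"
        unfolding index_1_3 by (auto simp: lx)
    qed simp
    moreover have "restrict (lookup y) {1..3} = g"
      by (rule extensionalityI[OF _ ext(2)]) (auto simp: ly)
    ultimately show ?thesis by (simp add: coord_proj_def)
  qed
  show "lookup x (1, j) = f (1, j)" "lookup x (2, j) = f (2, j)"
    "lookup x (3, j) = 1 - f (1, j) - f (2, j)" if "j \<in> {1..n}" for j
    using that by (simp_all add: lx)
  show "lookup y i = g i" if "i \<in> {1, 2, 3}" for i using that by (simp add: ly)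
qed

lemma PD_iff:
  "(x, y) \<in> P_set 3 n \<inter> D_set 3 n \<longleftrightarrow> (x, y) \<in> ambient 3 n \<and>
    (\<forall>j\<in>{1..n}. (lookup x (1, j), lookup x (2, j)) \<in>
        hexagon 0 0 0 (lookup y 1) (lookup y 2) (lookup y 3) \<and>
      lookup x (3, j) = 1 - lookup x (1, j) - lookup x (2, j)) \<and>
    lookup y 1 \<le> 1 \<and> lookup y 2 \<le> 1 \<and> lookup y 3 \<le> 1"
proof -
  have e: "((a, b) \<in> hexagon 0 0 0 u v w \<and> c = 1 - a - b) \<longleftrightarrow>
      (0 \<le> a \<and> a \<le> u) \<and> (0 \<le> b \<and> b \<le> v) \<and> (0 \<le> c \<and> c \<le> w) \<and> a + b + c = 1" for a b c u v w :: real
    unfolding hexagon_def by auto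
  have "(\<Sum>i=1..3. lookup x (i, j)) =
    lookup x (1, j) + lookup x (2, j) + lookup x (3, j)" for j
    unfolding atLeastAtMost_1_3 by (simp add: add.assoc)
  then show ?thesis
    unfolding P_set_def D_set_def Int_iff mem_Collect_eq prod.case e
    unfolding atLeastAtMost_1_3 by (simp add: add.assoc del: One_nat_def) blast
qed

lemma coord_proj_space:
  "coord_proj 3 n (x, y) \<in> space (Mxy n)"
  by (simp add: coord_proj_def space_pair_measure space_PiM)

lemma coord_proj_simps:
  "j \<in> {1..n} \<Longrightarrow> fst (coord_proj 3 n (x, y)) (1, j) = lookup x (1, j)"
  "j \<in> {1..n} \<Longrightarrow> fst (coord_proj 3 n (x, y)) (2, j) = lookup x (2, j)"
  "i \<in> {1, 2, 3} \<Longrightarrow> snd (coord_proj 3 n (x, y)) i = lookup y i"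
  by (auto simp: coord_proj_def)

lemma coord_proj_PD: "coord_proj 3 n ` (P_set 3 n \<inter> D_set 3 n) = PD_coord n"
proof (intro set_eqI iffI)
  fix z assume "z \<in> coord_proj 3 n ` (P_set 3 n \<inter> D_set 3 n)"
  then obtain x y where z: "z = coord_proj 3 n (x, y)" and xy: "(x, y) \<in> P_set 3 n \<inter> D_set 3 n" by auto
  show "z \<in> PD_coord n"
    using xy unfolding PD_iff PD_coord_def z
    by (simp add: coord_proj_simps coord_proj_space del: One_nat_def)
next
  fix z assume z: "z \<in> PD_coord n"
  obtain f g where fg: "z = (f, g)" by force
  have "(f, g) \<in> space (Mxy n)" using z by (simp add: PD_coord_def fg)
  then obtain x y where xy: "(x, y) \<in> ambient 3 n" "coord_proj 3 n (x, y) = (f, g)"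
    "\<And>j. j \<in> {1..n} \<Longrightarrow> lookup x (1, j) = f (1, j)"
    "\<And>j. j \<in> {1..n} \<Longrightarrow> lookup x (2, j) = f (2, j)"
    "\<And>j. j \<in> {1..n} \<Longrightarrow> lookup x (3, j) = 1 - f (1, j) - f (2, j)"
    "\<And>i. i \<in> {1, 2, 3} \<Longrightarrow> lookup y i = g i" by (rule coord_proj_lift) blast
  have "(x, y) \<in> P_set 3 n \<inter> D_set 3 n"
    using z xy(1) unfolding PD_iff PD_coord_def fg by (simp add: xy(3-6) del: One_nat_def)
  then show "z \<in> coord_proj 3 n ` (P_set 3 n \<inter> D_set 3 n)"
    unfolding fg xy(2)[symmetric] by (rule imageI)
qed

text \<open>On P and D the deleted entries are determined by the others, so whether an odd cycle
  inequality fails can be read off from the projected point; any preimage therefore decides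
  membership in the hull.\<close>

lemma coord_proj_hull:
  assumes n: "n \<ge> 1"
  shows "coord_proj 3 n ` integer_hull 3 n = PD_coord n - gap_coord n"
proof (intro set_eqI iffI)
  fix z assume "z \<in> coord_proj 3 n ` integer_hull 3 n"
  then obtain x y where z: "z = coord_proj 3 n (x, y)" and xy: "(x, y) \<in> P_set 3 n \<inter> D_set 3 n"
    "(x, y) \<in> odd_cycle_set n" unfolding integer_hull_eq[OF n] by auto
  have "z \<in> PD_coord n" unfolding coord_proj_PD[symmetric] z using xy(1) by (rule imageI)
  moreover have "z \<notin> gap_coord n"
  proof
    assume "z \<in> gap_coord n"
    then obtain j1 j2 j3 where j: "j1 \<in> {1..n}" "j2 \<in> {1..n}" "j3 \<in> {1..n}"
      "fst z (1, j1) + fst z (2, j2) + (1 - fst z (1, j3) - fst z (2, j3)) + snd z 1 + snd z 2 + snd z 3 < 2"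
      unfolding gap_coord_def by blast
    moreover have "lookup x (3, j3) = 1 - lookup x (1, j3) - lookup x (2, j3)"
      using xy(1) j(3) unfolding PD_iff by blast
    moreover have "2 \<le> lookup x (1, j1) + lookup x (2, j2) + lookup x (3, j3)
       + lookup y 1 + lookup y 2 + lookup y 3"
      using xy(2) j(1-3) unfolding odd_cycle_set_def by blast
    ultimately show False
      unfolding z by (simp add: coord_proj_simps del: One_nat_def)
  qed
  ultimately show "z \<in> PD_coord n - gap_coord n" by simp
next
  fix z assume z: "z \<in> PD_coord n - gap_coord n"
  then obtain x y where zz: "z = coord_proj 3 n (x, y)" and xy: "(x, y) \<in> P_set 3 n \<inter> D_set 3 n"
    unfolding coord_proj_PD[symmetric] by auto
  have "2 \<le> lookup x (1, j1) + lookup x (2, j2) + lookup x (3, j3)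
       + lookup y 1 + lookup y 2 + lookup y 3"
    if j: "j1 \<in> {1..n}" "j2 \<in> {1..n}" "j3 \<in> {1..n}" for j1 j2 j3
  proof -
    have "lookup x (3, j3) = 1 - lookup x (1, j3) - lookup x (2, j3)"
      using xy j(3) unfolding PD_iff by blast
    moreover have "\<not> fst z (1, j1) + fst z (2, j2) + (1 - fst z (1, j3) - fst z (2, j3)) + snd z 1 + snd z 2 + snd z 3 < 2"
      using z j unfolding gap_coord_def by blast
    ultimately show ?thesis using j unfolding zz by (simp add: coord_proj_simps del: One_nat_def)
  qed
  then have "(x, y) \<in> integer_hull 3 n"
    using xy unfolding integer_hull_eq[OF n] odd_cycle_set_def by blast
  then show "z \<in> coord_proj 3 n ` integer_hull 3 n" unfolding zz by (rule imageI)
qed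

section \<open>Measurability and slicing along y\<close>

lemma measurable_Mx:
  "i \<in> {1..<3} \<Longrightarrow> j \<in> {1..n} \<Longrightarrow> (\<lambda>f. f (i, j)) \<in> borel_measurable (Mx n)"
  using measurable_component_singleton[of "(i, j)" "{1..<3} \<times> {1..n}" "\<lambda>_. lborel :: real measure"] by simp

lemma measurable_My: "i \<in> {1..3} \<Longrightarrow> (\<lambda>g. g i) \<in> borel_measurable My"
  using measurable_component_singleton[of i "{1..3}" "\<lambda>_. lborel :: real measure"] by simp

lemma measurable_xy:
  "j \<in> {1..n} \<Longrightarrow> (\<lambda>z. fst z (1, j)) \<in> borel_measurable (Mxy n)"
  "j \<in> {1..n} \<Longrightarrow> (\<lambda>z. fst z (2, j)) \<in> borel_measurable (Mxy n)"
  "i \<in> {1, 2, 3} \<Longrightarrow> (\<lambda>z. snd z i) \<in> borel_measurable (Mxy n)"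
  by (rule measurable_compose[OF measurable_fst measurable_Mx], simp, simp)
    (rule measurable_compose[OF measurable_fst measurable_Mx], simp, simp,
     rule measurable_compose[OF measurable_snd measurable_My], auto)

lemma PD_coord_measurable [measurable]: "PD_coord n \<in> sets (Mxy n)"
  unfolding PD_coord_def hexagon_def mem_Collect_eq prod.case
  by (intro sets.sets_Collect_conj sets.sets_Collect_finite_All borel_measurable_le borel_measurable_const
    borel_measurable_diff measurable_xy) auto

lemma gap_coord_measurable [measurable]: "gap_coord n \<in> sets (Mxy n)"
proof -
  have A: "{z \<in> space (Mxy n). \<exists>j1\<in>{1..n}. \<exists>j2\<in>{1..n}. \<exists>j3\<in>{1..n}.
     fst z (1, j1) + fst z (2, j2) + (1 - fst z (1, j3) - fst z (2, j3)) + snd z 1 + snd z 2 + snd z 3 < 2}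
     \<in> sets (Mxy n)"
    by (intro sets.sets_Collect_finite_Ex borel_measurable_less borel_measurable_const
      borel_measurable_diff borel_measurable_add measurable_xy) auto
  have e: "gap_coord n = PD_coord n \<inter> {z \<in> space (Mxy n). \<exists>j1\<in>{1..n}. \<exists>j2\<in>{1..n}. \<exists>j3\<in>{1..n}.
     fst z (1, j1) + fst z (2, j2) + (1 - fst z (1, j3) - fst z (2, j3)) + snd z 1 + snd z 2 + snd z 3 < 2}"
    unfolding gap_coord_def PD_coord_def by blast
  show ?thesis unfolding e by (rule sets.Int[OF PD_coord_measurable A])
qed

lemma sigma_finite_PiM_lborel:
  "finite I \<Longrightarrow> sigma_finite_measure (Pi\<^sub>M I (\<lambda>_. lborel :: real measure))"
  by (rule product_sigma_finite.sigma_finite) (simp_all add: product_sigma_finite_def sigma_finite_lborel)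

lemma pair_sigma_finite_PiM:
  assumes "finite I" "finite J"
  shows "pair_sigma_finite (Pi\<^sub>M I (\<lambda>_. lborel :: real measure)) (Pi\<^sub>M J (\<lambda>_. lborel :: real measure))"
  unfolding pair_sigma_finite_def using assms by (auto intro: sigma_finite_PiM_lborel)

text \<open>Moves integration over y from functions on {1..3} to nested pairs of reals, where Fubini
  and affine substitutions are applied coordinatewise.\<close>

lemma nn_integral_My:
  assumes h[measurable]: "h \<in> borel_measurable lborel3"
  shows "(\<integral>\<^sup>+g. h ((g 1, g 2), g 3) \<partial>My) = integral\<^sup>N lborel3 h"
proof -
  interpret p: product_sigma_finite "\<lambda>_ :: nat. lborel :: real measure" by standard
  have e: "{1..3} = insert 3 {1, 2::nat}" by auto
  have "(\<lambda>g. ((g 1, g 2), g 3)) \<in> measurable My lborel3"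
    by (intro measurable_Pair measurable_component_singleton) auto
  then have m: "(\<lambda>g. h ((g 1, g 2), g 3)) \<in> borel_measurable My"
    by (rule measurable_compose) fact
  have "(\<integral>\<^sup>+g. h ((g 1, g 2), g 3) \<partial>My)
      = (\<integral>\<^sup>+g. \<integral>\<^sup>+z. h (((g(3 := z)) 1, (g(3 := z)) 2), (g(3 := z)) 3) \<partial>lborel \<partial>Pi\<^sub>M {1, 2::nat} (\<lambda>_. lborel))"
    unfolding e by (rule p.product_nn_integral_insert) (use m in \<open>simp_all add: e\<close>)
  also have "\<dots> = (\<integral>\<^sup>+g. (\<lambda>a b. \<integral>\<^sup>+z. h ((a, b), z) \<partial>lborel) (g 1) (g 2) \<partial>Pi\<^sub>M {1, 2::nat} (\<lambda>_. lborel))"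
    by simp
  also have "\<dots> = (\<integral>\<^sup>+w. (\<lambda>a b. \<integral>\<^sup>+z. h ((a, b), z) \<partial>lborel) (fst w) (snd w) \<partial>lborel2)"
    by (rule p.product_nn_integral_pair) (simp_all, measurable)
  also have "\<dots> = integral\<^sup>N lborel3 h"
    by (simp add: lborel.nn_integral_fst)
  finally show ?thesis .
qed

abbreviation "pr1 \<equiv> \<lambda>z :: (real \<times> real) \<times> real. fst (fst z)"
abbreviation "pr2 \<equiv> \<lambda>z :: (real \<times> real) \<times> real. snd (fst z)"
abbreviation "pr3 \<equiv> \<lambda>z :: (real \<times> real) \<times> real. snd z"
abbreviation "tot \<equiv> \<lambda>z. pr1 z + pr2 z + pr3 z"

definition hex_area :: "(real \<times> real) \<times> real \<Rightarrow> ennreal" where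
  "hex_area y = emeasure lborel (hexagon 0 0 0 (pr1 y) (pr2 y) (pr3 y))"

text \<open>The area is the measure of a section of a measurable set in five variables; no case
  distinction on the shape of the hexagon is made.\<close>

lemma hex_area_measurable [measurable]: "hex_area \<in> borel_measurable lborel3"
proof -
  let ?Q = "{w \<in> space (lborel3 \<Otimes>\<^sub>M lborel2). 0 \<le> fst (snd w) \<and> fst (snd w) \<le> pr1 (fst w) \<and> 0 \<le> snd (snd w) \<and>
    snd (snd w) \<le> pr2 (fst w) \<and> 0 \<le> 1 - fst (snd w) - snd (snd w) \<and> 1 - fst (snd w) - snd (snd w) \<le> pr3 (fst w)}"
  have "?Q \<in> sets (lborel3 \<Otimes>\<^sub>M lborel2)" by measurable
  also have "sets (lborel3 \<Otimes>\<^sub>M lborel2) = sets (lborel3 \<Otimes>\<^sub>M (lborel :: (real \<times> real) measure))"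
    by (rule sets_pair_measure_cong) (simp_all only: lborel_prod)
  finally have "(\<lambda>z. emeasure (lborel :: (real \<times> real) measure) (Pair z -` ?Q)) \<in> borel_measurable lborel3"
    by (rule lborel.measurable_emeasure_Pair)
  moreover have "Pair z -` ?Q = hexagon 0 0 0 (pr1 z) (pr2 z) (pr3 z)" for z
    by (auto simp: hexagon_def space_pair_measure)
  ultimately show ?thesis unfolding hex_area_def by simp
qed

lemma pair_sigma_finite_lborel3: "pair_sigma_finite lborel3 lborel3"
  by (simp only: lborel_prod pair_sigma_finite_def sigma_finite_lborel simp_thms)

lemma emeasure_by_slices:
  assumes S: "S \<in> sets (Mxy n)" and h: "h \<in> borel_measurable lborel3"
    and slice: "\<And>g. g \<in> space My \<Longrightarrow> emeasure (Mx n) ((\<lambda>f. (f, g)) -` S) = h ((g 1, g 2), g 3)"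
  shows "emeasure (Mxy n) S = integral\<^sup>N lborel3 h"
proof -
  interpret pair_sigma_finite "Mx n" My by (rule pair_sigma_finite_PiM) auto
  have "emeasure (Mxy n) S = (\<integral>\<^sup>+g. emeasure (Mx n) ((\<lambda>f. (f, g)) -` S) \<partial>My)"
    by (rule emeasure_pair_measure_alt2[OF S])
  also have "\<dots> = (\<integral>\<^sup>+g. h ((g 1, g 2), g 3) \<partial>My)"
    by (rule nn_integral_cong) (rule slice)
  also have "\<dots> = integral\<^sup>N lborel3 h" by (rule nn_integral_My[OF h])
  finally show ?thesis .
qed

lemma emeasure_PD_coord:
  assumes n: "n \<ge> 1"
  shows "emeasure (Mxy n) (PD_coord n)
    = (\<integral>\<^sup>+y. (if pr1 y \<le> 1 \<and> pr2 y \<le> 1 \<and> pr3 y \<le> 1 then hex_area y ^ n else 0) \<partial>lborel3)"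
proof (rule emeasure_by_slices)
  show "PD_coord n \<in> sets (Mxy n)" by (rule PD_coord_measurable)
  show "(\<lambda>y. if pr1 y \<le> 1 \<and> pr2 y \<le> 1 \<and> pr3 y \<le> 1 then hex_area y ^ n else 0) \<in> borel_measurable lborel3"
    by measurable
  fix g assume g: "g \<in> space My"
  show "emeasure (Mx n) ((\<lambda>f. (f, g)) -` PD_coord n)
    = (if pr1 ((g 1, g 2), g 3) \<le> 1 \<and> pr2 ((g 1, g 2), g 3) \<le> 1 \<and> pr3 ((g 1, g 2), g 3) \<le> 1
       then hex_area ((g 1, g 2), g 3) ^ n else 0)"
  proof (cases "g 1 \<le> 1 \<and> g 2 \<le> 1 \<and> g 3 \<le> 1")
    case True
    then have e: "(\<lambda>f. (f, g)) -` PD_coord n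
      = {x \<in> space (Mx n). \<forall>j\<in>{1..n}. (x (1, j), x (2, j)) \<in> hexagon 0 0 0 (g 1) (g 2) (g 3)}"
      using g unfolding PD_coord_def space_pair_measure by auto
    show ?thesis
      unfolding e hex_area_def using True by (simp add: emeasure_PiM_pairs[OF hexagon_measurable, unfolded One_nat_def])
  next
    case False
    then have "(\<lambda>f. (f, g)) -` PD_coord n = {}" unfolding PD_coord_def by auto
    then show ?thesis using False by auto
  qed
qed

text \<open>The range of (c1, c2, c3) for given y: mu_i >= 0 is the condition tau (1 - c_i) <= y_i,
  and mu_i >= y_i - tau is c_i >= 0. Without division by tau it is linear in y for fixed c and tau,
  which suits the exchange of integrals.\<close>

definition gap_region :: "real \<Rightarrow> real \<Rightarrow> real \<Rightarrow> real \<Rightarrow> real \<Rightarrow> real \<Rightarrow> bool" where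
  "gap_region y1 y2 y3 c1 c2 c3 \<longleftrightarrow> 0 \<le> c1 \<and> 0 \<le> c2 \<and> 0 \<le> c3 \<and> c1 + c2 + c3 < 1 \<and>
     1 < y1 + y2 + y3 \<and> (y1 + y2 + y3 - 1) * (1 - c1) \<le> y1 \<and> (y1 + y2 + y3 - 1) * (1 - c2) \<le> y2 \<and>
     (y1 + y2 + y3 - 1) * (1 - c3) \<le> y3"

abbreviation gap_integrand :: "nat \<Rightarrow> (real \<times> real) \<times> real \<Rightarrow> (real \<times> real) \<times> real \<Rightarrow> ennreal" where
  "gap_integrand n y c \<equiv> (if pr1 y \<le> 1 \<and> pr2 y \<le> 1 \<and> pr3 y \<le> 1 \<and>
      gap_region (pr1 y) (pr2 y) (pr3 y) (pr1 c) (pr2 c) (pr3 c)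
    then ennreal ((tot y - 1) ^ (2 * n) * simplex_density n (pr1 c) (pr2 c) (pr3 c)) else 0)"

lemma emeasure_hexagon_le_half: "emeasure lborel (hexagon 0 0 0 y1 y2 y3) \<le> ennreal (1 / 2)"
proof -
  have "emeasure lborel (hexagon 0 0 0 y1 y2 y3) \<le> emeasure lborel (hexagon 0 0 0 1 1 1)"
    by (rule emeasure_mono, force simp: hexagon_def, simp add: hexagon_measurable)
  also have "\<dots> = ennreal ((2\<^sup>2 - 1\<^sup>2 - 1\<^sup>2 - 1\<^sup>2) / 2)"
    by (rule emeasure_hexagon) auto
  finally show ?thesis by simp
qed

lemma gap_slice_eq_0:
  assumes n: "n \<ge> 1" and s: "y1 + y2 + y3 \<le> 1"
  shows "emeasure (Mx n) {f \<in> space (Mx n). \<forall>j\<in>{1..n}. (f (1, j), f (2, j)) \<in> hexagon 0 0 0 y1 y2 y3} = 0"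
proof -
  have "emeasure lborel (hexagon 0 0 0 y1 y2 y3) = 0"
  proof (cases "y1 + y2 + y3 = 1")
    case True
    have "emeasure lborel (hexagon 0 0 0 y1 y2 y3) \<le> emeasure lborel (hexagon y1 y2 y3 y1 y2 y3)"
      by (rule emeasure_mono, use True in \<open>force simp: hexagon_def\<close>, simp add: hexagon_measurable)
    also have "\<dots> = ennreal ((0\<^sup>2 - 0\<^sup>2 - 0\<^sup>2 - 0\<^sup>2) / 2)"
      using True by (intro emeasure_hexagon) auto
    finally show ?thesis by simp
  next
    case False
    then have "hexagon 0 0 0 y1 y2 y3 = {}" using s by (auto simp: hexagon_def)
    then show ?thesis by simp
  qed
  then show ?thesis using n by (subst emeasure_PiM_pairs) auto
qed

lemma ex3_Min_less:
  fixes u v w :: "'b \<Rightarrow> 'c::{linordered_ab_semigroup_add}"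
  assumes "finite J" "J \<noteq> {}"
  shows "(\<exists>j1\<in>J. \<exists>j2\<in>J. \<exists>j3\<in>J. u j1 + v j2 + w j3 < t) \<longleftrightarrow> Min (u ` J) + Min (v ` J) + Min (w ` J) < t"
proof
  assume "\<exists>j1\<in>J. \<exists>j2\<in>J. \<exists>j3\<in>J. u j1 + v j2 + w j3 < t"
  then obtain j1 j2 j3 where j: "j1 \<in> J" "j2 \<in> J" "j3 \<in> J" "u j1 + v j2 + w j3 < t" by blast
  then have "Min (u ` J) + Min (v ` J) + Min (w ` J) \<le> u j1 + v j2 + w j3"
    using assms by (intro add_mono) auto
  then show "Min (u ` J) + Min (v ` J) + Min (w ` J) < t" using j(4) by (rule le_less_trans)
next
  assume a: "Min (u ` J) + Min (v ` J) + Min (w ` J) < t"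
  have "Min (u ` J) \<in> u ` J" "Min (v ` J) \<in> v ` J" "Min (w ` J) \<in> w ` J"
    using assms by (auto intro!: Min_in)
  then obtain j1 j2 j3 where "j1 \<in> J" "Min (u ` J) = u j1" "j2 \<in> J" "Min (v ` J) = v j2" "j3 \<in> J" "Min (w ` J) = w j3"
    by auto
  then show "\<exists>j1\<in>J. \<exists>j2\<in>J. \<exists>j3\<in>J. u j1 + v j2 + w j3 < t" using a by auto
qed

text \<open>For fixed y, a lower bound on each c_i is a lower bound on every entry of row i, so
  orthants of c are n-th powers of hexagons. Their corner legs are tau a_i, which gives the
  hypothesis of \<open>emeasure_simplex_law\<close> with K = tau^(2n).\<close>

lemma emeasure_gap_slice:
  assumes n: "n \<ge> 1" and s: "1 < y1 + y2 + y3" and y: "y1 \<le> 1" "y2 \<le> 1" "y3 \<le> 1"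
  shows "emeasure (Mx n) {f \<in> space (Mx n). (\<forall>j\<in>{1..n}. (f (1, j), f (2, j)) \<in> hexagon 0 0 0 y1 y2 y3) \<and>
      (\<exists>j1\<in>{1..n}. \<exists>j2\<in>{1..n}. \<exists>j3\<in>{1..n}.
        f (1, j1) + f (2, j2) + (1 - f (1, j3) - f (2, j3)) + y1 + y2 + y3 < 2)}
    = (\<integral>\<^sup>+c. (if gap_region y1 y2 y3 (pr1 c) (pr2 c) (pr3 c)
        then ennreal ((y1 + y2 + y3 - 1) ^ (2 * n) * simplex_density n (pr1 c) (pr2 c) (pr3 c)) else 0) \<partial>lborel3)"
proof -
  let ?J = "{1..n}"
  define \<tau> where "\<tau> = y1 + y2 + y3 - 1"
  have \<tau>: "\<tau> > 0" using s by (simp add: \<tau>_def)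
  define W where "W = {f \<in> space (Mx n). \<forall>j\<in>?J. (f (1, j), f (2, j)) \<in> hexagon 0 0 0 y1 y2 y3}"
  define m1 where "m1 f = Min ((\<lambda>j. f (1::nat, j)) ` ?J)" for f :: "nat \<times> nat \<Rightarrow> real"
  define m2 where "m2 f = Min ((\<lambda>j. f (2::nat, j)) ` ?J)" for f :: "nat \<times> nat \<Rightarrow> real"
  define m3 where "m3 f = Min ((\<lambda>j. 1 - f (1::nat, j) - f (2, j)) ` ?J)" for f :: "nat \<times> nat \<Rightarrow> real"
  \<comment> \<open>This is c_i as a function of y_i and the row minimum.\<close>
  define X where "X y m = 1 - (y - m) / \<tau>" for y m :: real
  have J: "finite ?J" "?J \<noteq> {}" using n by auto
  have c1: "(\<lambda>f. f (1, j)) \<in> borel_measurable (Mx n)" and c2: "(\<lambda>f. f (2, j)) \<in> borel_measurable (Mx n)"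
    if "j \<in> ?J" for j by (rule measurable_Mx, simp, fact)+
  have mm: "m1 \<in> borel_measurable (Mx n)" "m2 \<in> borel_measurable (Mx n)" "m3 \<in> borel_measurable (Mx n)"
    unfolding m1_def m2_def m3_def
    by (intro borel_measurable_Min J borel_measurable_diff borel_measurable_const c1 c2; assumption)+
  have W: "W \<in> sets (Mx n)"
    unfolding W_def hexagon_def mem_Collect_eq prod.case
    by (intro sets.sets_Collect_conj sets.sets_Collect_finite_All borel_measurable_le borel_measurable_const
      borel_measurable_diff c1 c2) auto
  define M where "M = restrict_space (Mx n) W"
  have spM: "space M = W" unfolding M_def space_restrict_space using sets.sets_into_space[OF W] by auto
  have eM: "emeasure M A = emeasure (Mx n) A" if "A \<subseteq> W" for A
    unfolding M_def using that W by (intro emeasure_restrict_space) auto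
  have "emeasure (Mx n) W \<le> ennreal (1 / 2) ^ n"
    unfolding W_def emeasure_PiM_pairs[OF hexagon_measurable]
    by (intro power_mono emeasure_hexagon_le_half zero_le)
  then have eW: "emeasure (Mx n) W \<le> ennreal ((1 / 2) ^ n)"
    by (simp only: ennreal_power)
  have fM: "finite_measure M"
    using eW by (intro finite_measureI) (auto simp: spM eM top_unique)
  have mX: "(\<lambda>f. X y1 (m1 f)) \<in> borel_measurable M" "(\<lambda>f. X y2 (m2 f)) \<in> borel_measurable M"
    "(\<lambda>f. X y3 (m3 f)) \<in> borel_measurable M"
    unfolding M_def X_def
    by (intro measurable_restrict_space1 borel_measurable_diff borel_measurable_const borel_measurable_divide mm)+
  have Xge: "a \<le> X y m \<longleftrightarrow> y - \<tau> * (1 - a) \<le> m" for a y m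
  proof -
    have "a \<le> X y m \<longleftrightarrow> (y - m) / \<tau> \<le> 1 - a" by (auto simp: X_def)
    also have "\<dots> \<longleftrightarrow> y - m \<le> (1 - a) * \<tau>" using \<tau> by (simp add: pos_divide_le_eq)
    also have "\<dots> \<longleftrightarrow> y - \<tau> * (1 - a) \<le> m" by (auto simp: mult.commute)
    finally show ?thesis .
  qed
  have m_ge: "l \<le> m1 f \<longleftrightarrow> (\<forall>j\<in>?J. l \<le> f (1, j))" "l \<le> m2 f \<longleftrightarrow> (\<forall>j\<in>?J. l \<le> f (2, j))"
    "l \<le> m3 f \<longleftrightarrow> (\<forall>j\<in>?J. l \<le> 1 - f (1, j) - f (2, j))" for l f
    unfolding m1_def m2_def m3_def using J by (simp_all add: Min_ge_iff)
  \<comment> \<open>The least value that c_i can take, from the two lower bounds on the row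
    minimum.\<close>
  define k where "k y = max 0 (1 - y / \<tau>)" for y :: real
  have k0: "0 \<le> k y1" "0 \<le> k y2" "0 \<le> k y3" by (simp_all add: k_def)
  have kle: "k y \<le> a \<longleftrightarrow> 0 \<le> a \<and> \<tau> * (1 - a) \<le> y" for y a
  proof -
    have "1 - y / \<tau> \<le> a \<longleftrightarrow> 1 - a \<le> y / \<tau>" by auto
    also have "\<dots> \<longleftrightarrow> \<tau> * (1 - a) \<le> y" using \<tau> by (simp add: pos_le_divide_eq mult.commute)
    finally show ?thesis by (simp add: k_def)
  qed
  have Xk: "k y1 \<le> X y1 (m1 f) \<and> k y2 \<le> X y2 (m2 f) \<and> k y3 \<le> X y3 (m3 f)" if f: "f \<in> space M" for f
  proof -
    have h: "(f (1, j), f (2, j)) \<in> hexagon 0 0 0 y1 y2 y3" if "j \<in> ?J" for j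
      using f that by (simp add: spM W_def)
    have hj: "0 \<le> f (1, j) \<and> f (1, j) \<le> y1 \<and> 0 \<le> f (2, j) \<and> f (2, j) \<le> y2 \<and>
      0 \<le> 1 - f (1, j) - f (2, j) \<and> 1 - f (1, j) - f (2, j) \<le> y3" if "j \<in> ?J" for j
      using h[OF that] by (simp add: hexagon_def)
    have "0 \<le> m1 f" "0 \<le> m2 f" "0 \<le> m3 f" "y1 - \<tau> \<le> m1 f" "y2 - \<tau> \<le> m2 f" "y3 - \<tau> \<le> m3 f"
      unfolding m_ge \<tau>_def by (intro ballI, drule hj, linarith)+
    moreover have "k y \<le> X y m" if "0 \<le> m" "y - \<tau> \<le> m" for y m
    proof -
      have "y / \<tau> \<ge> (y - m) / \<tau>" using that \<tau> by (intro divide_right_mono) auto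
      moreover have "0 \<le> X y m" using that by (simp add: Xge)
      ultimately show ?thesis by (simp add: k_def X_def)
    qed
    ultimately show ?thesis by blast
  qed
  \<comment> \<open>As a_i >= \<open>k\<close> y_i, the new lower bounds y_i - tau (1 - a_i) are
    nonnegative and imply the old bounds 0. The corner leg is T + (y_i - tau (1 - a_i)) - y_i = tau
    a_i with T = tau.\<close>
  have orth: "measure M {f \<in> space M. a1 \<le> X y1 (m1 f) \<and> a2 \<le> X y2 (m2 f) \<and> a3 \<le> X y3 (m3 f)}
      = \<tau> ^ (2 * n) * ((1 - a1\<^sup>2 - a2\<^sup>2 - a3\<^sup>2) / 2) ^ n"
    if a: "k y1 \<le> a1" "k y2 \<le> a2" "k y3 \<le> a3" "a1 + a2 + a3 \<le> 1" for a1 a2 a3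
  proof -
    have a0: "0 \<le> a1" "0 \<le> a2" "0 \<le> a3" using a k0 by auto
    have ay: "0 \<le> y1 - \<tau> * (1 - a1)" "0 \<le> y2 - \<tau> * (1 - a2)" "0 \<le> y3 - \<tau> * (1 - a3)"
      using a by (simp_all add: kle)
    let ?H = "hexagon (y1 - \<tau> * (1 - a1)) (y2 - \<tau> * (1 - a2)) (y3 - \<tau> * (1 - a3)) y1 y2 y3"
    have set: "{f \<in> space M. a1 \<le> X y1 (m1 f) \<and> a2 \<le> X y2 (m2 f) \<and> a3 \<le> X y3 (m3 f)}
      = {f \<in> space (Mx n). \<forall>j\<in>?J. (f (1, j), f (2, j)) \<in> ?H}" (is "?L = ?R")
    proof (intro set_eqI iffI)
      fix f assume "f \<in> ?L"
      then show "f \<in> ?R" unfolding spM W_def Xge m_ge hexagon_def by simp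
    next
      fix f assume "f \<in> ?R"
      then show "f \<in> ?L" unfolding spM W_def Xge m_ge hexagon_def using ay by fastforce
    qed
    have sq: "a1\<^sup>2 + a2\<^sup>2 + a3\<^sup>2 \<le> 1" using a0 a(4) by (rule sum_squares_le_one)
    have "emeasure lborel ?H = ennreal ((\<tau>\<^sup>2 - (\<tau> * a1)\<^sup>2 - (\<tau> * a2)\<^sup>2 - (\<tau> * a3)\<^sup>2) / 2)"
    proof (rule emeasure_hexagon)
      have "\<tau> * a1 + \<tau> * a2 \<le> \<tau>" "\<tau> * a1 + \<tau> * a3 \<le> \<tau>" "\<tau> * a2 + \<tau> * a3 \<le> \<tau>"
        using a0 a(4) \<tau> by (simp_all flip: distrib_left)
      then show "\<tau> * a1 + \<tau> * a2 \<le> \<tau>" "\<tau> * a1 + \<tau> * a3 \<le> \<tau>" "\<tau> * a2 + \<tau> * a3 \<le> \<tau>" .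
      show "0 \<le> \<tau> * a1" "0 \<le> \<tau> * a2" "0 \<le> \<tau> * a3" using a0 \<tau> by simp_all
    qed (simp_all add: \<tau>_def algebra_simps)
    also have "(\<tau>\<^sup>2 - (\<tau> * a1)\<^sup>2 - (\<tau> * a2)\<^sup>2 - (\<tau> * a3)\<^sup>2) / 2 = \<tau>\<^sup>2 * ((1 - a1\<^sup>2 - a2\<^sup>2 - a3\<^sup>2) / 2)"
      by (simp add: power_mult_distrib field_simps)
    finally have "emeasure (Mx n) ?R = ennreal ((\<tau>\<^sup>2 * ((1 - a1\<^sup>2 - a2\<^sup>2 - a3\<^sup>2) / 2)) ^ n)"
      using sq by (subst emeasure_PiM_pairs[OF hexagon_measurable]) (simp add: ennreal_power)
    also have "(\<tau>\<^sup>2 * ((1 - a1\<^sup>2 - a2\<^sup>2 - a3\<^sup>2) / 2)) ^ n = \<tau> ^ (2 * n) * ((1 - a1\<^sup>2 - a2\<^sup>2 - a3\<^sup>2) / 2) ^ n"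
      by (simp only: power_mult_distrib power_mult)
    finally have R: "emeasure (Mx n) ?R = ennreal (\<tau> ^ (2 * n) * ((1 - a1\<^sup>2 - a2\<^sup>2 - a3\<^sup>2) / 2) ^ n)" .
    have "?L \<subseteq> W" by (auto simp: spM)
    then have "emeasure M ?L = ennreal (\<tau> ^ (2 * n) * ((1 - a1\<^sup>2 - a2\<^sup>2 - a3\<^sup>2) / 2) ^ n)"
      unfolding R[symmetric] set[symmetric] by (rule eM)
    then show ?thesis
      using sq \<tau> by (simp add: measure_def)
  qed
  \<comment> \<open>The sum of the c_i is 3 - (y1 + y2 + y3 - u - v - w) / tau, and y1 + y2 + y3 - 2
    tau = 2 - (y1 + y2 + y3).\<close>
  have X1: "X y1 u + X y2 v + X y3 w < 1 \<longleftrightarrow> u + v + w < 2 - (y1 + y2 + y3)" for u v w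
  proof -
    have "X y1 u + X y2 v + X y3 w < 1 \<longleftrightarrow> 2 < (y1 + y2 + y3 - (u + v + w)) / \<tau>"
      by (auto simp: X_def add_divide_distrib diff_divide_distrib)
    also have "\<dots> \<longleftrightarrow> 2 * \<tau> < y1 + y2 + y3 - (u + v + w)" using \<tau> by (simp add: pos_less_divide_eq)
    also have "\<dots> \<longleftrightarrow> u + v + w < 2 - (y1 + y2 + y3)" unfolding \<tau>_def by auto
    finally show ?thesis .
  qed
  have "{f \<in> space (Mx n). (\<forall>j\<in>?J. (f (1, j), f (2, j)) \<in> hexagon 0 0 0 y1 y2 y3) \<and>
      (\<exists>j1\<in>?J. \<exists>j2\<in>?J. \<exists>j3\<in>?J.
        f (1, j1) + f (2, j2) + (1 - f (1, j3) - f (2, j3)) + y1 + y2 + y3 < 2)}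
    = {f \<in> space M. X y1 (m1 f) + X y2 (m2 f) + X y3 (m3 f) < 1}"
  proof -
    have "a + y1 + y2 + y3 < 2 \<longleftrightarrow> a < 2 - (y1 + y2 + y3)" for a by auto
    then show ?thesis
      unfolding X1 m1_def m2_def m3_def ex3_Min_less[OF J, symmetric] spM W_def by auto
  qed
  moreover have "{f \<in> space M. X y1 (m1 f) + X y2 (m2 f) + X y3 (m3 f) < 1} \<subseteq> W" by (auto simp: spM)
  moreover note eM[OF this]
  moreover have "emeasure M {f \<in> space M. X y1 (m1 f) + X y2 (m2 f) + X y3 (m3 f) < 1}
    = ennreal (\<tau> ^ (2 * n)) * (\<integral>\<^sup>+z. (case z of ((c1, c2), c3) \<Rightarrow> ennreal (simplex_density n c1 c2 c3) *
        indicator {((c1, c2), c3). k y1 \<le> c1 \<and> k y2 \<le> c2 \<and> k y3 \<le> c3 \<and> c1 + c2 + c3 < 1} z) \<partial>lborel3)"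
    by (rule emeasure_simplex_law[OF fM mX k0 _ Xk orth]) (use \<tau> in auto)
  moreover have "\<dots> = (\<integral>\<^sup>+z. ennreal (\<tau> ^ (2 * n)) * (case z of ((c1, c2), c3) \<Rightarrow> ennreal (simplex_density n c1 c2 c3) *
        indicator {((c1, c2), c3). k y1 \<le> c1 \<and> k y2 \<le> c2 \<and> k y3 \<le> c3 \<and> c1 + c2 + c3 < 1} z) \<partial>lborel3)"
    unfolding simplex_density_def case_prod_beta by (rule nn_integral_cmult[symmetric]) measurable
  moreover have "\<dots> = (\<integral>\<^sup>+c. (if gap_region y1 y2 y3 (pr1 c) (pr2 c) (pr3 c)
        then ennreal ((y1 + y2 + y3 - 1) ^ (2 * n) * simplex_density n (pr1 c) (pr2 c) (pr3 c)) else 0) \<partial>lborel3)"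
    using s \<tau> unfolding \<tau>_def[symmetric]
    by (intro nn_integral_cong)
      (auto simp: case_prod_beta indicator_def kle gap_region_def \<tau>_def[symmetric] ennreal_mult')
  ultimately show ?thesis by simp
qed

lemma emeasure_gap_coord:
  assumes n: "n \<ge> 1"
  shows "emeasure (Mxy n) (gap_coord n)
    = (\<integral>\<^sup>+y. \<integral>\<^sup>+c. gap_integrand n y c
        \<partial>lborel3 \<partial>lborel3)"
proof (rule emeasure_by_slices)
  show "gap_coord n \<in> sets (Mxy n)" by (rule gap_coord_measurable)
  interpret l3: pair_sigma_finite lborel3 lborel3 by (rule pair_sigma_finite_lborel3)
  show "(\<lambda>y. \<integral>\<^sup>+c. gap_integrand n y c
        \<partial>lborel3) \<in> borel_measurable lborel3"
    unfolding gap_region_def simplex_density_def by measurable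
  fix g assume g: "g \<in> space My"
  let ?h = "\<lambda>y. \<integral>\<^sup>+c. gap_integrand n y c \<partial>lborel3"
  let ?S = "(\<lambda>f. (f, g)) -` gap_coord n"
  let ?W = "{f \<in> space (Mx n). \<forall>j\<in>{1..n}. (f (1, j), f (2, j)) \<in> hexagon 0 0 0 (g 1) (g 2) (g 3)}"
  consider "\<not> (g 1 \<le> 1 \<and> g 2 \<le> 1 \<and> g 3 \<le> 1)" | "g 1 \<le> 1" "g 2 \<le> 1" "g 3 \<le> 1" "g 1 + g 2 + g 3 \<le> 1"
    | "g 1 \<le> 1" "g 2 \<le> 1" "g 3 \<le> 1" "1 < g 1 + g 2 + g 3" by linarith
  then show "emeasure (Mx n) ?S = ?h ((g 1, g 2), g 3)"
  proof cases
    case 1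
    then have "?S = {}" unfolding gap_coord_def PD_coord_def by auto
    moreover have "?h ((g 1, g 2), g 3) = 0" using 1 by auto
    ultimately show ?thesis by simp
  next
    case 2
    have "?W \<in> sets (Mx n)"
      unfolding hexagon_def mem_Collect_eq prod.case
      by (intro sets.sets_Collect_conj sets.sets_Collect_finite_All borel_measurable_le borel_measurable_const
        borel_measurable_diff measurable_Mx) auto
    moreover have "?S \<subseteq> ?W" unfolding gap_coord_def PD_coord_def space_pair_measure by auto
    ultimately have "emeasure (Mx n) ?S \<le> emeasure (Mx n) ?W" by (rule emeasure_mono[rotated])
    then have "emeasure (Mx n) ?S = 0" using gap_slice_eq_0[OF n 2(4)] by simp
    moreover have "\<not> gap_region (g 1) (g 2) (g 3) c1 c2 c3" for c1 c2 c3
      using 2(4) by (simp add: gap_region_def)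
    ultimately show ?thesis by simp
  next
    case 3
    have "?S = {f \<in> space (Mx n). (\<forall>j\<in>{1..n}. (f (1, j), f (2, j)) \<in> hexagon 0 0 0 (g 1) (g 2) (g 3)) \<and>
      (\<exists>j1\<in>{1..n}. \<exists>j2\<in>{1..n}. \<exists>j3\<in>{1..n}.
        f (1, j1) + f (2, j2) + (1 - f (1, j3) - f (2, j3)) + g 1 + g 2 + g 3 < 2)}"
      using g 3 unfolding gap_coord_def PD_coord_def space_pair_measure by auto
    then show ?thesis
      unfolding emeasure_gap_slice[OF n 3(4,1-3), symmetric] using 3(1-3)
      by (simp only: fst_conv snd_conv emeasure_gap_slice[OF n 3(4,1-3)] simp_thms)
  qed
qed

section \<open>Integration over y for fixed slacks\<close>

definition beta_prim :: "nat \<Rightarrow> real \<Rightarrow> real" where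
  "beta_prim n w = w ^ (2 * n + 1) / (2 * real (2 * n + 1)) - w ^ (2 * n + 2) / real (2 * n + 2)
     + w ^ (2 * n + 3) / (2 * real (2 * n + 3))"

lemma beta_prim_0 [simp]: "beta_prim n 0 = 0"
  by (simp add: beta_prim_def)

text \<open>So \<open>beta_prim\<close> is half an incomplete beta function, with B(2n+1, 3) / 2 as
  its value at 1. The factor (1 - w)^2 / 2 will be a triangle area and w^(2n) the factor tau^(2n),
  both rescaled.\<close>

lemma beta_prim_deriv: "(beta_prim n has_real_derivative w ^ (2 * n) * (1 - w)\<^sup>2 / 2) (at w)"
proof -
  have D: "((\<lambda>w. w ^ (2 * n + 1) / (2 * real (2 * n + 1)) - w ^ (2 * n + 2) / real (2 * n + 2)
     + w ^ (2 * n + 3) / (2 * real (2 * n + 3))) has_real_derivative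
     real (2 * n + 1) * w ^ (2 * n + 1 - 1) / (2 * real (2 * n + 1)) - real (2 * n + 2) * w ^ (2 * n + 2 - 1) / real (2 * n + 2)
     + real (2 * n + 3) * w ^ (2 * n + 3 - 1) / (2 * real (2 * n + 3))) (at w)"
    by (intro DERIV_add DERIV_diff DERIV_cdivide DERIV_pow[where s = UNIV, simplified])
      (use DERIV_pow in \<open>simp_all only: One_nat_def\<close>)
  have e1: "real (2 * n + 1) * w ^ (2 * n + 1 - 1) / (2 * real (2 * n + 1)) - real (2 * n + 2) * w ^ (2 * n + 2 - 1) / real (2 * n + 2)
     + real (2 * n + 3) * w ^ (2 * n + 3 - 1) / (2 * real (2 * n + 3))
     = w ^ (2 * n) / 2 - w ^ (2 * n + 1) + w ^ (2 * n + 2) / 2"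
  proof -
    have e: "2 * n + 1 - 1 = 2 * n" "2 * n + 2 - 1 = 2 * n + 1" "2 * n + 3 - 1 = 2 * n + 2" by simp_all
    have g: "a * W / (2 * a) = W / 2" "a * W / a = W" if "a \<noteq> 0" for a W :: real using that by simp_all
    have nz: "real (2 * n + 1) \<noteq> 0" "real (2 * n + 2) \<noteq> 0" "real (2 * n + 3) \<noteq> 0" by simp_all
    show ?thesis unfolding e g(1)[OF nz(1)] g(2)[OF nz(2)] g(1)[OF nz(3)] ..
  qed
  have e2: "w ^ (2 * n) / 2 - w ^ (2 * n + 1) + w ^ (2 * n + 2) / 2 = w ^ (2 * n) * (1 - w)\<^sup>2 / 2"
    by (simp add: power_add power2_eq_square algebra_simps add_divide_distrib diff_divide_distrib)
  show ?thesis using D unfolding e1 e2 beta_prim_def[abs_def] .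
qed

text \<open>The slice of the cone of admissible y at y1 + y2 + y3 = 1 + tau, in the coordinates y1,
  y2: a triangle with legs 1 - tau zeta.\<close>

lemma emeasure_triangle_slab:
  fixes \<tau> Z1 Z2 Z3 :: real
  assumes \<zeta>: "\<zeta> = Z1 + Z2 + Z3 - 1"
  shows "emeasure lborel2 {w. \<tau> * Z1 \<le> fst w \<and> \<tau> * Z2 \<le> snd w \<and> \<tau> * Z3 \<le> 1 + \<tau> - fst w - snd w}
    = (if \<tau> * \<zeta> \<le> 1 then ennreal ((1 - \<tau> * \<zeta>)\<^sup>2 / 2) else 0)"
proof (cases "\<tau> * \<zeta> \<le> 1")
  case True
  have e: "1 + \<tau> - \<tau> * Z3 - \<tau> * Z1 - \<tau> * Z2 = 1 - \<tau> * \<zeta>" unfolding \<zeta> by (simp add: algebra_simps)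
  have "closed {w. \<tau> * Z1 \<le> fst w \<and> \<tau> * Z2 \<le> snd w \<and> \<tau> * Z3 \<le> 1 + \<tau> - fst w - snd w}"
    by (intro closed_Collect_conj closed_Collect_le continuous_intros)
  then have "emeasure lborel {w. \<tau> * Z1 \<le> fst w \<and> \<tau> * Z2 \<le> snd w \<and> \<tau> * Z3 \<le> 1 + \<tau> - fst w - snd w}
    = ennreal ((1 + \<tau> - \<tau> * Z3 - \<tau> * Z1 - \<tau> * Z2)\<^sup>2 / 2)"
    using True e by (intro emeasure_triangle) auto
  then show ?thesis using True unfolding e lborel_prod by simp
next
  case False
  have "\<not> (\<tau> * Z1 \<le> a \<and> \<tau> * Z2 \<le> b \<and> \<tau> * Z3 \<le> 1 + \<tau> - a - b)" for a b
    using False unfolding \<zeta> by (auto simp: algebra_simps)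
  then have "{w. \<tau> * Z1 \<le> fst w \<and> \<tau> * Z2 \<le> snd w \<and> \<tau> * Z3 \<le> 1 + \<tau> - fst w - snd w} = {}"
    by blast
  then show ?thesis using False by (simp only: emeasure_empty if_False)
qed

text \<open>Slicing by tau and rescaling w = tau zeta produces zeta^-(2n+1) and a beta integral from
  theta to 1. Use is made of Z_i = 1 - c_i; theta = 0 keeps the whole cone, theta = 5/6 the part
  near w = 1.\<close>

lemma nn_integral_cone:
  fixes Z1 Z2 Z3 \<theta> :: real
  assumes n: "n \<ge> 1" and \<theta>: "0 \<le> \<theta>" "\<theta> \<le> 1" and \<zeta>: "\<zeta> = Z1 + Z2 + Z3 - 1" "\<zeta> > 0"
  shows "(\<integral>\<^sup>+y. (if 1 < tot y \<and> \<theta> \<le> (tot y - 1) * \<zeta> \<and>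
      (tot y - 1) * Z1 \<le> pr1 y \<and> (tot y - 1) * Z2 \<le> pr2 y \<and>
      (tot y - 1) * Z3 \<le> pr3 y then ennreal ((tot y - 1) ^ (2 * n)) else 0) \<partial>lborel3)
    = ennreal ((1 / \<zeta>) ^ (2 * n + 1) * (beta_prim n 1 - beta_prim n \<theta>))"
proof -
  interpret l: pair_sigma_finite lborel2 "lborel :: real measure"
    by (simp only: lborel_prod pair_sigma_finite_def sigma_finite_lborel simp_thms)
  define f where "f y = (if 1 < tot y \<and> \<theta> \<le> (tot y - 1) * \<zeta> \<and>
      (tot y - 1) * Z1 \<le> pr1 y \<and> (tot y - 1) * Z2 \<le> pr2 y \<and>
      (tot y - 1) * Z3 \<le> pr3 y then ennreal ((tot y - 1) ^ (2 * n)) else 0)" for y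
  have f[measurable]: "f \<in> borel_measurable lborel3" unfolding f_def by measurable
  have "integral\<^sup>N lborel3 f = (\<integral>\<^sup>+w. \<integral>\<^sup>+z. f (w, z) \<partial>lborel \<partial>lborel2)"
    by (rule lborel.nn_integral_fst[symmetric]) fact
  \<comment> \<open>Translation in y3 alone, so that the new variable is tau = y1 + y2 + y3 - 1; the
    Jacobian is 1.\<close>
  also have "\<dots> = (\<integral>\<^sup>+w. \<integral>\<^sup>+\<tau>. f (w, (1 - fst w - snd w) + 1 * \<tau>) \<partial>lborel \<partial>lborel2)"
  proof (rule nn_integral_cong)
    fix w assume w: "w \<in> space lborel2"
    show "(\<integral>\<^sup>+z. f (w, z) \<partial>lborel) = (\<integral>\<^sup>+\<tau>. f (w, (1 - fst w - snd w) + 1 * \<tau>) \<partial>lborel)"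
      using nn_integral_real_affine[of "\<lambda>z. f (w, z)" 1 "1 - fst w - snd w"]
        measurable_compose_Pair1[OF w f] by simp
  qed
  also have "\<dots> = (\<integral>\<^sup>+\<tau>. \<integral>\<^sup>+w. f (w, (1 - fst w - snd w) + 1 * \<tau>) \<partial>lborel2 \<partial>lborel)"
    by (rule l.Fubini'[symmetric]) measurable
  also have "\<dots> = (\<integral>\<^sup>+\<tau>. ennreal (\<tau> ^ (2 * n) * (1 - \<tau> * \<zeta>)\<^sup>2 / 2) * indicator {\<theta> / \<zeta>..1 / \<zeta>} \<tau> \<partial>lborel)"
  proof (rule nn_integral_cong)
    fix \<tau> :: real
    let ?S = "{w. \<tau> * Z1 \<le> fst w \<and> \<tau> * Z2 \<le> snd w \<and> \<tau> * Z3 \<le> 1 + \<tau> - fst w - snd w}"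
    have S: "?S \<in> sets lborel2"
    proof -
      have "{w \<in> space lborel2. \<tau> * Z1 \<le> fst w \<and> \<tau> * Z2 \<le> snd w \<and> \<tau> * Z3 \<le> 1 + \<tau> - fst w - snd w} \<in> sets lborel2"
        by measurable
      then show ?thesis by (simp add: space_pair_measure)
    qed
    have "f (w, (1 - fst w - snd w) + 1 * \<tau>) = (if 0 < \<tau> \<and> \<theta> \<le> \<tau> * \<zeta> then ennreal (\<tau> ^ (2 * n)) else 0) * indicator ?S w" for w
      unfolding f_def by (auto simp: indicator_def algebra_simps)
    then have "(\<integral>\<^sup>+w. f (w, (1 - fst w - snd w) + 1 * \<tau>) \<partial>lborel2)
      = (\<integral>\<^sup>+w. (if 0 < \<tau> \<and> \<theta> \<le> \<tau> * \<zeta> then ennreal (\<tau> ^ (2 * n)) else 0) * indicator ?S w \<partial>lborel2)"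
      by simp
    also have "\<dots> = (if 0 < \<tau> \<and> \<theta> \<le> \<tau> * \<zeta> then ennreal (\<tau> ^ (2 * n)) else 0) * emeasure lborel2 ?S"
      by (rule nn_integral_cmult_indicator[OF S])
    also have "\<dots> = ennreal (\<tau> ^ (2 * n) * (1 - \<tau> * \<zeta>)\<^sup>2 / 2) * indicator {\<theta> / \<zeta>..1 / \<zeta>} \<tau>"
    proof -
      have i: "\<tau> \<in> {\<theta> / \<zeta>..1 / \<zeta>} \<longleftrightarrow> \<theta> \<le> \<tau> * \<zeta> \<and> \<tau> * \<zeta> \<le> 1"
        using \<zeta>(2) by (simp add: pos_divide_le_eq pos_le_divide_eq)
      show ?thesis
      proof (cases "\<theta> \<le> \<tau> * \<zeta> \<and> \<tau> * \<zeta> \<le> 1")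
        case True
        then have "0 \<le> \<tau> * \<zeta>" using \<theta>(1) by linarith
        then have t0: "0 \<le> \<tau>" using \<zeta>(2) by (simp add: zero_le_mult_iff)
        have m: "ennreal (\<tau> ^ (2 * n)) * ennreal ((1 - \<tau> * \<zeta>)\<^sup>2 / 2) = ennreal (\<tau> ^ (2 * n) * (1 - \<tau> * \<zeta>)\<^sup>2 / 2)"
          using t0 by (simp add: ennreal_mult'[symmetric])
        show ?thesis
        proof (cases "\<tau> = 0")
          case True
          \<comment> \<open>The strict condition 1 < tot y excludes tau = 0, but the closed interval
            may contain it; both sides vanish there because 2n > 0.\<close>
          then show ?thesis using n by (simp add: power_0_left)
        next
          case False
          then have "0 < \<tau>" using t0 by simp
          then show ?thesis
            unfolding emeasure_triangle_slab[OF \<zeta>(1)] using True i m by (simp add: indicator_def)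
        qed
      next
        case False
        then show ?thesis
          unfolding emeasure_triangle_slab[OF \<zeta>(1)] using i by (auto simp: indicator_def)
      qed
    qed
    finally show "(\<integral>\<^sup>+w. f (w, (1 - fst w - snd w) + 1 * \<tau>) \<partial>lborel2)
      = ennreal (\<tau> ^ (2 * n) * (1 - \<tau> * \<zeta>)\<^sup>2 / 2) * indicator {\<theta> / \<zeta>..1 / \<zeta>} \<tau>" .
  qed
  also have "\<dots> = ennreal ((1 / \<zeta>) ^ (2 * n + 1) * beta_prim n (1 / \<zeta> * \<zeta>) - (1 / \<zeta>) ^ (2 * n + 1) * beta_prim n (\<theta> / \<zeta> * \<zeta>))"
  proof (rule nn_integral_FTC_Icc)
    fix \<tau> assume \<tau>: "\<tau> \<in> {\<theta> / \<zeta>..1 / \<zeta>}"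
    have "((\<lambda>\<tau>. \<tau> * \<zeta>) has_real_derivative \<zeta>) (at \<tau>)" by (auto intro!: derivative_eq_intros)
    then have "((\<lambda>\<tau>. beta_prim n (\<tau> * \<zeta>)) has_real_derivative (\<tau> * \<zeta>) ^ (2 * n) * (1 - \<tau> * \<zeta>)\<^sup>2 / 2 * \<zeta>) (at \<tau>)"
      by (rule DERIV_chain2[OF beta_prim_deriv])
    then have "((\<lambda>\<tau>. (1 / \<zeta>) ^ (2 * n + 1) * beta_prim n (\<tau> * \<zeta>)) has_real_derivative
        (1 / \<zeta>) ^ (2 * n + 1) * ((\<tau> * \<zeta>) ^ (2 * n) * (1 - \<tau> * \<zeta>)\<^sup>2 / 2 * \<zeta>)) (at \<tau>)"
      by (rule DERIV_cmult)
    moreover have "(1 / \<zeta>) ^ (2 * n + 1) * ((\<tau> * \<zeta>) ^ (2 * n) * (1 - \<tau> * \<zeta>)\<^sup>2 / 2 * \<zeta>) = \<tau> ^ (2 * n) * (1 - \<tau> * \<zeta>)\<^sup>2 / 2"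
    proof -
      have "(1 / \<zeta>) ^ (2 * n + 1) * \<zeta> ^ (2 * n + 1) = 1" using \<zeta>(2) by (simp add: power_one_over)
      moreover have "u * ((\<tau> * \<zeta>) ^ (2 * n) * A / 2 * \<zeta>) = (u * \<zeta> ^ (2 * n + 1)) * (\<tau> ^ (2 * n) * A / 2)" for u A
        by (simp add: power_mult_distrib)
      ultimately show ?thesis by (simp only: mult_1_left)
    qed
    ultimately show "((\<lambda>\<tau>. (1 / \<zeta>) ^ (2 * n + 1) * beta_prim n (\<tau> * \<zeta>)) has_real_derivative
        \<tau> ^ (2 * n) * (1 - \<tau> * \<zeta>)\<^sup>2 / 2) (at \<tau>)" by simp
    have "0 \<le> \<theta> / \<zeta>" using \<theta>(1) \<zeta>(2) by simp
    then show "0 \<le> \<tau> ^ (2 * n) * (1 - \<tau> * \<zeta>)\<^sup>2 / 2" using \<tau> by simp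
  qed (use \<theta> \<zeta>(2) in \<open>auto intro: divide_right_mono\<close>)
  also have "\<dots> = ennreal ((1 / \<zeta>) ^ (2 * n + 1) * (beta_prim n 1 - beta_prim n \<theta>))"
    using \<zeta>(2) by (simp add: right_diff_distrib)
  finally show ?thesis unfolding f_def .
qed

section \<open>Two-sided bounds by a Laplace integral\<close>

abbreviation laplace_integrand :: "nat \<Rightarrow> real \<Rightarrow> (real \<times> real) \<times> real \<Rightarrow> ennreal" where
  "laplace_integrand n \<delta> c \<equiv> (if \<delta> \<le> pr1 c \<and> \<delta> \<le> pr2 c \<and> \<delta> \<le> pr3 c \<and> tot c < 1
    then ennreal (simplex_density n (pr1 c) (pr2 c) (pr3 c) * (1 / (2 - tot c)) ^ (2 * n + 1)) else 0)"

text \<open>The c-integral left after integrating out y. The cutoff delta is 0 in the upper and 1/6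
  in the lower bound; any delta below 1/3 leaves the critical point inside.\<close>

definition laplace_int :: "nat \<Rightarrow> real \<Rightarrow> ennreal" where
  "laplace_int n \<delta> = (\<integral>\<^sup>+c. laplace_integrand n \<delta> c \<partial>lborel3)"

lemma simplex_density_nonneg:
  assumes "0 \<le> a" "0 \<le> b" "0 \<le> c" "a + b + c \<le> 1"
  shows "0 \<le> simplex_density n a b c"
  unfolding simplex_density_def using assms sum_squares_le_one[OF assms] by (intro mult_nonneg_nonneg zero_le_power) auto

lemma emeasure_gap_swap:
  assumes n: "n \<ge> 1"
  shows "emeasure (Mxy n) (gap_coord n)
    = (\<integral>\<^sup>+c. \<integral>\<^sup>+y. gap_integrand n y c
        \<partial>lborel3 \<partial>lborel3)"
proof -
  interpret l3: pair_sigma_finite lborel3 lborel3 by (rule pair_sigma_finite_lborel3)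
  show ?thesis
    unfolding emeasure_gap_coord[OF n]
    by (rule l3.Fubini'[symmetric]) (unfold gap_region_def simplex_density_def, measurable)
qed

abbreviation cone_integrand ::
    "nat \<Rightarrow> real \<Rightarrow> real \<Rightarrow> real \<Rightarrow> real \<Rightarrow> real \<Rightarrow> (real \<times> real) \<times> real \<Rightarrow> ennreal" where
  "cone_integrand n \<theta> p c1 c2 c3 y \<equiv> (if 1 < tot y \<and> \<theta> \<le> (tot y - 1) * (2 - (c1 + c2 + c3)) \<and>
      (tot y - 1) * (1 - c1) \<le> pr1 y \<and> (tot y - 1) * (1 - c2) \<le> pr2 y \<and> (tot y - 1) * (1 - c3) \<le> pr3 y
    then ennreal ((tot y - 1) ^ (2 * n) * p) else 0)"

lemma nn_integral_cone':
  assumes n: "n \<ge> 1" and \<theta>: "0 \<le> \<theta>" "\<theta> \<le> 1" and c: "c1 + c2 + c3 < 1" and p: "0 \<le> p"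
  shows "(\<integral>\<^sup>+y. cone_integrand n \<theta> p c1 c2 c3 y \<partial>lborel3)
    = ennreal (beta_prim n 1 - beta_prim n \<theta>) * ennreal (p * (1 / (2 - (c1 + c2 + c3))) ^ (2 * n + 1))"
    (is "(\<integral>\<^sup>+y. (if ?P y then _ else _) \<partial>lborel3) = _")
proof -
  have z: "0 < 2 - (c1 + c2 + c3)" using c by simp
  have "(\<integral>\<^sup>+y. (if ?P y then ennreal ((tot y - 1) ^ (2 * n) * p) else 0) \<partial>lborel3)
    = (\<integral>\<^sup>+y. (if ?P y then ennreal ((tot y - 1) ^ (2 * n)) else 0) * ennreal p \<partial>lborel3)"
    by (intro nn_integral_cong) (simp add: ennreal_mult''[OF p])
  also have "\<dots> = (\<integral>\<^sup>+y. (if ?P y then ennreal ((tot y - 1) ^ (2 * n)) else 0) \<partial>lborel3) * ennreal p"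
    by (rule nn_integral_multc) measurable
  also have "\<dots> = ennreal ((1 / (2 - (c1 + c2 + c3))) ^ (2 * n + 1) * (beta_prim n 1 - beta_prim n \<theta>)) * ennreal p"
    by (subst nn_integral_cone[OF n \<theta> _ z]) simp_all
  also have "\<dots> = ennreal (beta_prim n 1 - beta_prim n \<theta>) * ennreal (p * (1 / (2 - (c1 + c2 + c3))) ^ (2 * n + 1))"
  proof -
    have "ennreal (q * b) * ennreal p = ennreal b * ennreal (p * q)" if "0 \<le> q" for q b
      unfolding ennreal_mult'[OF that] ennreal_mult'[OF p] by (simp only: mult_ac)
    then show ?thesis using z by (simp only: zero_le_power zero_le_divide_1_iff less_imp_le)
  qed
  finally show ?thesis .
qed

text \<open>Dropping y_i <= 1 enlarges the domain to the full cone, whose integral is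
  explicit.\<close>

lemma emeasure_gap_le:
  assumes n: "n \<ge> 1"
  shows "emeasure (Mxy n) (gap_coord n) \<le> ennreal (beta_prim n 1) * laplace_int n 0"
proof -
  have "emeasure (Mxy n) (gap_coord n) \<le> (\<integral>\<^sup>+c. ennreal (beta_prim n 1 - beta_prim n 0) *
     laplace_integrand n 0 c \<partial>lborel3)"
    unfolding emeasure_gap_swap[OF n]
  proof (rule nn_integral_mono)
    fix c :: "(real \<times> real) \<times> real"
    let ?p = "simplex_density n (pr1 c) (pr2 c) (pr3 c)"
    show "(\<integral>\<^sup>+y. gap_integrand n y c \<partial>lborel3)
      \<le> ennreal (beta_prim n 1 - beta_prim n 0) *
     laplace_integrand n 0 c" (is "?L \<le> ?R")
    proof (cases "0 \<le> pr1 c \<and> 0 \<le> pr2 c \<and> 0 \<le> pr3 c \<and> tot c < 1")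
      case True
      then have p: "0 \<le> ?p" by (intro simplex_density_nonneg) auto
      have c: "tot c < 1" using True by blast
      have "?L \<le> (\<integral>\<^sup>+y. cone_integrand n 0 ?p (pr1 c) (pr2 c) (pr3 c) y \<partial>lborel3)"
        using c by (intro nn_integral_mono) (auto simp: gap_region_def)
      also have "\<dots> = ennreal (beta_prim n 1 - beta_prim n 0) * ennreal (?p * (1 / (2 - tot c)) ^ (2 * n + 1))"
        by (rule nn_integral_cone'[OF n _ _ c p]) auto
      also have "\<dots> = ?R" using True by (simp only: if_True simp_thms)
      finally show ?thesis .
    next
      case False
      then have "\<not> gap_region y1 y2 y3 (pr1 c) (pr2 c) (pr3 c)" for y1 y2 y3
        unfolding gap_region_def by blast
      then show ?thesis by simp
    qed
  qed
  also have "\<dots> = ennreal (beta_prim n 1) * laplace_int n 0"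
    unfolding laplace_int_def simplex_density_def beta_prim_0 diff_zero by (rule nn_integral_cmult) measurable
  finally show ?thesis .
qed

text \<open>On the restricted domain y_i <= 1 comes for free. The three excesses y_i - tau (1 - c_i)
  are nonnegative with sum 1 - w, hence each is at most 1/6 when w >= 5/6; and tau <= 1 with c_i >=
  1/6 bounds tau (1 - c_i) by 5/6.\<close>

lemma emeasure_gap_ge:
  assumes n: "n \<ge> 1"
  shows "ennreal (beta_prim n 1 - beta_prim n (5 / 6)) * laplace_int n (1 / 6) \<le> emeasure (Mxy n) (gap_coord n)"
proof -
  have "ennreal (beta_prim n 1 - beta_prim n (5 / 6)) * laplace_int n (1 / 6)
    = (\<integral>\<^sup>+c. ennreal (beta_prim n 1 - beta_prim n (5 / 6)) *
     laplace_integrand n (1 / 6) c \<partial>lborel3)"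
    unfolding laplace_int_def simplex_density_def by (rule nn_integral_cmult[symmetric]) measurable
  also have "\<dots> \<le> emeasure (Mxy n) (gap_coord n)"
    unfolding emeasure_gap_swap[OF n]
  proof (rule nn_integral_mono)
    fix c :: "(real \<times> real) \<times> real"
    let ?p = "simplex_density n (pr1 c) (pr2 c) (pr3 c)"
    show "ennreal (beta_prim n 1 - beta_prim n (5 / 6)) *
     laplace_integrand n (1 / 6) c
     \<le> (\<integral>\<^sup>+y. gap_integrand n y c \<partial>lborel3)" (is "?R \<le> ?L")
    proof (cases "1 / 6 \<le> pr1 c \<and> 1 / 6 \<le> pr2 c \<and> 1 / 6 \<le> pr3 c \<and> tot c < 1")
      case True
      then have p: "0 \<le> ?p" by (intro simplex_density_nonneg) auto
      have c: "tot c < 1" using True by blast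
      have "?R = ennreal (beta_prim n 1 - beta_prim n (5 / 6)) * ennreal (?p * (1 / (2 - tot c)) ^ (2 * n + 1))"
        using True by (simp only: if_True simp_thms)
      also have "\<dots> = (\<integral>\<^sup>+y. cone_integrand n (5 / 6) ?p (pr1 c) (pr2 c) (pr3 c) y \<partial>lborel3)"
        by (rule nn_integral_cone'[OF n _ _ c p, symmetric]) auto
      also have "\<dots> \<le> ?L"
      proof (rule nn_integral_mono)
        fix y :: "(real \<times> real) \<times> real"
        obtain y1 y2 y3 where y: "y = ((y1, y2), y3)" by (metis prod.exhaust)
        obtain c1 c2 c3 where cc: "c = ((c1, c2), c3)" by (metis prod.exhaust)
        have "y1 \<le> 1 \<and> y2 \<le> 1 \<and> y3 \<le> 1 \<and> gap_region y1 y2 y3 c1 c2 c3"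
          if h: "1 < y1 + y2 + y3" "5 / 6 \<le> (y1 + y2 + y3 - 1) * (2 - (c1 + c2 + c3))"
            "(y1 + y2 + y3 - 1) * (1 - c1) \<le> y1" "(y1 + y2 + y3 - 1) * (1 - c2) \<le> y2" "(y1 + y2 + y3 - 1) * (1 - c3) \<le> y3"
        proof -
          define t where "t = y1 + y2 + y3 - 1"
          have t: "0 < t" "5 / 6 \<le> t * (2 - (c1 + c2 + c3))" "t * (1 - c1) \<le> y1" "t * (1 - c2) \<le> y2" "t * (1 - c3) \<le> y3"
            using h by (simp_all add: t_def)
          have c': "1 / 6 \<le> c1" "1 / 6 \<le> c2" "1 / 6 \<le> c3" "c1 + c2 + c3 < 1" using True by (simp_all add: cc)
          have e: "t * (2 - (c1 + c2 + c3)) = t * (1 - c1) + t * (1 - c2) + t * (1 - c3) - t"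
            by (simp add: algebra_simps)
          have "t * 1 \<le> t * (2 - (c1 + c2 + c3))" using t(1) c' by (intro mult_left_mono) auto
          moreover have "t * (2 - (c1 + c2 + c3)) \<le> 1" unfolding e using t t_def by linarith
          ultimately have t1: "t \<le> 1" by linarith
          have z: "t * (1 - c1) \<le> 5 / 6" "t * (1 - c2) \<le> 5 / 6" "t * (1 - c3) \<le> 5 / 6"
            using mult_mono[of t 1 "1 - c1" "5 / 6"] mult_mono[of t 1 "1 - c2" "5 / 6"] mult_mono[of t 1 "1 - c3" "5 / 6"]
              t(1) t1 c' by auto
          have "y1 \<le> 1" "y2 \<le> 1" "y3 \<le> 1"
            using t(2-5) z t_def unfolding e by linarith+
          then show ?thesis using h c' by (simp add: gap_region_def)
        qed
        then show "cone_integrand n (5 / 6) ?p (pr1 c) (pr2 c) (pr3 c) y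
        \<le> gap_integrand n y c"
          unfolding y cc fst_conv snd_conv by auto
      qed
      finally show ?thesis .
    next
      case False
      then show ?thesis by (simp only: if_False mult_zero_right zero_le)
    qed
  qed
  finally show ?thesis .
qed

section \<open>Laplace asymptotics\<close>

text \<open>The logarithm differs from its linear part by at most 2 x_n^2 / n in total. A varying
  x_n is needed since the rescaled exponent still contains terms in t / sqrt n.\<close>

lemma tendsto_one_plus_over_n_power:
  fixes x :: "nat \<Rightarrow> real"
  assumes x: "x \<longlonglongrightarrow> l"
  shows "(\<lambda>n. (1 + x n / real n) ^ n) \<longlonglongrightarrow> exp l"
proof -
  have y0: "(\<lambda>n. x n / real n) \<longlonglongrightarrow> 0"
    using tendsto_mult[OF x lim_inverse_n'] by (simp add: divide_inverse)
  have b: "(\<lambda>n. 2 * (x n * (x n / real n))) \<longlonglongrightarrow> 0"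
    using tendsto_mult[OF tendsto_const[of "2::real"] tendsto_mult[OF x y0]] by simp
  have ev: "\<forall>\<^sub>F n in sequentially. \<bar>x n / real n\<bar> < 1 / 2"
    using tendstoD[OF y0, of "1 / 2"] by (simp add: dist_real_def)
  have "(\<lambda>n. real n * ln (1 + x n / real n) - x n) \<longlonglongrightarrow> 0"
  proof (rule Lim_null_comparison[OF _ b])
    show "\<forall>\<^sub>F n in sequentially. norm (real n * ln (1 + x n / real n) - x n) \<le> 2 * (x n * (x n / real n))"
      using ev eventually_gt_at_top[of 0]
    proof eventually_elim
      case (elim n)
      have "\<bar>ln (1 + x n / real n) - x n / real n\<bar> \<le> 2 * (x n / real n)\<^sup>2"
        using elim by (intro abs_ln_one_plus_x_minus_x_bound) auto
      then have "real n * \<bar>ln (1 + x n / real n) - x n / real n\<bar> \<le> real n * (2 * (x n / real n)\<^sup>2)"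
        by (intro mult_left_mono) auto
      moreover have "real n * \<bar>ln (1 + x n / real n) - x n / real n\<bar> = \<bar>real n * ln (1 + x n / real n) - x n\<bar>"
      proof -
        have "real n * \<bar>ln (1 + x n / real n) - x n / real n\<bar> = \<bar>real n * (ln (1 + x n / real n) - x n / real n)\<bar>"
          by (simp add: abs_mult)
        then show ?thesis using elim(2) by (simp add: right_diff_distrib)
      qed
      moreover have "real n * (2 * (x n / real n)\<^sup>2) = 2 * (x n * (x n / real n))"
        using elim(2) by (simp add: power2_eq_square)
      ultimately show ?case by simp
    qed
  qed
  then have "(\<lambda>n. (real n * ln (1 + x n / real n) - x n) + x n) \<longlonglongrightarrow> 0 + l"
    by (rule tendsto_add[OF _ x])
  then have "(\<lambda>n. exp (real n * ln (1 + x n / real n))) \<longlonglongrightarrow> exp l"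
    by (intro tendsto_exp) simp
  moreover have "\<forall>\<^sub>F n in sequentially. exp (real n * ln (1 + x n / real n)) = (1 + x n / real n) ^ n"
    using ev
  proof eventually_elim
    case (elim n)
    then have "0 < 1 + x n / real n" by linarith
    then show ?case by (simp add: exp_of_nat_mult)
  qed
  ultimately show ?thesis by (rule Lim_transform_eventually)
qed

section \<open>Elementary integrals and affine substitutions\<close>

lemma nn_integral_gauss:
  fixes a b :: real
  assumes a: "a > 0"
  shows "(\<integral>\<^sup>+x. ennreal (exp (- (a * (x + b)\<^sup>2))) \<partial>lborel) = ennreal (sqrt (pi / a))"
proof -
  define \<sigma> where "\<sigma> = sqrt (1 / (2 * a))"
  have s2: "\<sigma>\<^sup>2 = 1 / (2 * a)" and s0: "\<sigma> > 0" using a by (simp_all add: \<sigma>_def)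
  have e: "exp (- (a * (x + b)\<^sup>2)) = sqrt (pi / a) * normal_density (- b) \<sigma> x" for x
    unfolding normal_density_def s2 using a by (simp add: field_simps real_sqrt_divide)
  have "(\<integral>\<^sup>+x. ennreal (exp (- (a * (x + b)\<^sup>2))) \<partial>lborel)
    = (\<integral>\<^sup>+x. ennreal (sqrt (pi / a)) * ennreal (normal_density (- b) \<sigma> x) \<partial>lborel)"
    unfolding e using a by (simp add: ennreal_mult)
  also have "\<dots> = ennreal (sqrt (pi / a)) * (\<integral>\<^sup>+x. ennreal (normal_density (- b) \<sigma> x) \<partial>lborel)"
    by (rule nn_integral_cmult) measurable
  also have "(\<integral>\<^sup>+x. ennreal (normal_density (- b) \<sigma> x) \<partial>lborel) = ennreal (\<integral>x. normal_density (- b) \<sigma> x \<partial>lborel)"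
    using s0 by (intro nn_integral_eq_integral) auto
  also have "\<dots> = 1" using s0 by simp
  finally show ?thesis by simp
qed

lemma nn_integral_exp_decay:
  fixes a :: real
  assumes a: "a > 0"
  shows "(\<integral>\<^sup>+t. (if 0 < t then ennreal (exp (- (a * t))) else 0) \<partial>lborel) = ennreal (1 / a)"
proof -
  have "(\<integral>\<^sup>+t. (if 0 < t then ennreal (exp (- (a * t))) else 0) \<partial>lborel)
    = (\<integral>\<^sup>+t. ennreal (exp (- (a * t))) * indicator {0..} t \<partial>lborel)"
    by (rule nn_integral_cong_AE, rule AE_mp[OF AE_lborel_singleton[of 0]]) (auto simp: indicator_def)
  also have "\<dots> = ennreal (0 - (- exp (- (a * 0)) / a))"
  proof (rule nn_integral_FTC_atLeast)
    show "((\<lambda>t. - exp (- (a * t)) / a) has_real_derivative exp (- (a * x))) (at x)" for x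
      using a by (auto intro!: derivative_eq_intros)
    show "((\<lambda>t. - exp (- (a * t)) / a) \<longlongrightarrow> 0) at_top" using a by real_asymp
  qed auto
  finally show ?thesis by simp
qed

lemma nn_integral_lborel3_prod:
  fixes f g h :: "real \<Rightarrow> ennreal"
  assumes [measurable]: "f \<in> borel_measurable borel" "g \<in> borel_measurable borel" "h \<in> borel_measurable borel"
  shows "(\<integral>\<^sup>+z. f (pr1 z) * g (pr2 z) * h (pr3 z) \<partial>lborel3)
    = integral\<^sup>N lborel f * integral\<^sup>N lborel g * integral\<^sup>N lborel h"
  by (subst nn_integral_lborel3) (simp_all add: nn_integral_cmult nn_integral_multc)

text \<open>One affine substitution per coordinate, innermost first. The shift h may depend on the
  first two coordinates; such a shear does not affect the Jacobian.\<close>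

lemma nn_integral_lborel3_affine:
  fixes h :: "real \<Rightarrow> real \<Rightarrow> real"
  assumes f[measurable]: "f \<in> borel_measurable lborel3"
    and h[measurable]: "case_prod h \<in> borel_measurable lborel2"
    and k: "k1 \<noteq> 0" "k2 \<noteq> 0" "k3 \<noteq> 0"
  shows "integral\<^sup>N lborel3 f = ennreal (\<bar>k1\<bar> * \<bar>k2\<bar> * \<bar>k3\<bar>) * (\<integral>\<^sup>+z. f ((a1 + k1 * pr1 z, a2 + k2 * pr2 z),
      h (a1 + k1 * pr1 z) (a2 + k2 * pr2 z) + k3 * pr3 z) \<partial>lborel3)"
proof -
  have "integral\<^sup>N lborel3 f = (\<integral>\<^sup>+x. \<integral>\<^sup>+y. \<integral>\<^sup>+z. f ((x, y), z) \<partial>lborel \<partial>lborel \<partial>lborel)"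
    by (rule nn_integral_lborel3) fact
  also have "\<dots> = (\<integral>\<^sup>+x. \<integral>\<^sup>+y. \<bar>k3\<bar> * (\<integral>\<^sup>+t. f ((x, y), h x y + k3 * t) \<partial>lborel) \<partial>lborel \<partial>lborel)"
    by (intro nn_integral_cong nn_integral_real_affine k) measurable
  also have "\<dots> = (\<integral>\<^sup>+x. \<bar>k2\<bar> * (\<integral>\<^sup>+w. \<bar>k3\<bar> * (\<integral>\<^sup>+t. f ((x, a2 + k2 * w), h x (a2 + k2 * w) + k3 * t)
      \<partial>lborel) \<partial>lborel) \<partial>lborel)"
    by (intro nn_integral_cong nn_integral_real_affine k) measurable
  also have "\<dots> = \<bar>k1\<bar> * (\<integral>\<^sup>+u. \<bar>k2\<bar> * (\<integral>\<^sup>+w. \<bar>k3\<bar> * (\<integral>\<^sup>+t. f ((a1 + k1 * u, a2 + k2 * w),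
      h (a1 + k1 * u) (a2 + k2 * w) + k3 * t) \<partial>lborel) \<partial>lborel) \<partial>lborel)"
    by (intro nn_integral_real_affine k) measurable
  also have "\<dots> = \<bar>k1\<bar> * (\<bar>k2\<bar> * (\<bar>k3\<bar> * (\<integral>\<^sup>+u. \<integral>\<^sup>+w. \<integral>\<^sup>+t. f ((a1 + k1 * u, a2 + k2 * w),
      h (a1 + k1 * u) (a2 + k2 * w) + k3 * t) \<partial>lborel \<partial>lborel \<partial>lborel)))"
    by (simp add: nn_integral_cmult)
  also have "(\<integral>\<^sup>+u. \<integral>\<^sup>+w. \<integral>\<^sup>+t. f ((a1 + k1 * u, a2 + k2 * w),
      h (a1 + k1 * u) (a2 + k2 * w) + k3 * t) \<partial>lborel \<partial>lborel \<partial>lborel)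
    = (\<integral>\<^sup>+z. f ((a1 + k1 * pr1 z, a2 + k2 * pr2 z), h (a1 + k1 * pr1 z) (a2 + k2 * pr2 z) + k3 * pr3 z) \<partial>lborel3)"
    by (subst nn_integral_lborel3) simp_all
  finally show ?thesis by (simp add: ennreal_mult' mult.assoc)
qed

text \<open>With r = sqrt n: the first two coordinates vary on scale 1/r around 1/3 and the defect 1
  - c1 - c2 - c3 equals t / r^2. The Jacobian r^-4 = n^-2 is the origin of the power of n.\<close>

lemma nn_integral_rescale_affine:
  fixes r :: real
  assumes f: "f \<in> borel_measurable lborel3" and r: "r > 0"
  shows "integral\<^sup>N lborel3 f = ennreal (1 / r ^ 4) *
    (\<integral>\<^sup>+z. f ((1 / 3 + pr1 z / r, 1 / 3 + pr2 z / r), 1 / 3 - (pr1 z + pr2 z) / r - pr3 z / r\<^sup>2) \<partial>lborel3)"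
proof -
  have k: "\<bar>1 / r\<bar> * \<bar>1 / r\<bar> * \<bar>- 1 / r\<^sup>2\<bar> = 1 / r ^ 4"
    using r by (simp add: power2_eq_square power4_eq_xxxx)
  have "1 - (1 / 3 + 1 / r * u) - (1 / 3 + 1 / r * w) + - 1 / r\<^sup>2 * t = 1 / 3 - (u + w) / r - t / r\<^sup>2" for u w t
    by (simp add: add_divide_distrib)
  then show ?thesis
    using nn_integral_lborel3_affine[OF f, of "\<lambda>x y. 1 - x - y" "1 / r" "1 / r" "- 1 / r\<^sup>2" "1 / 3" "1 / 3"] r
    unfolding k by (simp add: add.commute)
qed

lemma nn_integral_rescale_corner:
  fixes r :: real
  assumes f: "f \<in> borel_measurable lborel3" and r: "r > 0"
  shows "integral\<^sup>N lborel3 f = ennreal (1 / r ^ 3) *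
    (\<integral>\<^sup>+z. f ((1 - pr1 z / r, 1 - pr2 z / r), 1 - pr3 z / r) \<partial>lborel3)"
proof -
  have k: "\<bar>- 1 / r\<bar> * \<bar>- 1 / r\<bar> * \<bar>- 1 / r\<bar> = 1 / r ^ 3"
    using r by (simp add: power3_eq_cube)
  show ?thesis
    using nn_integral_lborel3_affine[OF f, of "\<lambda>x y. 1" "- 1 / r" "- 1 / r" "- 1 / r" 1 1] r
    unfolding k by simp
qed

text \<open>With \<open>\<eta> = 1 - c\<^sub>1 - c\<^sub>2 - c\<^sub>3\<close> this quotient is \<open>(1 + \<eta> - 3 |c - (1/3, 1/3, 1/3)|\<^sup>2 / 2) / (1 + \<eta>)\<^sup>2\<close>.\<close>

definition laplace_base :: "real \<Rightarrow> real \<Rightarrow> real \<Rightarrow> real" where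
  "laplace_base a b c = 3 * (1 - a\<^sup>2 - b\<^sup>2 - c\<^sup>2) / 2 / (2 - (a + b + c))\<^sup>2"

text \<open>A global bound with weaker constants than the local expansion. Put e = 2 - (a + b + c),
  between 1 and 2. Then e <= (1 - (e-1)/2) e^2, since the difference is e (e-1) (2-e) / 2, and 3/8
  is 3/2 divided by the maximum 4 of e^2. The square of c - 1/3 is simply dropped.\<close>

lemma laplace_base_le:
  assumes "0 \<le> a" "0 \<le> b" "0 \<le> c" "a + b + c \<le> 1"
  shows "laplace_base a b c \<le> exp (- ((1 - (a + b + c)) / 2 + 3 / 8 * ((a - 1 / 3)\<^sup>2 + (b - 1 / 3)\<^sup>2)))"
proof -
  define e where "e = 2 - (a + b + c)"
  define q where "q = (a - 1 / 3)\<^sup>2 + (b - 1 / 3)\<^sup>2"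
  have e: "1 \<le> e" "e \<le> 2" using assms by (simp_all add: e_def)
  have q: "0 \<le> q" by (simp add: q_def)
  have X: "3 * (1 - a\<^sup>2 - b\<^sup>2 - c\<^sup>2) / 2 = e - 3 / 2 * (q + (c - 1 / 3)\<^sup>2)"
    unfolding e_def q_def by (simp add: power2_eq_square field_simps)
  have "3 * (1 - a\<^sup>2 - b\<^sup>2 - c\<^sup>2) / 2 \<le> e - 3 / 2 * q" unfolding X by simp
  also have "\<dots> \<le> (1 - (e - 1) / 2 - 3 / 8 * q) * e\<^sup>2"
  proof -
    have "0 \<le> e * (e - 1) * (2 - e) / 2" using e by simp
    moreover have "e\<^sup>2 \<le> 2\<^sup>2" using e by (intro power_mono) auto
    then have "q * e\<^sup>2 \<le> q * 4" using q by (intro mult_left_mono) auto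
    moreover have "(1 - (e - 1) / 2 - 3 / 8 * q) * e\<^sup>2 = e + e * (e - 1) * (2 - e) / 2 - 3 / 8 * (q * e\<^sup>2)"
      by (simp add: power2_eq_square field_simps)
    ultimately show ?thesis by linarith
  qed
  finally have "laplace_base a b c \<le> 1 - (e - 1) / 2 - 3 / 8 * q"
    unfolding laplace_base_def e_def[symmetric] using e by (simp add: pos_divide_le_eq)
  also have "\<dots> \<le> exp (- ((e - 1) / 2 + 3 / 8 * q))"
    using exp_ge_add_one_self[of "- ((e - 1) / 2 + 3 / 8 * q)"] by linarith
  also have "(e - 1) / 2 + 3 / 8 * q = (1 - (a + b + c)) / 2 + 3 / 8 * ((a - 1 / 3)\<^sup>2 + (b - 1 / 3)\<^sup>2)"
    by (simp add: e_def q_def)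
  finally show ?thesis .
qed

lemma laplace_base_nonneg:
  assumes "0 \<le> a" "0 \<le> b" "0 \<le> c" "a + b + c \<le> 1"
  shows "0 \<le> laplace_base a b c"
  using sum_squares_le_one[OF assms] by (simp add: laplace_base_def)

text \<open>The integrand times 3^n, without n (n-1) (n-2). With base exponent n - 3 there remain
  3^3 = 27 and the power (2n + 1) - 2 (n - 3) = 7; the value at (1/3, 1/3, 1/3) is 1.\<close>

definition laplace_kernel :: "nat \<Rightarrow> real \<Rightarrow> real \<Rightarrow> real \<Rightarrow> real" where
  "laplace_kernel n a b c = 27 * a * b * c * laplace_base a b c ^ (n - 3) * (1 / (2 - (a + b + c))) ^ 7"

lemma laplace_kernel_eq:
  assumes n: "n \<ge> 3" and "a + b + c < 1"
  shows "3 ^ n * (simplex_density n a b c * (1 / (2 - (a + b + c))) ^ (2 * n + 1))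
    = real n * real (n - 1) * real (n - 2) * laplace_kernel n a b c"
proof -
  obtain m where m: "n = m + 3" using n by (metis le_add_diff_inverse2)
  define q where "q = 1 / (2 - (a + b + c))"
  define X where "X = (1 - a\<^sup>2 - b\<^sup>2 - c\<^sup>2) / 2"
  have B: "laplace_base a b c = 3 * X * q\<^sup>2" by (simp add: laplace_base_def X_def q_def power_divide)
  have e: "2 * (m + 3) + 1 = 2 * m + 7" by simp
  show ?thesis
    unfolding laplace_kernel_def simplex_density_def B X_def[symmetric] q_def[symmetric] m e add_diff_cancel_right'
    by (simp add: power_mult_distrib power_add flip: power_mult)
qed


section \<open>Dominated convergence over the slacks\<close>

lemma tendsto_divide_sqrt: "(\<lambda>n. u / sqrt (real n)) \<longlonglongrightarrow> 0"
proof -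
  have "(\<lambda>n. u * (1 / sqrt (real n))) \<longlonglongrightarrow> u * 0"
    by (intro tendsto_mult tendsto_const) real_asymp
  then show ?thesis by simp
qed

text \<open>The dominating function. For n >= 6 the exponent n - 3 is at least n/2, which halves the
  constants of \<open>laplace_base_le\<close>: 3/8 becomes 3/16 and 1/2 becomes 1/4.\<close>

lemma laplace_kernel_le:
  assumes n: "n \<ge> 6" and c: "0 \<le> a" "0 \<le> b" "0 \<le> c" "a + b + c < 1"
    and abc: "a = 1 / 3 + u / sqrt (real n)" "b = 1 / 3 + w / sqrt (real n)" "a + b + c = 1 - t / real n"
  shows "laplace_kernel n a b c \<le> 27 * exp (- (3 / 16 * u\<^sup>2)) * exp (- (3 / 16 * w\<^sup>2)) * exp (- (1 / 4 * t))"
proof -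
  define E where "E = t / 2 + 3 / 8 * (u\<^sup>2 + w\<^sup>2)"
  have n0: "real n > 0" using n by simp
  have "0 < t / real n" using c(4) abc(3) by linarith
  then have t: "t > 0" using n0 by (simp add: zero_less_divide_iff)
  then have E: "0 \<le> E" by (simp add: E_def)
  have c1: "a + b + c \<le> 1" using c(4) by simp
  have "laplace_base a b c \<le> exp (- (E / real n))"
  proof -
    have "(1 - (a + b + c)) / 2 + 3 / 8 * ((a - 1 / 3)\<^sup>2 + (b - 1 / 3)\<^sup>2) = E / real n"
    proof -
      have e1: "1 - (a + b + c) = t / real n" using abc(3) by simp
      have e2: "(a - 1 / 3)\<^sup>2 = u\<^sup>2 / real n" "(b - 1 / 3)\<^sup>2 = w\<^sup>2 / real n"
        unfolding abc(1,2) by (simp_all add: power_divide)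
      show ?thesis unfolding e1 e2 E_def by (simp add: add_divide_distrib)
    qed
    then show ?thesis using laplace_base_le[OF c(1-3) c1] by simp
  qed
  then have "laplace_base a b c ^ (n - 3) \<le> exp (- (E / real n)) ^ (n - 3)"
    using laplace_base_nonneg[OF c(1-3) c1] by (rule power_mono)
  also have "\<dots> = exp (- (real (n - 3) / real n * E))"
    by (simp flip: exp_of_nat_mult)
  also have "\<dots> \<le> exp (- (1 / 2 * E))"
  proof -
    have "1 / 2 \<le> real (n - 3) / real n" using n n0 by (simp add: field_simps of_nat_diff)
    then have "1 / 2 * E \<le> real (n - 3) / real n * E" using E by (rule mult_right_mono)
    then show ?thesis by simp
  qed
  finally have B: "laplace_base a b c ^ (n - 3) \<le> exp (- (1 / 2 * E))" .
  have "27 * a * b * c \<le> 27"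
  proof -
    have "a * b \<le> 1 * 1" using c by (intro mult_mono) auto
    then have "(a * b) * c \<le> 1 * 1" using c by (intro mult_mono) auto
    then show ?thesis by (simp add: mult.assoc)
  qed
  moreover have "(1 / (2 - (a + b + c))) ^ 7 \<le> 1"
    using c by (intro power_le_one) (auto simp: field_simps)
  ultimately have "laplace_kernel n a b c \<le> 27 * exp (- (1 / 2 * E)) * 1"
    unfolding laplace_kernel_def using c B laplace_base_nonneg[OF c(1-3) c1]
    by (intro mult_mono) (auto intro!: mult_nonneg_nonneg)
  also have "\<dots> = 27 * exp (- (3 / 16 * u\<^sup>2)) * exp (- (3 / 16 * w\<^sup>2)) * exp (- (1 / 4 * t))"
    by (simp add: E_def mult.assoc flip: exp_add) (simp add: algebra_simps)
  finally show ?thesis .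
qed

lemma laplace_kernel_tendsto:
  fixes u w t :: real
  defines "a \<equiv> \<lambda>n. 1 / 3 + u / sqrt (real n)" and "b \<equiv> \<lambda>n. 1 / 3 + w / sqrt (real n)"
    and "c \<equiv> \<lambda>n. 1 / 3 - (u + w) / sqrt (real n) - t / (sqrt (real n))\<^sup>2"
  shows "(\<lambda>n. laplace_kernel n (a n) (b n) (c n)) \<longlonglongrightarrow> exp (- (9 / 4 * u\<^sup>2)) * exp (- (3 * (w + u / 2)\<^sup>2)) * exp (- (1 * t))"
proof -
  have t0: "(\<lambda>n. t / (sqrt (real n))\<^sup>2) \<longlonglongrightarrow> 0"
  proof -
    have "(\<lambda>n. t / sqrt (real n) * (1 / sqrt (real n))) \<longlonglongrightarrow> 0 * 0"
      by (intro tendsto_mult tendsto_divide_sqrt)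
    then show ?thesis by (simp add: power2_eq_square)
  qed
  have lim: "a \<longlonglongrightarrow> 1 / 3" "b \<longlonglongrightarrow> 1 / 3" "c \<longlonglongrightarrow> 1 / 3"
  proof -
    have "a \<longlonglongrightarrow> 1 / 3 + 0" unfolding a_def by (intro tendsto_add tendsto_const tendsto_divide_sqrt)
    then show "a \<longlonglongrightarrow> 1 / 3" by simp
    have "b \<longlonglongrightarrow> 1 / 3 + 0" unfolding b_def by (intro tendsto_add tendsto_const tendsto_divide_sqrt)
    then show "b \<longlonglongrightarrow> 1 / 3" by simp
    have "c \<longlonglongrightarrow> 1 / 3 - 0 - 0" unfolding c_def by (intro tendsto_diff tendsto_const tendsto_divide_sqrt t0)
    then show "c \<longlonglongrightarrow> 1 / 3" by simp
  qed
  have base: "(\<lambda>n. laplace_base (a n) (b n) (c n)) \<longlonglongrightarrow> 1"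
  proof -
    have "(\<lambda>n. laplace_base (a n) (b n) (c n)) \<longlonglongrightarrow>
      3 * (1 - (1 / 3)\<^sup>2 - (1 / 3)\<^sup>2 - (1 / 3)\<^sup>2) / 2 / (2 - (1 / 3 + 1 / 3 + 1 / 3))\<^sup>2"
      unfolding laplace_base_def by (intro tendsto_intros lim) simp_all
    then show ?thesis by (simp add: power2_eq_square)
  qed
  \<comment> \<open>The numerator of the base is exactly 1 + x n / n, its denominator (1 + t /
    n)^2.\<close>
  define x where "x n = t - 3 / 2 * (u\<^sup>2 + w\<^sup>2 + (u + w + t / sqrt (real n))\<^sup>2)" for n
  have "x \<longlonglongrightarrow> t - 3 / 2 * (u\<^sup>2 + w\<^sup>2 + (u + w + 0)\<^sup>2)"
    unfolding x_def by (intro tendsto_intros tendsto_divide_sqrt)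
  then have num: "(\<lambda>n. (1 + x n / real n) ^ n) \<longlonglongrightarrow> exp (t - 3 / 2 * (u\<^sup>2 + w\<^sup>2 + (u + w + 0)\<^sup>2))"
    by (rule tendsto_one_plus_over_n_power)
  have den: "(\<lambda>n. (1 + t / real n) ^ n) \<longlonglongrightarrow> exp t"
    by (rule tendsto_one_plus_over_n_power) (rule tendsto_const)
  \<comment> \<open>The limit is taken with exponent n and then corrected by the cube of the base,
    which tends to 1.\<close>
  have "(\<lambda>n. (1 + x n / real n) ^ n / ((1 + t / real n) ^ n)\<^sup>2 / laplace_base (a n) (b n) (c n) ^ 3)
    \<longlonglongrightarrow> exp (t - 3 / 2 * (u\<^sup>2 + w\<^sup>2 + (u + w + 0)\<^sup>2)) / (exp t)\<^sup>2 / 1 ^ 3"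
    by (intro tendsto_divide tendsto_power num den base) simp_all
  moreover have "\<forall>\<^sub>F n in sequentially. (1 + x n / real n) ^ n / ((1 + t / real n) ^ n)\<^sup>2 / laplace_base (a n) (b n) (c n) ^ 3
      = laplace_base (a n) (b n) (c n) ^ (n - 3)"
    using order_tendstoD(1)[OF base zero_less_one] eventually_ge_at_top[of 3]
  proof eventually_elim
    case (elim n)
    define s where "s = sqrt (real n)"
    have s: "s > 0" "real n = s\<^sup>2" using elim(2) by (simp_all add: s_def)
    have e: "2 - (a n + b n + c n) = 1 + t / real n"
      unfolding a_def b_def c_def s_def[symmetric] s(2) by (simp add: add_divide_distrib)
    have X: "3 * (1 - (a n)\<^sup>2 - (b n)\<^sup>2 - (c n)\<^sup>2) / 2 = 1 + x n / real n"
    proof -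
      define U W T where "U = u / s" and "W = w / s" and "T = t / s"
      have uwt: "u = U * s" "w = W * s" "t = T * s" using s by (simp_all add: U_def W_def T_def)
      have ab: "a n = 1 / 3 + U" "b n = 1 / 3 + W" "c n = 1 / 3 - (U + W) - T / s"
        unfolding a_def b_def c_def s_def[symmetric] U_def W_def T_def using s
        by (simp_all add: add_divide_distrib power2_eq_square)
      have "x n / real n = T / s - 3 / 2 * (U\<^sup>2 + W\<^sup>2 + (U + W + T / s)\<^sup>2)"
        unfolding x_def s_def[symmetric] s(2) uwt using s(1)
        by (simp add: field_simps power2_eq_square)
      moreover have "3 * (1 - (1 / 3 + U)\<^sup>2 - (1 / 3 + W)\<^sup>2 - (1 / 3 - (U + W) - V)\<^sup>2) / 2
        = 1 + (V - 3 / 2 * (U\<^sup>2 + W\<^sup>2 + (U + W + V)\<^sup>2))" for V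
        by (simp add: power2_eq_square field_simps)
      ultimately show ?thesis unfolding ab by (simp only:)
    qed
    have "laplace_base (a n) (b n) (c n) = (1 + x n / real n) / (1 + t / real n)\<^sup>2"
      unfolding laplace_base_def e X ..
    then have p1: "laplace_base (a n) (b n) (c n) ^ n = (1 + x n / real n) ^ n / ((1 + t / real n) ^ n)\<^sup>2"
      by (simp add: power_divide mult.commute flip: power_mult)
    have p2: "laplace_base (a n) (b n) (c n) ^ n = laplace_base (a n) (b n) (c n) ^ (n - 3) * laplace_base (a n) (b n) (c n) ^ 3"
      using elim(2) by (simp flip: power_add)
    show ?case unfolding p1[symmetric] p2 using elim(1) by simp
  qed
  ultimately have "(\<lambda>n. laplace_base (a n) (b n) (c n) ^ (n - 3))
    \<longlonglongrightarrow> exp (t - 3 / 2 * (u\<^sup>2 + w\<^sup>2 + (u + w + 0)\<^sup>2)) / (exp t)\<^sup>2 / 1 ^ 3"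
    by (rule Lim_transform_eventually)
  then have "(\<lambda>n. laplace_kernel n (a n) (b n) (c n)) \<longlonglongrightarrow>
    27 * (1 / 3) * (1 / 3) * (1 / 3) * (exp (t - 3 / 2 * (u\<^sup>2 + w\<^sup>2 + (u + w + 0)\<^sup>2)) / (exp t)\<^sup>2 / 1 ^ 3)
      * (1 / (2 - (1 / 3 + 1 / 3 + 1 / 3))) ^ 7"
    unfolding laplace_kernel_def by (intro tendsto_intros lim) simp_all
  also have "27 * (1 / 3) * (1 / 3) * (1 / 3) * (exp (t - 3 / 2 * (u\<^sup>2 + w\<^sup>2 + (u + w + 0)\<^sup>2)) / (exp t)\<^sup>2 / 1 ^ 3)
      * (1 / (2 - (1 / 3 + 1 / 3 + 1 / 3))) ^ 7 = exp (t - 3 / 2 * (u\<^sup>2 + w\<^sup>2 + (u + w)\<^sup>2) - t - t)"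
  proof -
    have "exp (t - Y) / (exp t)\<^sup>2 = exp (t - Y - t - t)" for Y
      by (simp only: exp_diff power2_eq_square divide_divide_eq_left mult.assoc)
    moreover have "27 * (1 / 3) * (1 / 3) * (1 / 3) * (X / 1 ^ 3) * (1 / (2 - (1 / 3 + 1 / 3 + 1 / 3))) ^ 7 = X" for X :: real
      by simp
    ultimately show ?thesis by (simp only: add_0_right)
  qed
  also have "t - 3 / 2 * (u\<^sup>2 + w\<^sup>2 + (u + w)\<^sup>2) - t - t = - (9 / 4 * u\<^sup>2) + - (3 * (w + u / 2)\<^sup>2) + - (1 * t)"
    by (simp add: power2_eq_square field_simps)
  finally show ?thesis by (simp only: exp_add)
qed

text \<open>For t > 0 the cutoff delta < 1/3 is eventually inactive pointwise, hence the limit does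
  not depend on it; for t <= 0 the integrands vanish. Completing the square, 3 (u^2 + u w + w^2) =
  9/4 u^2 + 3 (w + u/2)^2, splits the Gaussian.\<close>

lemma laplace_int_limit:
  assumes \<delta>: "0 \<le> \<delta>" "\<delta> < 1 / 3"
  shows "(\<lambda>n. ennreal (3 ^ n * (real n)\<^sup>2 / (real n * real (n - 1) * real (n - 2))) * laplace_int n \<delta>)
    \<longlonglongrightarrow> ennreal (2 * pi / (3 * sqrt 3))"
proof -
  define a where "a n u = 1 / 3 + u / sqrt (real n)" for n u
  define c where "c n u w t = 1 / 3 - (u + w) / sqrt (real n) - t / (sqrt (real n))\<^sup>2" for n u w t
  define H where "H n z = (if \<delta> \<le> a n (pr1 z) \<and> \<delta> \<le> a n (pr2 z) \<and> \<delta> \<le> c n (pr1 z) (pr2 z) (pr3 z) \<and>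
      a n (pr1 z) + a n (pr2 z) + c n (pr1 z) (pr2 z) (pr3 z) < 1
    then ennreal (laplace_kernel n (a n (pr1 z)) (a n (pr2 z)) (c n (pr1 z) (pr2 z) (pr3 z))) else 0)" for n z
  define W where "W z = ennreal (27 * exp (- (3 / 16 * (pr1 z + 0)\<^sup>2))) * ennreal (exp (- (3 / 16 * (pr2 z + 0)\<^sup>2)))
    * (if 0 < pr3 z then ennreal (exp (- (1 / 4 * pr3 z))) else 0)" for z
  define G where "G z = ennreal (exp (- (9 / 4 * (pr1 z + 0)\<^sup>2))) * (ennreal (exp (- (3 * (pr2 z + pr1 z / 2)\<^sup>2)))
    * (if 0 < pr3 z then ennreal (exp (- (1 * pr3 z))) else 0))" for z
  have sum: "a n u + a n w + c n u w t = 1 - t / real n" for n u w t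
    unfolding a_def c_def by (simp add: add_divide_distrib)
  have step: "ennreal (3 ^ n * (real n)\<^sup>2 / (real n * real (n - 1) * real (n - 2))) * laplace_int n \<delta>
    = integral\<^sup>N lborel3 (H n)" if n: "n \<ge> 3" for n
  proof -
    define N where "N = real n * real (n - 1) * real (n - 2)"
    have N: "N > 0" using n by (simp add: N_def)
    define f where "f z = (if \<delta> \<le> pr1 z \<and> \<delta> \<le> pr2 z \<and> \<delta> \<le> pr3 z \<and> pr1 z + pr2 z + pr3 z < 1
      then ennreal (simplex_density n (pr1 z) (pr2 z) (pr3 z) * (1 / (2 - (pr1 z + pr2 z + pr3 z))) ^ (2 * n + 1)) else 0)" for z
    have f[measurable]: "f \<in> borel_measurable lborel3" unfolding f_def simplex_density_def by measurable
    have r4: "(sqrt (real n)) ^ 4 = (real n)\<^sup>2"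
      by (metis numeral_Bit0 of_nat_0_le_iff power_add power2_eq_square real_sqrt_pow2)
    have "laplace_int n \<delta> = integral\<^sup>N lborel3 f" unfolding laplace_int_def f_def ..
    also have "\<dots> = ennreal (1 / (real n)\<^sup>2) * (\<integral>\<^sup>+z. f ((a n (pr1 z), a n (pr2 z)), c n (pr1 z) (pr2 z) (pr3 z)) \<partial>lborel3)"
      unfolding a_def c_def r4[symmetric] using n by (intro nn_integral_rescale_affine f) simp
    finally have "ennreal (3 ^ n * (real n)\<^sup>2 / N) * laplace_int n \<delta>
      = ennreal (3 ^ n * (real n)\<^sup>2 / N) * ennreal (1 / (real n)\<^sup>2) *
        (\<integral>\<^sup>+z. f ((a n (pr1 z), a n (pr2 z)), c n (pr1 z) (pr2 z) (pr3 z)) \<partial>lborel3)" by (simp only: mult.assoc)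
    also have "ennreal (3 ^ n * (real n)\<^sup>2 / N) * ennreal (1 / (real n)\<^sup>2) = ennreal (3 ^ n / N)"
      using n N by (simp add: ennreal_mult'[symmetric])
    also have "ennreal (3 ^ n / N) * (\<integral>\<^sup>+z. f ((a n (pr1 z), a n (pr2 z)), c n (pr1 z) (pr2 z) (pr3 z)) \<partial>lborel3)
      = (\<integral>\<^sup>+z. ennreal (3 ^ n / N) * f ((a n (pr1 z), a n (pr2 z)), c n (pr1 z) (pr2 z) (pr3 z)) \<partial>lborel3)"
      unfolding a_def c_def by (rule nn_integral_cmult[symmetric]) measurable
    also have "\<dots> = integral\<^sup>N lborel3 (H n)"
    proof (rule nn_integral_cong)
      fix z :: "(real \<times> real) \<times> real"
      let ?a = "a n (pr1 z)" and ?b = "a n (pr2 z)" and ?c = "c n (pr1 z) (pr2 z) (pr3 z)"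
      show "ennreal (3 ^ n / N) * f ((?a, ?b), ?c) = H n z"
      proof (cases "\<delta> \<le> ?a \<and> \<delta> \<le> ?b \<and> \<delta> \<le> ?c \<and> ?a + ?b + ?c < 1")
        case True
        have k: "3 ^ n / N * (simplex_density n ?a ?b ?c * (1 / (2 - (?a + ?b + ?c))) ^ (2 * n + 1)) = laplace_kernel n ?a ?b ?c"
        proof -
          have e: "3 ^ n * (simplex_density n ?a ?b ?c * (1 / (2 - (?a + ?b + ?c))) ^ (2 * n + 1)) = N * laplace_kernel n ?a ?b ?c"
            using laplace_kernel_eq[OF n, of ?a ?b ?c] True unfolding N_def by blast
          show ?thesis unfolding times_divide_eq_left e using N by simp
        qed
        have "ennreal (3 ^ n / N) * ennreal (simplex_density n ?a ?b ?c * (1 / (2 - (?a + ?b + ?c))) ^ (2 * n + 1))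
          = ennreal (laplace_kernel n ?a ?b ?c)"
          unfolding k[symmetric] using N by (intro ennreal_mult'[symmetric]) simp
        then show ?thesis using True unfolding f_def H_def fst_conv snd_conv by (simp only: if_True simp_thms)
      next
        case False
        then show ?thesis unfolding f_def H_def fst_conv snd_conv by (simp only: if_False mult_zero_right)
      qed
    qed
    finally show ?thesis by (simp only: N_def)
  qed
  \<comment> \<open>The shift by 6 makes the dominating bound valid for every member of the
    sequence.\<close>
  have "(\<lambda>j. integral\<^sup>N lborel3 (H (j + 6))) \<longlonglongrightarrow> integral\<^sup>N lborel3 G"
  proof (rule nn_integral_dominated_convergence[where w = W])
    show "H (j + 6) \<in> borel_measurable lborel3" for j
      unfolding H_def laplace_kernel_def laplace_base_def a_def c_def by measurable
    show "G \<in> borel_measurable lborel3" unfolding G_def by measurable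
    show "W \<in> borel_measurable lborel3" unfolding W_def by measurable
    show "AE z in lborel3. H (j + 6) z \<le> W z" for j
    proof (rule AE_I2)
      fix z :: "(real \<times> real) \<times> real"
      define n where "n = j + 6"
      let ?a = "a n (pr1 z)" and ?b = "a n (pr2 z)" and ?c = "c n (pr1 z) (pr2 z) (pr3 z)"
      show "H (j + 6) z \<le> W z"
      proof (cases "\<delta> \<le> ?a \<and> \<delta> \<le> ?b \<and> \<delta> \<le> ?c \<and> ?a + ?b + ?c < 1")
        case True
        then have pos: "0 \<le> ?a" "0 \<le> ?b" "0 \<le> ?c" "?a + ?b + ?c < 1" using \<delta>(1) by linarith+
        have "laplace_kernel n ?a ?b ?c \<le> 27 * exp (- (3 / 16 * (pr1 z)\<^sup>2)) * exp (- (3 / 16 * (pr2 z)\<^sup>2)) * exp (- (1 / 4 * pr3 z))"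
          by (rule laplace_kernel_le[OF _ pos a_def a_def sum]) (simp add: n_def)
        moreover have "0 < pr3 z"
        proof -
          have "0 < pr3 z / real n" using pos(4) unfolding sum by simp
          then show ?thesis by (simp add: n_def zero_less_divide_iff)
        qed
        ultimately show ?thesis
          unfolding H_def W_def n_def[symmetric] using True
          by (simp add: ennreal_mult'[symmetric] ennreal_leI)
      next
        case False
        then show ?thesis unfolding H_def n_def[symmetric] by (simp only: if_False zero_le)
      qed
    qed
    have "integral\<^sup>N lborel3 W = ennreal 27 * ennreal (sqrt (pi / (3 / 16))) * ennreal (sqrt (pi / (3 / 16))) * ennreal (1 / (1 / 4))"
    proof -
      have "(\<integral>\<^sup>+x. ennreal (27 * exp (- (3 / 16 * (x + 0)\<^sup>2))) \<partial>lborel) = ennreal 27 * ennreal (sqrt (pi / (3 / 16)))"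
        by (subst nn_integral_gauss[of "3 / 16" 0, symmetric], simp, subst nn_integral_cmult[symmetric])
          (simp_all add: ennreal_mult')
      moreover have "(\<integral>\<^sup>+x. ennreal (exp (- (3 / 16 * (x + 0)\<^sup>2))) \<partial>lborel) = ennreal (sqrt (pi / (3 / 16)))"
        by (rule nn_integral_gauss) simp
      moreover have "(\<integral>\<^sup>+t. (if 0 < t then ennreal (exp (- (1 / 4 * t))) else 0) \<partial>lborel) = ennreal (1 / (1 / 4))"
        by (rule nn_integral_exp_decay) simp
      moreover have "integral\<^sup>N lborel3 W = (\<integral>\<^sup>+x. ennreal (27 * exp (- (3 / 16 * (x + 0)\<^sup>2))) \<partial>lborel)
        * (\<integral>\<^sup>+x. ennreal (exp (- (3 / 16 * (x + 0)\<^sup>2))) \<partial>lborel)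
        * (\<integral>\<^sup>+t. (if 0 < t then ennreal (exp (- (1 / 4 * t))) else 0) \<partial>lborel)"
        unfolding W_def by (rule nn_integral_lborel3_prod) measurable
      ultimately show ?thesis by (simp only:)
    qed
    then show "integral\<^sup>N lborel3 W < \<infinity>" by (simp add: ennreal_mult_less_top)
    show "AE z in lborel3. (\<lambda>j. H (j + 6) z) \<longlonglongrightarrow> G z"
    proof (rule AE_I2)
      fix z :: "(real \<times> real) \<times> real"
      obtain u w t where z: "z = ((u, w), t)" by (metis prod.exhaust)
      have "(\<lambda>n. H n z) \<longlonglongrightarrow> G z"
      proof (cases "0 < t")
        case True
        have u0: "(\<lambda>n. a n u) \<longlonglongrightarrow> 1 / 3 + 0" for u
          unfolding a_def by (intro tendsto_add tendsto_const tendsto_divide_sqrt)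
        have "(\<lambda>n. 1 - t / real n - a n u - a n w) \<longlonglongrightarrow> 1 - 0 - (1 / 3 + 0) - (1 / 3 + 0)"
          by (intro tendsto_diff tendsto_const u0 lim_const_over_n)
        moreover have "c n u w t = 1 - t / real n - a n u - a n w" for n using sum[of n u w t] by simp
        ultimately have c0: "(\<lambda>n. c n u w t) \<longlonglongrightarrow> 1 / 3" by simp
        have "\<forall>\<^sub>F n in sequentially. \<delta> < a n u" "\<forall>\<^sub>F n in sequentially. \<delta> < a n w" "\<forall>\<^sub>F n in sequentially. \<delta> < c n u w t"
          using u0[of u] u0[of w] c0 \<delta>(2) by (auto intro: order_tendstoD(1))
        then have ev: "\<forall>\<^sub>F n in sequentially. ennreal (laplace_kernel n (a n u) (a n w) (c n u w t)) = H n z"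
          using eventually_gt_at_top[of 0]
        proof eventually_elim
          case (elim n)
          then have "a n u + a n w + c n u w t < 1" unfolding sum using True by simp
          then show ?case using elim unfolding H_def z fst_conv snd_conv by simp
        qed
        have "(\<lambda>n. ennreal (laplace_kernel n (a n u) (a n w) (c n u w t)))
          \<longlonglongrightarrow> ennreal (exp (- (9 / 4 * u\<^sup>2)) * exp (- (3 * (w + u / 2)\<^sup>2)) * exp (- (1 * t)))"
          unfolding a_def c_def by (intro tendsto_ennrealI laplace_kernel_tendsto)
        then have "(\<lambda>n. H n z) \<longlonglongrightarrow> ennreal (exp (- (9 / 4 * u\<^sup>2)) * exp (- (3 * (w + u / 2)\<^sup>2)) * exp (- (1 * t)))"
          by (rule Lim_transform_eventually) (rule ev)
        also have "ennreal (exp (- (9 / 4 * u\<^sup>2)) * exp (- (3 * (w + u / 2)\<^sup>2)) * exp (- (1 * t))) = G z"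
          unfolding G_def z fst_conv snd_conv using True by (simp add: ennreal_mult'[symmetric] mult.assoc)
        finally show ?thesis .
      next
        case False
        have "\<forall>\<^sub>F n in sequentially. 0 = H n z"
          using eventually_gt_at_top[of 0]
        proof eventually_elim
          case (elim n)
          then have "\<not> a n u + a n w + c n u w t < 1"
            unfolding sum using False by (simp add: divide_nonpos_pos not_less)
          then show ?case unfolding H_def z fst_conv snd_conv by simp
        qed
        moreover have "G z = 0" using False by (simp add: G_def z)
        ultimately show ?thesis by (intro Lim_transform_eventually[OF tendsto_const]) simp_all
      qed
      then show "(\<lambda>j. H (j + 6) z) \<longlonglongrightarrow> G z" by (rule LIMSEQ_ignore_initial_segment)
    qed
  qed
  also have "integral\<^sup>N lborel3 G = ennreal (2 * pi / (3 * sqrt 3))"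
  proof -
    have "integral\<^sup>N lborel3 G = (\<integral>\<^sup>+u. \<integral>\<^sup>+w. \<integral>\<^sup>+t. ennreal (exp (- (9 / 4 * (u + 0)\<^sup>2))) * (ennreal (exp (- (3 * (w + u / 2)\<^sup>2)))
      * (if 0 < t then ennreal (exp (- (1 * t))) else 0)) \<partial>lborel \<partial>lborel \<partial>lborel)"
    proof -
      have m: "G \<in> borel_measurable lborel3" unfolding G_def by measurable
      show ?thesis unfolding nn_integral_lborel3[OF m] unfolding G_def fst_conv snd_conv ..
    qed
    also have "\<dots> = (\<integral>\<^sup>+u. ennreal (exp (- (9 / 4 * (u + 0)\<^sup>2))) * (\<integral>\<^sup>+w. ennreal (exp (- (3 * (w + u / 2)\<^sup>2)))
      * (\<integral>\<^sup>+t. (if 0 < t then ennreal (exp (- (1 * t))) else 0) \<partial>lborel) \<partial>lborel) \<partial>lborel)"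
      by (simp add: nn_integral_cmult)
    also have "\<dots> = (\<integral>\<^sup>+u. ennreal (exp (- (9 / 4 * (u + 0)\<^sup>2))) * ennreal (sqrt (pi / 3)) \<partial>lborel)"
      by (subst nn_integral_exp_decay, simp, simp only: div_by_1 ennreal_1 mult_1_right, subst nn_integral_gauss) simp_all
    also have "\<dots> = ennreal (sqrt (pi / (9 / 4))) * ennreal (sqrt (pi / 3))"
      by (subst nn_integral_multc, simp, subst nn_integral_gauss) simp_all
    also have "\<dots> = ennreal (2 * pi / (3 * sqrt 3))"
    proof -
      have "sqrt (pi / (9 / 4)) * sqrt (pi / 3) = 2 * pi / (3 * sqrt 3)"
      proof -
        have "pi / (9 / 4) = (2 / 3)\<^sup>2 * pi" by (simp add: power2_eq_square)
        then have "sqrt (pi / (9 / 4)) = sqrt ((2 / 3)\<^sup>2 * pi)" by (simp only:)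
        also have "\<dots> = 2 / 3 * sqrt pi" by (simp add: real_sqrt_mult)
        finally have "sqrt (pi / (9 / 4)) = 2 / 3 * sqrt pi" .
        then show ?thesis by (simp add: real_sqrt_divide)
      qed
      then show ?thesis by (simp add: ennreal_mult'[symmetric])
    qed
    finally show ?thesis .
  qed
  finally have "(\<lambda>n. integral\<^sup>N lborel3 (H n)) \<longlonglongrightarrow> ennreal (2 * pi / (3 * sqrt 3))"
    by (rule LIMSEQ_offset)
  moreover have "\<forall>\<^sub>F n in sequentially. integral\<^sup>N lborel3 (H n)
    = ennreal (3 ^ n * (real n)\<^sup>2 / (real n * real (n - 1) * real (n - 2))) * laplace_int n \<delta>"
    using eventually_ge_at_top[of 3] by eventually_elim (rule step[symmetric])
  ultimately show ?thesis by (rule Lim_transform_eventually)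
qed


section \<open>The volume of P and D near y = (1, 1, 1)\<close>

lemma hex_area_le:
  assumes "y1 \<le> 1" "y2 \<le> 1" "y3 \<le> 1"
  shows "2 * hex_area ((y1, y2), y3) \<le> ennreal (exp (- (((1 - y1)\<^sup>2 + (1 - y2)\<^sup>2 + (1 - y3)\<^sup>2) / 3)))"
proof (cases "0 \<le> y1 \<and> 0 \<le> y2 \<and> 0 \<le> y3")
  case True
  \<comment> \<open>Two of the bounds are raised to 1 and the third is d; the formula then gives ((1
    + d)^2 - 1 - 2 d^2) / 2 for the enlarged hexagon.\<close>
  have le: "emeasure lborel (hexagon 0 0 0 y1 y2 y3) \<le> ennreal ((1 - (1 - d)\<^sup>2) / 2)"
    if "y1 \<le> b1" "y2 \<le> b2" "y3 \<le> b3" and b: "b1 = d \<and> b2 = 1 \<and> b3 = 1 \<or> b1 = 1 \<and> b2 = d \<and> b3 = 1 \<or> b1 = 1 \<and> b2 = 1 \<and> b3 = d"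
      and d: "0 \<le> d" "d \<le> 1" for b1 b2 b3 d
  proof -
    have "emeasure lborel (hexagon 0 0 0 y1 y2 y3) \<le> emeasure lborel (hexagon 0 0 0 b1 b2 b3)"
      by (rule emeasure_mono, use that(1-3) in \<open>force simp: hexagon_def\<close>, simp add: hexagon_measurable)
    also have "\<dots> = ennreal (((b1 + b2 + b3 - 1)\<^sup>2 - (b2 + b3 - 1)\<^sup>2 - (b1 + b3 - 1)\<^sup>2 - (b1 + b2 - 1)\<^sup>2) / 2)"
      by (rule emeasure_hexagon) (use b d in auto)
    also have "((b1 + b2 + b3 - 1)\<^sup>2 - (b2 + b3 - 1)\<^sup>2 - (b1 + b3 - 1)\<^sup>2 - (b1 + b2 - 1)\<^sup>2) / 2 = (1 - (1 - d)\<^sup>2) / 2"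
      using b by (elim disjE conjE) (simp_all add: power2_eq_square algebra_simps)
    finally show ?thesis .
  qed
  have le1: "emeasure lborel (hexagon 0 0 0 y1 y2 y3) \<le> ennreal ((1 - (1 - y1)\<^sup>2) / 2)"
    using True assms by (intro le[of y1 1 1]) auto
  have le2: "emeasure lborel (hexagon 0 0 0 y1 y2 y3) \<le> ennreal ((1 - (1 - y2)\<^sup>2) / 2)"
    using True assms by (intro le[of 1 y2 1]) auto
  have le3: "emeasure lborel (hexagon 0 0 0 y1 y2 y3) \<le> ennreal ((1 - (1 - y3)\<^sup>2) / 2)"
    using True assms by (intro le[of 1 1 y3]) auto
  define m where "m = ((1 - y1)\<^sup>2 + (1 - y2)\<^sup>2 + (1 - y3)\<^sup>2) / 3"
  \<comment> \<open>The largest square is at least the mean m. Passing to the mean weakens the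
    constant to 1/3 but makes the bound a product in the three coordinates.\<close>
  have "m \<le> (1 - y1)\<^sup>2 \<or> m \<le> (1 - y2)\<^sup>2 \<or> m \<le> (1 - y3)\<^sup>2" unfolding m_def by argo
  moreover have "emeasure lborel (hexagon 0 0 0 y1 y2 y3) \<le> ennreal ((1 - m) / 2)"
    if "m \<le> d" "emeasure lborel (hexagon 0 0 0 y1 y2 y3) \<le> ennreal ((1 - d) / 2)" for d
    using that(2) by (rule order_trans) (use that(1) in \<open>simp add: ennreal_leI\<close>)
  ultimately have "emeasure lborel (hexagon 0 0 0 y1 y2 y3) \<le> ennreal ((1 - m) / 2)"
    using le1 le2 le3 by blast
  also have "\<dots> \<le> ennreal (exp (- m) / 2)"
    using exp_ge_add_one_self[of "- m"] by (intro ennreal_leI) simp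
  finally have "2 * emeasure lborel (hexagon 0 0 0 y1 y2 y3) \<le> ennreal 2 * ennreal (exp (- m) / 2)"
    by (simp add: mult_left_mono)
  also have "\<dots> = ennreal (exp (- m))" by (subst ennreal_mult'[symmetric]) simp_all
  finally show ?thesis by (simp add: hex_area_def m_def)
next
  case False
  then have "hexagon 0 0 0 y1 y2 y3 = {}" by (auto simp: hexagon_def)
  then show ?thesis by (simp add: hex_area_def)
qed

lemma nn_integral_half_gauss:
  "(\<integral>\<^sup>+x. (if 0 \<le> x then ennreal (exp (- x\<^sup>2)) else 0) \<partial>lborel) = ennreal (sqrt pi / 2)"
proof -
  have "(\<integral>\<^sup>+x. ennreal (indicator {0..} x *\<^sub>R exp (- x\<^sup>2)) \<partial>lborel)
    = ennreal (\<integral>x. indicator {0..} x *\<^sub>R exp (- x\<^sup>2) \<partial>lborel)"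
    using gaussian_moment_0 by (intro nn_integral_eq_integral) (auto simp: has_bochner_integral_iff)
  also have "\<dots> = ennreal (sqrt pi / 2)"
    using has_bochner_integral_integral_eq[OF gaussian_moment_0] by simp
  finally have "(\<integral>\<^sup>+x. ennreal (indicator {0..} x *\<^sub>R exp (- x\<^sup>2)) \<partial>lborel) = ennreal (sqrt pi / 2)" .
  moreover have "(if 0 \<le> x then ennreal (exp (- x\<^sup>2)) else 0) = ennreal (indicator {0..} x *\<^sub>R exp (- x\<^sup>2))" for x :: real
    by (simp add: indicator_def)
  ultimately show ?thesis by simp
qed

text \<open>Near (1, 1, 1), twice the fibre area is exactly 1 minus the squared distance to that
  point. With 1 - y_i of order 1 / sqrt n the powers converge to three half Gaussians, each
  contributing sqrt pi / 2, and the Jacobian is n^(-3/2).\<close>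

lemma PD_limit:
  "(\<lambda>n. ennreal (2 ^ n * sqrt (real n) ^ 3) * emeasure (Mxy n) (PD_coord n))
    \<longlonglongrightarrow> ennreal (pi * sqrt pi / 8)"
proof -
  define y where "y n u = 1 - u / sqrt (real n)" for n u
  define H where "H n z = (if 0 \<le> pr1 z \<and> 0 \<le> pr2 z \<and> 0 \<le> pr3 z
    then (2 * hex_area ((y n (pr1 z), y n (pr2 z)), y n (pr3 z))) ^ n else 0)" for n z
  define W where "W z = ennreal (exp (- (1 / 3 * (pr1 z + 0)\<^sup>2))) * ennreal (exp (- (1 / 3 * (pr2 z + 0)\<^sup>2)))
    * ennreal (exp (- (1 / 3 * (pr3 z + 0)\<^sup>2)))" for z
  define g where "g x = (if 0 \<le> x then ennreal (exp (- x\<^sup>2)) else 0)" for x :: real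
  define G where "G z = g (pr1 z) * g (pr2 z) * g (pr3 z)" for z
  have g[measurable]: "g \<in> borel_measurable borel" unfolding g_def by measurable
  have step: "ennreal (2 ^ n * sqrt (real n) ^ 3) * emeasure (Mxy n) (PD_coord n) = integral\<^sup>N lborel3 (H n)"
    if n: "n \<ge> 1" for n
  proof -
    define f where "f z = (if pr1 z \<le> 1 \<and> pr2 z \<le> 1 \<and> pr3 z \<le> 1 then hex_area z ^ n else 0)" for z
    have f[measurable]: "f \<in> borel_measurable lborel3" unfolding f_def by measurable
    have r: "sqrt (real n) > 0" using n by simp
    have "emeasure (Mxy n) (PD_coord n) = integral\<^sup>N lborel3 f"
      unfolding emeasure_PD_coord[OF n] f_def ..
    also have "\<dots> = ennreal (1 / sqrt (real n) ^ 3) * (\<integral>\<^sup>+z. f ((y n (pr1 z), y n (pr2 z)), y n (pr3 z)) \<partial>lborel3)"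
      unfolding y_def by (rule nn_integral_rescale_corner[OF f r])
    finally have "ennreal (2 ^ n * sqrt (real n) ^ 3) * emeasure (Mxy n) (PD_coord n)
      = ennreal (2 ^ n * sqrt (real n) ^ 3) * ennreal (1 / sqrt (real n) ^ 3) *
        (\<integral>\<^sup>+z. f ((y n (pr1 z), y n (pr2 z)), y n (pr3 z)) \<partial>lborel3)" by (simp only: mult.assoc)
    also have "ennreal (2 ^ n * sqrt (real n) ^ 3) * ennreal (1 / sqrt (real n) ^ 3) = 2 ^ n"
    proof -
      have "ennreal (2 ^ n * sqrt (real n) ^ 3) * ennreal (1 / sqrt (real n) ^ 3) = ennreal (2 ^ n)"
        using r by (subst ennreal_mult'[symmetric]) simp_all
      also have "\<dots> = 2 ^ n" by (simp flip: ennreal_power)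
      finally show ?thesis .
    qed
    also have "2 ^ n * (\<integral>\<^sup>+z. f ((y n (pr1 z), y n (pr2 z)), y n (pr3 z)) \<partial>lborel3)
      = (\<integral>\<^sup>+z. 2 ^ n * f ((y n (pr1 z), y n (pr2 z)), y n (pr3 z)) \<partial>lborel3)"
      unfolding y_def by (rule nn_integral_cmult[symmetric]) measurable
    also have "\<dots> = integral\<^sup>N lborel3 (H n)"
    proof (rule nn_integral_cong)
      fix z :: "(real \<times> real) \<times> real"
      have "y n u \<le> 1 \<longleftrightarrow> 0 \<le> u" for u using r n by (auto simp: y_def zero_le_divide_iff)
      then show "2 ^ n * f ((y n (pr1 z), y n (pr2 z)), y n (pr3 z)) = H n z"
        unfolding f_def H_def by (simp add: power_mult_distrib)
    qed
    finally show ?thesis .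
  qed
  have "(\<lambda>j. integral\<^sup>N lborel3 (H (j + 1))) \<longlonglongrightarrow> integral\<^sup>N lborel3 G"
  proof (rule nn_integral_dominated_convergence[where w = W])
    show "H (j + 1) \<in> borel_measurable lborel3" for j
      unfolding H_def y_def by measurable
    show "G \<in> borel_measurable lborel3" unfolding G_def by measurable
    show "W \<in> borel_measurable lborel3" unfolding W_def by measurable
    show "AE z in lborel3. H (j + 1) z \<le> W z" for j
    proof (rule AE_I2)
      fix z :: "(real \<times> real) \<times> real"
      define n where "n = j + 1"
      obtain u w t where z: "z = ((u, w), t)" by (metis prod.exhaust)
      have n0: "real n > 0" by (simp add: n_def)
      have "H n z \<le> W z"
      proof (cases "0 \<le> u \<and> 0 \<le> w \<and> 0 \<le> t")
        case True
        then have y1: "y n u \<le> 1" "y n w \<le> 1" "y n t \<le> 1" by (simp_all add: y_def)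
        have "(2 * hex_area ((y n u, y n w), y n t)) ^ n
          \<le> ennreal (exp (- (((1 - y n u)\<^sup>2 + (1 - y n w)\<^sup>2 + (1 - y n t)\<^sup>2) / 3))) ^ n"
          by (intro power_mono hex_area_le y1) simp
        also have "\<dots> = ennreal (exp (- (((1 - y n u)\<^sup>2 + (1 - y n w)\<^sup>2 + (1 - y n t)\<^sup>2) / 3)) ^ n)"
          by (simp add: ennreal_power)
        also have "exp (- (((1 - y n u)\<^sup>2 + (1 - y n w)\<^sup>2 + (1 - y n t)\<^sup>2) / 3)) ^ n
          = exp (real n * - (((1 - y n u)\<^sup>2 + (1 - y n w)\<^sup>2 + (1 - y n t)\<^sup>2) / 3))"
          by (rule exp_of_nat_mult[symmetric])
        also have "real n * - (((1 - y n u)\<^sup>2 + (1 - y n w)\<^sup>2 + (1 - y n t)\<^sup>2) / 3)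
          = - (1 / 3 * (u + 0)\<^sup>2) + - (1 / 3 * (w + 0)\<^sup>2) + - (1 / 3 * (t + 0)\<^sup>2)"
        proof -
          have "(1 - y n v)\<^sup>2 = v\<^sup>2 / real n" for v by (simp add: y_def power_divide)
          then show ?thesis using n0 by (simp add: field_simps)
        qed
        also have "ennreal (exp \<dots>) = W z"
          unfolding W_def z fst_conv snd_conv exp_add by (simp add: ennreal_mult')
        finally show ?thesis using True by (simp add: H_def z)
      next
        case False
        then show ?thesis unfolding H_def z fst_conv snd_conv by (simp only: if_False zero_le)
      qed
      then show "H (j + 1) z \<le> W z" by (simp add: n_def)
    qed
    have "integral\<^sup>N lborel3 W = (\<integral>\<^sup>+x. ennreal (exp (- (1 / 3 * (x + 0)\<^sup>2))) \<partial>lborel)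
        * (\<integral>\<^sup>+x. ennreal (exp (- (1 / 3 * (x + 0)\<^sup>2))) \<partial>lborel) * (\<integral>\<^sup>+x. ennreal (exp (- (1 / 3 * (x + 0)\<^sup>2))) \<partial>lborel)"
      unfolding W_def by (rule nn_integral_lborel3_prod) measurable
    moreover have "(\<integral>\<^sup>+x. ennreal (exp (- (1 / 3 * (x + 0)\<^sup>2))) \<partial>lborel) = ennreal (sqrt (pi / (1 / 3)))"
      by (rule nn_integral_gauss) simp
    ultimately show "integral\<^sup>N lborel3 W < \<infinity>" by (simp add: ennreal_mult_less_top)
    show "AE z in lborel3. (\<lambda>j. H (j + 1) z) \<longlonglongrightarrow> G z"
    proof (rule AE_I2)
      fix z :: "(real \<times> real) \<times> real"
      obtain u w t where z: "z = ((u, w), t)" by (metis prod.exhaust)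
      have "(\<lambda>n. H n z) \<longlonglongrightarrow> G z"
      proof (cases "0 \<le> u \<and> 0 \<le> w \<and> 0 \<le> t")
        case True
        \<comment> \<open>Below 1/3 the three deviations sum to at most 1, so the hexagon formula
          applies and the base of the power is nonnegative.\<close>
        have small: "\<forall>\<^sub>F n in sequentially. v / sqrt (real n) < 1 / 3" for v
          using tendsto_divide_sqrt[of v] by (rule order_tendstoD(2)) simp
        have ev: "\<forall>\<^sub>F n in sequentially. ennreal ((1 + - (u\<^sup>2 + w\<^sup>2 + t\<^sup>2) / real n) ^ n) = H n z"
          using small[of u] small[of w] small[of t] eventually_gt_at_top[of 0]
        proof eventually_elim
          case (elim n)
          define a b c where "a = u / sqrt (real n)" and "b = w / sqrt (real n)" and "c = t / sqrt (real n)"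
          have abc: "0 \<le> a" "0 \<le> b" "0 \<le> c" "a < 1 / 3" "b < 1 / 3" "c < 1 / 3"
            using elim True by (simp_all add: a_def b_def c_def)
          have sq: "a\<^sup>2 + b\<^sup>2 + c\<^sup>2 \<le> 1" using abc by (intro sum_squares_le_one) auto
          have "emeasure lborel (hexagon 0 0 0 (1 - a) (1 - b) (1 - c))
            = ennreal (((2 - a - b - c)\<^sup>2 - (1 - b - c)\<^sup>2 - (1 - a - c)\<^sup>2 - (1 - a - b)\<^sup>2) / 2)"
            by (rule emeasure_hexagon) (use abc in auto)
          also have "((2 - a - b - c)\<^sup>2 - (1 - b - c)\<^sup>2 - (1 - a - c)\<^sup>2 - (1 - a - b)\<^sup>2) / 2 = (1 - a\<^sup>2 - b\<^sup>2 - c\<^sup>2) / 2"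
            by (simp add: power2_eq_square algebra_simps)
          finally have "2 * hex_area ((y n u, y n w), y n t) = ennreal 2 * ennreal ((1 - a\<^sup>2 - b\<^sup>2 - c\<^sup>2) / 2)"
            by (simp add: hex_area_def y_def a_def b_def c_def)
          also have "\<dots> = ennreal (1 - a\<^sup>2 - b\<^sup>2 - c\<^sup>2)"
          proof -
            have "ennreal 2 * ennreal (X / 2) = ennreal X" for X
              by (subst ennreal_mult'[symmetric]) simp_all
            then show ?thesis .
          qed
          also have "1 - a\<^sup>2 - b\<^sup>2 - c\<^sup>2 = 1 + - (u\<^sup>2 + w\<^sup>2 + t\<^sup>2) / real n"
            unfolding a_def b_def c_def by (simp add: power_divide diff_divide_distrib)
          finally have h: "2 * hex_area ((y n u, y n w), y n t) = ennreal (1 + - (u\<^sup>2 + w\<^sup>2 + t\<^sup>2) / real n)" .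
          have "1 - a\<^sup>2 - b\<^sup>2 - c\<^sup>2 = 1 + - (u\<^sup>2 + w\<^sup>2 + t\<^sup>2) / real n"
            unfolding a_def b_def c_def by (simp add: power_divide diff_divide_distrib)
          then have "0 \<le> 1 + - (u\<^sup>2 + w\<^sup>2 + t\<^sup>2) / real n" using sq by linarith
          then show ?case using True unfolding H_def z fst_conv snd_conv h by (simp add: ennreal_power)
        qed
        have "(\<lambda>n. ennreal ((1 + - (u\<^sup>2 + w\<^sup>2 + t\<^sup>2) / real n) ^ n)) \<longlonglongrightarrow> ennreal (exp (- (u\<^sup>2 + w\<^sup>2 + t\<^sup>2)))"
          by (intro tendsto_ennrealI tendsto_one_plus_over_n_power tendsto_const)
        then have "(\<lambda>n. H n z) \<longlonglongrightarrow> ennreal (exp (- (u\<^sup>2 + w\<^sup>2 + t\<^sup>2)))"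
          by (rule Lim_transform_eventually) (rule ev)
        also have "- (u\<^sup>2 + w\<^sup>2 + t\<^sup>2) = - u\<^sup>2 + - w\<^sup>2 + - t\<^sup>2" by simp
        also have "ennreal (exp (- u\<^sup>2 + - w\<^sup>2 + - t\<^sup>2)) = G z"
          unfolding G_def g_def z fst_conv snd_conv exp_add using True by (simp add: ennreal_mult')
        finally show ?thesis .
      next
        case False
        then have "H n z = 0" "G z = 0" for n by (auto simp: H_def G_def g_def z)
        then show ?thesis by simp
      qed
      then show "(\<lambda>j. H (j + 1) z) \<longlonglongrightarrow> G z" by (rule LIMSEQ_ignore_initial_segment)
    qed
  qed
  also have "integral\<^sup>N lborel3 G = ennreal (pi * sqrt pi / 8)"
  proof -
    have "integral\<^sup>N lborel3 G = integral\<^sup>N lborel g * integral\<^sup>N lborel g * integral\<^sup>N lborel g"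
      unfolding G_def by (rule nn_integral_lborel3_prod) measurable
    also have "integral\<^sup>N lborel g = ennreal (sqrt pi / 2)" unfolding g_def by (rule nn_integral_half_gauss)
    also have "ennreal (sqrt pi / 2) * ennreal (sqrt pi / 2) * ennreal (sqrt pi / 2)
      = ennreal (sqrt pi / 2 * (sqrt pi / 2) * (sqrt pi / 2))" by (simp add: ennreal_mult'[symmetric])
    also have "sqrt pi / 2 * (sqrt pi / 2) * (sqrt pi / 2) = pi * sqrt pi / 8" by simp
    finally show ?thesis .
  qed
  finally have "(\<lambda>n. integral\<^sup>N lborel3 (H n)) \<longlonglongrightarrow> ennreal (pi * sqrt pi / 8)"
    by (rule LIMSEQ_offset)
  moreover have "\<forall>\<^sub>F n in sequentially. integral\<^sup>N lborel3 (H n)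
    = ennreal (2 ^ n * sqrt (real n) ^ 3) * emeasure (Mxy n) (PD_coord n)"
    using eventually_ge_at_top[of 1] by eventually_elim (rule step[symmetric])
  ultimately show ?thesis by (rule Lim_transform_eventually)
qed

section \<open>Matching constants and passing to volumes\<close>

lemma beta_prim_limit:
  fixes \<theta> :: real
  assumes "\<theta> = 0 \<or> \<theta> = 5 / 6"
  shows "(\<lambda>n. (beta_prim n 1 - beta_prim n \<theta>) * (real n * real (n - 1) * real (n - 2))) \<longlonglongrightarrow> 1 / 8"
proof -
  \<comment> \<open>The value at 1 equals 1 / ((2n+1) (2n+2) (2n+3)), hence the limit 1 /
    2^3.\<close>
  have "(\<lambda>n. beta_prim n 1 * (real n * (real n - 1) * (real n - 2))) \<longlonglongrightarrow> 1 / 8"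
    unfolding beta_prim_def power_one of_nat_add of_nat_mult of_nat_numeral of_nat_1 by real_asymp
  moreover have "(\<lambda>n. beta_prim n \<theta> * (real n * (real n - 1) * (real n - 2))) \<longlonglongrightarrow> 0"
  proof (cases "\<theta> = 0")
    case False
    then have \<theta>: "\<theta> = 5 / 6" using assms by simp
    \<comment> \<open>Isolates the geometric factor (25/36)^n, which beats the cubic factor.\<close>
    have e: "\<theta> ^ (2 * n + k) = (25 / 36) ^ n * (5 / 6) ^ k" for n k
      unfolding \<theta> power_add power_mult by (simp add: power2_eq_square)
    show ?thesis
      unfolding beta_prim_def e of_nat_add of_nat_mult of_nat_numeral of_nat_1 by real_asymp
  qed simp
  ultimately have "(\<lambda>n. beta_prim n 1 * (real n * (real n - 1) * (real n - 2)) - beta_prim n \<theta> * (real n * (real n - 1) * (real n - 2))) \<longlonglongrightarrow> 1 / 8 - 0"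
    by (rule tendsto_diff)
  then have "(\<lambda>n. (beta_prim n 1 - beta_prim n \<theta>) * (real n * (real n - 1) * (real n - 2))) \<longlonglongrightarrow> 1 / 8"
    by (simp only: left_diff_distrib diff_zero)
  moreover have "\<forall>\<^sub>F n in sequentially. (beta_prim n 1 - beta_prim n \<theta>) * (real n * (real n - 1) * (real n - 2))
      = (beta_prim n 1 - beta_prim n \<theta>) * (real n * real (n - 1) * real (n - 2))"
    using eventually_ge_at_top[of 2] by eventually_elim (simp add: of_nat_diff)
  ultimately show ?thesis by (rule Lim_transform_eventually)
qed

lemma gap_bound_limit:
  assumes \<theta>: "\<theta> = 0 \<or> \<theta> = 5 / 6" and \<delta>: "0 \<le> \<delta>" "\<delta> < 1 / 3"
  shows "(\<lambda>n. ennreal (3 ^ n * (real n)\<^sup>2) * (ennreal (beta_prim n 1 - beta_prim n \<theta>) * laplace_int n \<delta>))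
    \<longlonglongrightarrow> ennreal (pi / (12 * sqrt 3))"
proof -
  have "(\<lambda>n. ennreal ((beta_prim n 1 - beta_prim n \<theta>) * (real n * real (n - 1) * real (n - 2))) *
      (ennreal (3 ^ n * (real n)\<^sup>2 / (real n * real (n - 1) * real (n - 2))) * laplace_int n \<delta>))
    \<longlonglongrightarrow> ennreal (1 / 8) * ennreal (2 * pi / (3 * sqrt 3))"
    by (intro tendsto_mult_ennreal tendsto_ennrealI beta_prim_limit[OF \<theta>] laplace_int_limit \<delta>) auto
  also have "ennreal (1 / 8) * ennreal (2 * pi / (3 * sqrt 3)) = ennreal (pi / (12 * sqrt 3))"
    by (subst ennreal_mult'[symmetric]) simp_all
  finally have lim: "(\<lambda>n. ennreal ((beta_prim n 1 - beta_prim n \<theta>) * (real n * real (n - 1) * real (n - 2))) *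
      (ennreal (3 ^ n * (real n)\<^sup>2 / (real n * real (n - 1) * real (n - 2))) * laplace_int n \<delta>))
    \<longlonglongrightarrow> ennreal (pi / (12 * sqrt 3))" .
  show ?thesis
  proof (rule Lim_transform_eventually[OF lim])
    show "\<forall>\<^sub>F n in sequentially. ennreal ((beta_prim n 1 - beta_prim n \<theta>) * (real n * real (n - 1) * real (n - 2))) *
      (ennreal (3 ^ n * (real n)\<^sup>2 / (real n * real (n - 1) * real (n - 2))) * laplace_int n \<delta>)
      = ennreal (3 ^ n * (real n)\<^sup>2) * (ennreal (beta_prim n 1 - beta_prim n \<theta>) * laplace_int n \<delta>)"
      using eventually_ge_at_top[of 3]
    proof eventually_elim
      case (elim n)
      define N where "N = real n * real (n - 1) * real (n - 2)"
      have N: "N > 0" using elim by (simp add: N_def)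
      have "ennreal (b * N) * (ennreal (r / N) * L) = ennreal r * (ennreal b * L)" if "0 \<le> r" for b r L
      proof -
        have "ennreal N * ennreal (r / N) = ennreal r"
          using N that by (subst ennreal_mult'[symmetric]) simp_all
        moreover have "ennreal (b * N) * (ennreal (r / N) * L) = ennreal b * (ennreal N * ennreal (r / N)) * L"
          using N by (simp add: ennreal_mult'' mult.assoc)
        ultimately show ?thesis by (simp only: mult_ac)
      qed
      then show ?case unfolding N_def[symmetric] by simp
    qed
  qed
qed

text \<open>The upper bound (theta = 0, delta = 0) and the lower bound (theta = 5/6, delta = 1/6)
  have the same limit.\<close>

lemma gap_limit:
  "(\<lambda>n. ennreal (3 ^ n * (real n)\<^sup>2) * emeasure (Mxy n) (gap_coord n)) \<longlonglongrightarrow> ennreal (pi / (12 * sqrt 3))"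
proof (rule tendsto_sandwich)
  show "\<forall>\<^sub>F n in sequentially. ennreal (3 ^ n * (real n)\<^sup>2) * (ennreal (beta_prim n 1 - beta_prim n (5 / 6)) * laplace_int n (1 / 6))
    \<le> ennreal (3 ^ n * (real n)\<^sup>2) * emeasure (Mxy n) (gap_coord n)"
    using eventually_ge_at_top[of 1] by eventually_elim (intro mult_left_mono emeasure_gap_ge, simp_all)
  show "\<forall>\<^sub>F n in sequentially. ennreal (3 ^ n * (real n)\<^sup>2) * emeasure (Mxy n) (gap_coord n)
    \<le> ennreal (3 ^ n * (real n)\<^sup>2) * (ennreal (beta_prim n 1 - beta_prim n 0) * laplace_int n 0)"
    using eventually_ge_at_top[of 1] unfolding beta_prim_0 diff_zero
    by eventually_elim (intro mult_left_mono emeasure_gap_le, simp_all)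
  show "(\<lambda>n. ennreal (3 ^ n * (real n)\<^sup>2) * (ennreal (beta_prim n 1 - beta_prim n (5 / 6)) * laplace_int n (1 / 6)))
    \<longlonglongrightarrow> ennreal (pi / (12 * sqrt 3))"
    by (rule gap_bound_limit) auto
  show "(\<lambda>n. ennreal (3 ^ n * (real n)\<^sup>2) * (ennreal (beta_prim n 1 - beta_prim n 0) * laplace_int n 0))
    \<longlonglongrightarrow> ennreal (pi / (12 * sqrt 3))"
    by (rule gap_bound_limit) auto
qed

lemma tendsto_measure_of_emeasure:
  assumes lim: "(\<lambda>n. ennreal (a n) * emeasure (M n) (S n)) \<longlonglongrightarrow> ennreal l" and "0 \<le> l" "\<And>n. 0 \<le> a n"
  shows "(\<lambda>n. a n * measure (M n) (S n)) \<longlonglongrightarrow> l"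
proof -
  have "(\<lambda>n. enn2real (ennreal (a n) * emeasure (M n) (S n))) \<longlonglongrightarrow> l"
    by (rule tendsto_enn2real[OF lim]) fact
  then show ?thesis using assms(3) by (simp add: enn2real_mult measure_def)
qed

lemma Vol_PD: "Vol 3 n (P_set 3 n \<inter> D_set 3 n) = measure (Mxy n) (PD_coord n)"
  unfolding Vol_def coord_proj_PD coord_lebesgue_def by (rule measure_completion) (rule PD_coord_measurable)

lemma Vol_hull:
  assumes n: "n \<ge> 1" and fin: "emeasure (Mxy n) (PD_coord n) \<noteq> \<infinity>"
  shows "Vol 3 n (integer_hull 3 n) = measure (Mxy n) (PD_coord n) - measure (Mxy n) (gap_coord n)"
proof -
  have "Vol 3 n (integer_hull 3 n) = measure (Mxy n) (PD_coord n - gap_coord n)"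
    unfolding Vol_def coord_proj_hull[OF n] coord_lebesgue_def
    by (intro measure_completion sets.Diff PD_coord_measurable gap_coord_measurable)
  also have "\<dots> = measure (Mxy n) (PD_coord n) - measure (Mxy n) (gap_coord n)"
    using fin by (intro measure_Diff PD_coord_measurable gap_coord_measurable) (auto simp: gap_coord_def)
  finally show ?thesis .
qed

theorem proposition20:
  shows "(\<lambda>n. Vol 3 n (P_set 3 n \<inter> D_set 3 n) - Vol 3 n (integer_hull 3 n))
           \<sim>[sequentially]
         (\<lambda>n. pi / (12 * sqrt 3) * (1 / (2 ^ n * real n ^ 2)) * (2 / 3) ^ n)
       \<and>
         (\<lambda>n. 1 - Vol 3 n (integer_hull 3 n) / Vol 3 n (P_set 3 n \<inter> D_set 3 n))
           \<sim>[sequentially]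
         (\<lambda>n. 2 / (3 * sqrt (3 * pi)) * (1 / sqrt (real n)) * (2 / 3) ^ n)"
proof -
  define V where "V n = measure (Mxy n) (PD_coord n)" for n
  define G where "G n = measure (Mxy n) (gap_coord n)" for n
  have V: "(\<lambda>n. 2 ^ n * sqrt (real n) ^ 3 * V n) \<longlonglongrightarrow> pi * sqrt pi / 8"
    unfolding V_def by (rule tendsto_measure_of_emeasure[OF PD_limit]) simp_all
  have G: "(\<lambda>n. 3 ^ n * (real n)\<^sup>2 * G n) \<longlonglongrightarrow> pi / (12 * sqrt 3)"
    unfolding G_def by (rule tendsto_measure_of_emeasure[OF gap_limit]) simp_all
  \<comment> \<open>Finiteness, needed to subtract measures, is read off from the finite limit and
    so is available for large n.\<close>
  have fin: "\<forall>\<^sub>F n in sequentially. emeasure (Mxy n) (PD_coord n) \<noteq> \<infinity>"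
  proof -
    have "ennreal (pi * sqrt pi / 8) < \<infinity>" by simp
    with PD_limit have "\<forall>\<^sub>F n in sequentially. ennreal (2 ^ n * sqrt (real n) ^ 3) * emeasure (Mxy n) (PD_coord n) < \<infinity>"
      by (rule order_tendstoD(2))
    then show ?thesis
      using eventually_gt_at_top[of 0]
    proof eventually_elim
      case (elim n)
      have "ennreal (2 ^ n * sqrt (real n) ^ 3) \<noteq> 0" using elim(2) by (simp add: ennreal_eq_0_iff not_le)
      then show ?case using elim(1) by (auto simp: ennreal_mult_top)
    qed
  qed
  have ev: "\<forall>\<^sub>F n in sequentially. n > 0 \<and> V n > 0 \<and> Vol 3 n (P_set 3 n \<inter> D_set 3 n) = V n
      \<and> Vol 3 n (integer_hull 3 n) = V n - G n"
  proof -
    have "\<forall>\<^sub>F n in sequentially. 0 < 2 ^ n * sqrt (real n) ^ 3 * V n"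
      using V by (rule order_tendstoD(1)) simp
    then show ?thesis
      using fin eventually_ge_at_top[of 1]
    proof eventually_elim
      case (elim n)
      have "V n \<noteq> 0" using elim(1) by auto
      moreover have "0 \<le> V n" by (simp add: V_def)
      ultimately have "V n > 0" by simp
      then show ?case using elim Vol_PD[of n] Vol_hull[OF elim(3,2)] by (simp only: V_def G_def) simp
    qed
  qed
  have first: "(\<lambda>n. Vol 3 n (P_set 3 n \<inter> D_set 3 n) - Vol 3 n (integer_hull 3 n))
      \<sim>[sequentially] (\<lambda>n. pi / (12 * sqrt 3) * (1 / (2 ^ n * real n ^ 2)) * (2 / 3) ^ n)"
  proof (rule asymp_equivI')
    have "(\<lambda>n. 3 ^ n * (real n)\<^sup>2 * G n / (pi / (12 * sqrt 3))) \<longlonglongrightarrow> (pi / (12 * sqrt 3)) / (pi / (12 * sqrt 3))"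
      by (intro tendsto_divide G tendsto_const) simp
    then have lim: "(\<lambda>n. 3 ^ n * (real n)\<^sup>2 * G n / (pi / (12 * sqrt 3))) \<longlonglongrightarrow> 1" by simp
    show "(\<lambda>n. (Vol 3 n (P_set 3 n \<inter> D_set 3 n) - Vol 3 n (integer_hull 3 n)) /
        (pi / (12 * sqrt 3) * (1 / (2 ^ n * real n ^ 2)) * (2 / 3) ^ n)) \<longlonglongrightarrow> 1"
    proof (rule Lim_transform_eventually[OF lim])
      show "\<forall>\<^sub>F n in sequentially. 3 ^ n * (real n)\<^sup>2 * G n / (pi / (12 * sqrt 3))
        = (Vol 3 n (P_set 3 n \<inter> D_set 3 n) - Vol 3 n (integer_hull 3 n)) /
        (pi / (12 * sqrt 3) * (1 / (2 ^ n * real n ^ 2)) * (2 / 3) ^ n)"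
        using ev
      proof eventually_elim
        case (elim n)
        have h: "3 ^ n * m * g / k = g / (k * (1 / (2 ^ n * m)) * (2 / 3) ^ n)" if "m > 0" "k > 0" for m g k :: real
          using that by (simp add: power_divide field_simps)
        have d: "Vol 3 n (P_set 3 n \<inter> D_set 3 n) - Vol 3 n (integer_hull 3 n) = G n" using elim by simp
        show ?case unfolding d by (rule h) (use elim in simp_all)
      qed
    qed
  qed
  have second: "(\<lambda>n. 1 - Vol 3 n (integer_hull 3 n) / Vol 3 n (P_set 3 n \<inter> D_set 3 n))
      \<sim>[sequentially] (\<lambda>n. 2 / (3 * sqrt (3 * pi)) * (1 / sqrt (real n)) * (2 / 3) ^ n)"
  proof (rule asymp_equivI')
    let ?k = "2 / (3 * sqrt (3 * pi)) :: real"
    \<comment> \<open>The ratio of the two limits: 8 / (12 sqrt 3 sqrt pi) = 2 / (3 sqrt (3 pi)),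
      and n^2 / n^(3/2) leaves sqrt n.\<close>
    have "(\<lambda>n. 3 ^ n * (real n)\<^sup>2 * G n / (2 ^ n * sqrt (real n) ^ 3 * V n) / ?k)
      \<longlonglongrightarrow> (pi / (12 * sqrt 3)) / (pi * sqrt pi / 8) / ?k"
      by (intro tendsto_divide G V tendsto_const) simp_all
    also have "(pi / (12 * sqrt 3)) / (pi * sqrt pi / 8) / ?k = 1"
      by (simp add: real_sqrt_mult field_simps)
    finally have lim: "(\<lambda>n. 3 ^ n * (real n)\<^sup>2 * G n / (2 ^ n * sqrt (real n) ^ 3 * V n) / ?k) \<longlonglongrightarrow> 1" .
    show "(\<lambda>n. (1 - Vol 3 n (integer_hull 3 n) / Vol 3 n (P_set 3 n \<inter> D_set 3 n)) /
        (?k * (1 / sqrt (real n)) * (2 / 3) ^ n)) \<longlonglongrightarrow> 1"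
    proof (rule Lim_transform_eventually[OF lim])
      show "\<forall>\<^sub>F n in sequentially. 3 ^ n * (real n)\<^sup>2 * G n / (2 ^ n * sqrt (real n) ^ 3 * V n) / ?k
        = (1 - Vol 3 n (integer_hull 3 n) / Vol 3 n (P_set 3 n \<inter> D_set 3 n)) / (?k * (1 / sqrt (real n)) * (2 / 3) ^ n)"
        using ev
      proof eventually_elim
        case (elim n)
        define s where "s = sqrt (real n)"
        have s: "s > 0" "real n = s\<^sup>2" using elim by (simp_all add: s_def)
        have "1 - (V n - G n) / V n = G n / V n" using elim by (simp add: field_simps)
        then have "(1 - Vol 3 n (integer_hull 3 n) / Vol 3 n (P_set 3 n \<inter> D_set 3 n)) / (?k * (1 / s) * (2 / 3) ^ n)
          = G n / V n / (?k * (1 / s) * (2 / 3) ^ n)" using elim by simp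
        also have "\<dots> = 3 ^ n * (s\<^sup>2)\<^sup>2 * G n / (2 ^ n * s ^ 3 * V n) / ?k"
        proof -
          have h: "G n / V n / (k * (1 / s) * (2 / 3) ^ n) = 3 ^ n * (s\<^sup>2)\<^sup>2 * G n / (2 ^ n * s ^ 3 * V n) / k"
            if "k > 0" for k
            using that s(1) elim by (simp add: power_divide power2_eq_square power3_eq_cube field_simps)
          show ?thesis by (rule h) simp
        qed
        finally show ?case unfolding s_def[symmetric] unfolding s(2) by (rule sym)
      qed
    qed
  qed
  show ?thesis using first second by (rule conjI)
qed

end
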